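(* Let $n\ge 1$, let $\mathcal{D}=\{z\in\mathbb{C}:|z|\le 1\}$, and put $C=2^{16}$. (i) Let $f:\mathbb{F}_5^n\to\mathcal{D}$ be a function and let $0<\eta\le 1$. If $\|f\|_{U^3(\mathbb{F}_5^n)}\ge\eta$, then there exists a linear subspace $W\le\mathbb{F}_5^n$ of codimension at most $(2/\eta)^C$ such that $$\mathbb{E}_{y\in\mathbb{F}_5^n}\|f\|_{u^3(y+W)}\ge(\eta/2)^C.$$ In particular, there exists $y\in\mathbb{F}_5^n$ such that $\|f\|_{u^3(y+W)}\ge(\eta/2)^C$. (ii) Conversely, for every linear subspace $W\le\mathbb{F}_5^n$, every function $f:\mathbb{F}_5^n\to\mathbb{C}$ and every $y\in\mathbb{F}_5^n$, $$\|f\|_{U^3(\mathbb{F}_5^n)}\ge\|f\|_{u^3(\mathbb{F}_5^n)}\ge 5^{-n}|W|\,\|f\|_{u^3(y+W)}.$$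
   Context: For a finite nonempty set $B$, $\mathbb{E}_{x\in B}f(x)=|B|^{-1}\sum_{x\in B}f(x)$. Write $e(t)=e^{2\pi i t}$ for $t\in\mathbb{R}/\mathbb{Z}$. For a finite abelian group $G$ and $f:G\to\mathbb{C}$, the Gowers norm $\|f\|_{U^3(G)}\ge 0$ is defined by $$\|f\|_{U^3(G)}^{8}=\mathbb{E}_{x,h_1,h_2,h_3\in G}\prod_{\omega\in\{0,1\}^3}\mathcal{C}^{|\omega|}f(x+\omega_1h_1+\omega_2h_2+\omega_3h_3),$$ where $|\omega|=\omega_1+\omega_2+\omega_3$ and $\mathcal{C}$ is complex conjugation. For a nonempty subset $B\subseteq G$, a function $\phi:B\to\mathbb{R}/\mathbb{Z}$ is a (locally) quadratic phase function on $B$ if $\sum_{\omega\in\{0,1\}^3}(-1)^{|\omega|}\phi(x+\omega_1h_1+\omega_2h_2+\omega_3h_3)=0$ whenever $x,h_1,h_2,h_3\in G$ are such that all eight points $x+\omega_1h_1+\omega_2h_2+\omega_3h_3$ ($\omega\in\{0,1\}^3$) lie in $B$. For $f$ defined on (a set containing) $B$, $$\|f\|_{u^3(B)}=\sup_\phi\left|\mathbb{E}_{x\in B}f(x)e(-\phi(x))\right|,$$ the supremum being over all quadratic phase functions $\phi$ on $B$. *)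

theory Defs
  imports "HOL-Analysis.Analysis" "HOL-Library.Real_Mod"
begin

definition avg :: "'a set \<Rightarrow> ('a \<Rightarrow> 'b::field) \<Rightarrow> 'b" where
  "avg B f = (\<Sum>x\<in>B. f x) / of_nat (card B)"

text \<open>
  The additive character \<open>e(t) = exp(2 \<pi> i t)\<close>, on real representatives of \<open>\<real>/\<int>\<close>.
\<close>
definition echar :: "real \<Rightarrow> complex" where
  "echar t = exp (2 * of_real pi * \<i> * of_real t)"

text \<open>
  The index set \<open>{0,1}\<^sup>3\<close> is the type \<^typ>\<open>bool \<times> bool \<times> bool\<close>.
\<close>
fun weight :: "bool \<times> bool \<times> bool \<Rightarrow> nat" where
  "weight (w1, w2, w3) = of_bool w1 + of_bool w2 + of_bool w3"

fun vertex :: "'a::ab_group_add \<Rightarrow> 'a \<Rightarrow> 'a \<Rightarrow> 'a \<Rightarrow> bool \<times> bool \<times> bool \<Rightarrow> 'a" where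
  "vertex x h1 h2 h3 (w1, w2, w3) =
     x + (if w1 then h1 else 0) + (if w2 then h2 else 0) + (if w3 then h3 else 0)"

definition U3avg :: "('a::{ab_group_add,finite} \<Rightarrow> complex) \<Rightarrow> complex" where
  "U3avg f = avg UNIV (\<lambda>(x, h1, h2, h3).
     \<Prod>\<omega>\<in>UNIV. (cnj ^^ weight \<omega>) (f (vertex x h1 h2 h3 \<omega>)))"

text \<open>
  The average \<^term>\<open>U3avg f\<close> is a nonnegative real, so taking the real part loses nothing;
  see \<open>U3norm_nonneg\<close> and \<open>U3norm_power8\<close> below.
\<close>
definition U3norm :: "('a::{ab_group_add,finite} \<Rightarrow> complex) \<Rightarrow> real" where
  "U3norm f = root 8 (Re (U3avg f))"

text \<open>
  A function \<open>B \<rightarrow> \<real>/\<int>\<close> is given by real representatives, equality in \<open>\<real>/\<int>\<close> being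
  congruence modulo 1; the values of \<open>\<phi>\<close> outside \<open>B\<close> are irrelevant.
\<close>
definition quadratic_phase :: "'a::ab_group_add set \<Rightarrow> ('a \<Rightarrow> real) \<Rightarrow> bool" where
  "quadratic_phase B \<phi> \<longleftrightarrow>
     (\<forall>x h1 h2 h3. (\<forall>\<omega>. vertex x h1 h2 h3 \<omega> \<in> B) \<longrightarrow>
        [(\<Sum>\<omega>\<in>UNIV. (-1) ^ weight \<omega> * \<phi> (vertex x h1 h2 h3 \<omega>)) = 0] (rmod 1))"

definition u3norm :: "('a::ab_group_add \<Rightarrow> complex) \<Rightarrow> 'a set \<Rightarrow> real" where
  "u3norm f B = (SUP \<phi>\<in>{\<phi>. quadratic_phase B \<phi>}. cmod (avg B (\<lambda>x. f x * echar (- \<phi> x))))"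

lemma U3avg_eq:
  fixes f :: "'a::{ab_group_add,finite} \<Rightarrow> complex"
  defines "g \<equiv> \<lambda>h1 h2 x. f x * cnj (f (x + h1)) * cnj (f (x + h2)) * f (x + h1 + h2)"
  shows "U3avg f =
    of_real ((\<Sum>h1\<in>UNIV. \<Sum>h2\<in>UNIV. (cmod (\<Sum>x\<in>UNIV. g h1 h2 x))\<^sup>2) / real CARD('a \<times> 'a \<times> 'a \<times> 'a))"
proof -
  have cube: "(\<Prod>\<omega>\<in>UNIV. (cnj ^^ weight \<omega>) (f (vertex x h1 h2 h3 \<omega>))) =
      g h1 h2 x * cnj (g h1 h2 (x + h3))" for x h1 h2 h3
    by (simp add: g_def UNIV_Times_UNIV[symmetric] UNIV_bool prod.cartesian_product[symmetric]
          add_ac mult_ac numeral_2_eq_2 numeral_3_eq_3 del: UNIV_Times_UNIV)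
  have shift: "(\<Sum>h3\<in>UNIV. cnj (g h1 h2 (x + h3))) = (\<Sum>y\<in>UNIV. cnj (g h1 h2 y))" for h1 h2 x
    by (rule sum.reindex_bij_witness[of _ "\<lambda>y. y - x" "\<lambda>h. x + h"]) auto
  have "(\<Sum>(x, h1, h2, h3)\<in>UNIV. \<Prod>\<omega>\<in>UNIV. (cnj ^^ weight \<omega>) (f (vertex x h1 h2 h3 \<omega>))) =
      (\<Sum>x\<in>UNIV. \<Sum>h1\<in>UNIV. \<Sum>h2\<in>UNIV. \<Sum>h3\<in>UNIV. g h1 h2 x * cnj (g h1 h2 (x + h3)))"
    by (simp only: cube) (simp only: UNIV_Times_UNIV[symmetric] sum.cartesian_product)
  also have "\<dots> = (\<Sum>h1\<in>UNIV. \<Sum>x\<in>UNIV. \<Sum>h2\<in>UNIV. g h1 h2 x * cnj (\<Sum>y\<in>UNIV. g h1 h2 y))"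
    by (subst sum.swap) (simp add: sum_distrib_left[symmetric] shift)
  also have "\<dots> = (\<Sum>h1\<in>UNIV. \<Sum>h2\<in>UNIV. \<Sum>x\<in>UNIV. g h1 h2 x * cnj (\<Sum>y\<in>UNIV. g h1 h2 y))"
    by (rule sum.cong[OF refl]) (rule sum.swap)
  also have "\<dots> = (\<Sum>h1\<in>UNIV. \<Sum>h2\<in>UNIV. of_real ((cmod (\<Sum>x\<in>UNIV. g h1 h2 x))\<^sup>2))"
    by (simp only: sum_distrib_right[symmetric] complex_norm_square)
  finally show ?thesis
    by (simp add: U3avg_def avg_def)
qed

lemma U3norm_nonneg: "U3norm f \<ge> 0"
  unfolding U3norm_def U3avg_eq by (simp add: sum_nonneg)

lemma U3norm_power8: "of_real (U3norm f ^ 8) = U3avg f"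
  unfolding U3norm_def U3avg_eq by (simp add: sum_nonneg divide_nonneg_nonneg)

lemma quadratic_phase_0: "quadratic_phase B (\<lambda>_. 0)"
  by (simp add: quadratic_phase_def)

lemma cmod_avg_echar_le:
  "cmod (avg B (\<lambda>x. f x * echar (- \<phi> x))) \<le> (\<Sum>x\<in>B. cmod (f x)) / card B"
proof -
  have "cmod (\<Sum>x\<in>B. f x * echar (- \<phi> x)) \<le> (\<Sum>x\<in>B. cmod (f x))"
    by (rule order_trans[OF norm_sum]) (simp add: norm_mult echar_def)
  then show ?thesis
    by (simp add: avg_def norm_divide divide_right_mono)
qed

lemma u3norm_bdd_above:
  "bdd_above ((\<lambda>\<phi>. cmod (avg B (\<lambda>x. f x * echar (- \<phi> x)))) ` {\<phi>. quadratic_phase B \<phi>})"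
  by (rule bdd_aboveI2) (rule cmod_avg_echar_le)

end

theory Submission
  imports Defs
begin

text \<open>
  If the \<open>U\<^sup>3\<close> norm of \<open>f\<close> is large then many derivatives \<open>f(x + h) cnj f(x)\<close> correlate with a character
  of frequency \<open>\<xi> h\<close>, and two applications of Cauchy--Schwarz show that the graph of \<open>\<xi>\<close>
  contains a positive proportion of all additive quadruples. By the
  Balog--Szemeredi--Gowers theorem and the Pluennecke--Ruzsa inequality a large piece of the
  graph has small iterated sumsets, so that only few differences of such sums are vertical; a
  generic subspace of frequencies avoids these, which leaves a dense set \<open>H\<close> on which \<open>\<xi>\<close> is a
  Freiman homomorphism. Since \<open>2H - 2H\<close> contains a subspace \<open>W\<close> of small codimension
  (Bogolyubov), \<open>\<xi>\<close> agrees with an affine map \<open>\<xi>\<^sub>0 + M\<close> on a dense part of a coset of \<open>W\<close>.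
  Cauchy--Schwarz forces \<open>M\<close> to be symmetric on a subspace \<open>W'\<close> of bounded index, where
  \<open>M u \<cdot> v\<close> is the polarisation of \<open>q v = (M v \<cdot> v)/2\<close>; removing the phase \<open>q\<close> turns the
  correlation of derivatives on \<open>W'\<close> into a plain convolution, whose size is controlled by the
  correlation of \<open>f\<close> with quadratic phases on the cosets of \<open>W'\<close>.

  For the converse, multiplication by a global quadratic phase leaves the \<open>U\<^sup>3\<close> norm unchanged,
  and a phase on \<open>y + W\<close> extends to the whole space through a linear projection onto \<open>W\<close>, the
  indicator function of the coset being an average of characters.
\<close>

section \<open>Sumsets\<close>

text \<open>The codimension may be polynomial in 1/\<eta>, so the index of the subspace may be
  exponential in it, while the correlation has to stay polynomial. After Bogolyubov's step every
  density is therefore measured relative to W: \<xi> is affine on a fraction \<alpha> of the size of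
  W, and later sums are localised to cosets by Cauchy--Schwarz, so that the index of W never enters
  the correlation bound. The constants come from \<delta> = \<eta>^8/2 (half the average correlation
  of derivatives), c = \<delta>^4 (additive energy of the graph), \<alpha> = c^119/2^321 (share of
  the coset) and \<sigma> = \<alpha>\<delta>. The codimension is at most 1/\<alpha>^2 +
  1/\<sigma>^2, where the second term is paid for symmetry. The field enters through three facts:
  its order is prime, so additive maps are linear; 2 is invertible, so a symmetric form has a
  quadratic form that polarises to it; its order is at most 8, which bounds the loss from rounding
  up to a power of the order.\<close>

lemma sum_card_swap:
  assumes "finite A" "finite B"
  shows "(\<Sum>a\<in>A. card {b\<in>B. R a b}) = (\<Sum>b\<in>B. card {a\<in>A. R a b})"
  using sum.swap_restrict[OF assms, of "\<lambda>_ _. 1::nat" R] by simp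

definition diffset :: "'a::ab_group_add set \<Rightarrow> 'a set \<Rightarrow> 'a set" where
  "diffset Y Z = (\<lambda>(y, z). y - z) ` (Y \<times> Z)"

fun nsums :: "nat \<Rightarrow> 'a::ab_group_add set \<Rightarrow> 'a set" where
  "nsums 0 B = {0}"
| "nsums (Suc k) B = B + nsums k B"

lemma finite_nsums [simp]: "finite B \<Longrightarrow> finite (nsums k B)"
  by (induction k) (auto intro: finite_set_plus)

text \<open>Ruzsa's triangle inequality. Once a representation y - z of each difference d is fixed,
  (x, d) \<mapsto> (x + y, x + z) is injective: subtracting the coordinates recovers d and then x.
  The right side has sums with X because sums are what \<open>petridis\<close> controls.\<close>

lemma diffset_triangle:
  fixes X Y Z :: "'a::ab_group_add set"
  assumes fin: "finite X" "finite Y" "finite Z"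
  shows "card X * card (diffset Y Z) \<le> card (X + Y) * card (X + Z)"
proof -
  have "\<exists>p. p \<in> Y \<times> Z \<and> fst p - snd p = d" if "d \<in> diffset Y Z" for d
    using that by (auto simp: diffset_def)
  then obtain p where p: "\<And>d. d \<in> diffset Y Z \<Longrightarrow> p d \<in> Y \<times> Z \<and> fst (p d) - snd (p d) = d"
    by metis
  let ?g = "\<lambda>(x, d). (x + fst (p d), x + snd (p d))"
  have inj: "inj_on ?g (X \<times> diffset Y Z)"
  proof (rule inj_onI, clarify)
    fix x d x' d'
    assume A: "d \<in> diffset Y Z" "d' \<in> diffset Y Z"
      and eq: "x + fst (p d) = x' + fst (p d')" "x + snd (p d) = x' + snd (p d')"
    have "(x + fst (p d)) - (x + snd (p d)) = (x' + fst (p d')) - (x' + snd (p d'))"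
      using eq by simp
    then have "d = d'" using p A by simp
    with eq show "x = x' \<and> d = d'" by simp
  qed
  have sub: "?g ` (X \<times> diffset Y Z) \<subseteq> (X + Y) \<times> (X + Z)"
  proof clarify
    fix x d assume "x \<in> X" "d \<in> diffset Y Z"
    then show "x + fst (p d) \<in> X + Y \<and> x + snd (p d) \<in> X + Z"
      using p[of d] by (auto simp: mem_Times_iff intro!: set_plus_intro)
  qed
  have "card (X \<times> diffset Y Z) \<le> card ((X + Y) \<times> (X + Z))"
    by (rule card_inj_on_le[OF inj sub]) (intro finite_cartesian_product finite_set_plus fin)
  then show ?thesis by (simp add: card_cartesian_product)
qed

text \<open>
  Petridis's lemma; the hypotheses say that \<open>X\<close> minimises \<open>card (Y + B) / card Y\<close> over
  its own nonempty subsets.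
\<close>
lemma petridis:
  fixes X B C :: "'a::ab_group_add set" and K :: real
  assumes fin: "finite X" "finite B" and "finite C"
    and le: "real (card (X + B)) \<le> K * real (card X)"
    and min: "\<And>Y. Y \<subseteq> X \<Longrightarrow> K * real (card Y) \<le> real (card (Y + B))"
  shows "real (card (X + B + C)) \<le> K * real (card (X + C))"
  using \<open>finite C\<close>
proof (induction C rule: finite_induct)
  case empty
  then show ?case by simp
next
  case (insert c C)
  \<comment> \<open>\<open>Y\<close> collects the x for which x + B + c is already covered by X + B
    + C. The translate of Y + B by c then adds nothing, and minimality bounds card (Y + B) from
    below.\<close>
  define Y where "Y = {x\<in>X. \<forall>b\<in>B. x + b + c \<in> X + B + C}"
  have YX: "Y \<subseteq> X" and finY: "finite Y" using fin by (auto simp: Y_def)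
  have finXB: "finite (X + B)" and finXC: "finite (X + C)" and finXBC: "finite (X + B + C)"
    using fin insert by (auto intro: finite_set_plus)
  have YB: "Y + B \<subseteq> X + B" using YX by (intro set_plus_mono2) auto
  have sub: "X + B + insert c C \<subseteq> (X + B + C) \<union> (\<lambda>s. s + c) ` ((X + B) - (Y + B))"
  proof
    fix z assume "z \<in> X + B + insert c C"
    then obtain s t where st: "z = s + t" "s \<in> X + B" "t \<in> insert c C"
      by (auto elim!: set_plus_elim)
    show "z \<in> (X + B + C) \<union> (\<lambda>s. s + c) ` ((X + B) - (Y + B))"
    proof (cases "t \<in> C")
      case True
      then show ?thesis using st by auto
    next
      case False
      then have [simp]: "t = c" using st by auto
      show ?thesis
      proof (cases "s \<in> Y + B")
        case True
        then obtain y b where "s = y + b" "y \<in> Y" "b \<in> B" by (auto elim!: set_plus_elim)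
        then show ?thesis using st by (auto simp: Y_def)
      next
        case False
        then show ?thesis using st by auto
      qed
    qed
  qed
  have "card (X + B + insert c C) \<le> card (X + B + C) + card ((\<lambda>s. s + c) ` ((X + B) - (Y + B)))"
    by (rule order_trans[OF card_mono[OF _ sub] card_Un_le]) (auto simp: finXBC finXB)
  also have "card ((\<lambda>s. s + c) ` ((X + B) - (Y + B))) = card (X + B) - card (Y + B)"
    using YB finY fin by (subst card_image) (auto simp: card_Diff_subset finite_set_plus)
  finally have 1: "real (card (X + B + insert c C)) \<le> real (card (X + B + C)) + real (card (X + B)) - real (card (Y + B))"
    using card_mono[OF finXB YB] by linarith
  \<comment> \<open>If x + c = x' + c' with c' in C, then x + b + c = x' + b + c' for all b in B, so
    x lies in Y. Hence all of X - Y gives new points after translation by c.\<close>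
  have disj: "(X + C) \<inter> (\<lambda>x. x + c) ` (X - Y) = {}"
  proof -
    have "x \<in> Y" if "x \<in> X" "x + c \<in> X + C" for x
    proof -
      have "x + b + c \<in> X + B + C" if "b \<in> B" for b
      proof -
        from \<open>x + c \<in> X + C\<close> obtain x' c' where "x + c = x' + c'" "x' \<in> X" "c' \<in> C"
          by (auto elim!: set_plus_elim)
        then have eq: "x + b + c = (x' + b) + c'" by (simp add: algebra_simps)
        show ?thesis unfolding eq using \<open>x' \<in> X\<close> \<open>c' \<in> C\<close> \<open>b \<in> B\<close> by (intro set_plus_intro)
      qed
      then show ?thesis using that by (simp add: Y_def)
    qed
    then show ?thesis by auto
  qed
  have "card (X + C) + (card X - card Y) = card ((X + C) \<union> (\<lambda>x. x + c) ` (X - Y))"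
    using disj finXC fin YX finY
    by (subst card_Un_disjoint) (auto simp: card_image card_Diff_subset)
  also have "\<dots> \<le> card (X + insert c C)"
  proof (rule card_mono)
    show "finite (X + insert c C)" using fin insert by (intro finite_set_plus) auto
    have "X + C \<subseteq> X + insert c C" by (intro set_plus_mono2) auto
    then show "(X + C) \<union> (\<lambda>x. x + c) ` (X - Y) \<subseteq> X + insert c C" by auto
  qed
  finally have 2: "real (card (X + C)) + real (card X) - real (card Y) \<le> real (card (X + insert c C))"
    using card_mono[OF fin(1) YX] by linarith
  have K0: "K \<ge> 0 \<or> X = {}"
  proof (rule disjCI)
    assume "X \<noteq> {}"
    then have "0 \<le> K * real (card X)" "real (card X) > 0" using le fin
      by (auto simp: card_gt_0_iff intro: order_trans[OF of_nat_0_le_iff le])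
    then show "K \<ge> 0" by (simp add: zero_le_mult_iff)
  qed
  show ?case
  proof (cases "X = {}")
    case False
    then have "K * (real (card (X + C)) + real (card X) - real (card Y)) \<le> K * real (card (X + insert c C))"
      using 2 K0 by (intro mult_left_mono) auto
    then show ?thesis using 1 insert.IH le min[OF YX] by (simp add: algebra_simps)
  qed simp
qed

text \<open>X minimises card (Y + B) / card Y over the nonempty subsets Y of A, and the minimum is
  at most K. \<open>petridis\<close> with C = \<open>nsums k B\<close> is the induction step. One X
  serves all k at once, which allows two different k in the triangle inequality.\<close>

lemma pluennecke_subset:
  fixes A B :: "'a::ab_group_add set" and K :: real
  assumes fin: "finite A" "finite B" and A: "A \<noteq> {}"
    and le: "real (card (A + B)) \<le> K * real (card A)"
  obtains X where "X \<subseteq> A" "X \<noteq> {}"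
    "\<And>k. real (card (X + nsums k B)) \<le> K ^ k * real (card X)"
proof -
  define F where "F = (\<lambda>Y. real (card (Y + B)) / real (card Y)) ` (Pow A - {{}})"
  have F: "finite F" "F \<noteq> {}" using fin A by (auto simp: F_def)
  obtain X where X: "X \<subseteq> A" "X \<noteq> {}" and L: "Min F = real (card (X + B)) / real (card X)"
    using Min_in[OF F] by (auto simp: F_def)
  define L where "L = Min F"
  have finX: "finite X" using X fin finite_subset by blast
  then have X0: "real (card X) > 0" using X by (simp add: card_gt_0_iff)
  have min: "L * real (card Y) \<le> real (card (Y + B))" if "Y \<subseteq> X" for Y
  proof (cases "Y = {}")
    case False
    have "finite Y" using that finX finite_subset by blast
    then have "real (card Y) > 0" using False by (simp add: card_gt_0_iff)
    moreover have "L \<le> real (card (Y + B)) / real (card Y)"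
      unfolding L_def by (rule Min_le[OF F(1)]) (use that X False in \<open>auto simp: F_def\<close>)
    ultimately show ?thesis by (simp add: field_simps)
  qed simp
  have eq: "real (card (X + B)) = L * real (card X)" using X0 L by (simp add: L_def)
  have L0: "L \<ge> 0" using L by (simp add: L_def)
  have "L \<le> real (card (A + B)) / real (card A)"
    unfolding L_def by (rule Min_le[OF F(1)]) (use A in \<open>auto simp: F_def\<close>)
  also have "\<dots> \<le> K" using le A fin by (simp add: field_simps card_gt_0_iff)
  finally have LK: "L \<le> K" .
  have "real (card (X + nsums k B)) \<le> L ^ k * real (card X)" for k
  proof (induction k)
    case (Suc k)
    have "real (card (X + nsums (Suc k) B)) = real (card (X + B + nsums k B))"
      by (simp add: add.assoc)
    also have "\<dots> \<le> L * real (card (X + nsums k B))"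
      by (rule petridis) (use finX fin eq min in auto)
    also have "\<dots> \<le> L * (L ^ k * real (card X))" using Suc L0 by (intro mult_left_mono)
    finally show ?case by simp
  qed simp
  also have "L ^ k * real (card X) \<le> K ^ k * real (card X)" for k
    using L0 LK by (intro mult_right_mono power_mono) auto
  finally show ?thesis using that X by blast
qed

text \<open>The triangle inequality with the X of \<open>pluennecke_subset\<close> as pivot: one
  factor card X cancels and the other is at most card A.\<close>

lemma pluennecke_ruzsa:
  fixes A B :: "'a::ab_group_add set" and K :: real
  assumes fin: "finite A" "finite B" and A: "A \<noteq> {}"
    and le: "real (card (A + B)) \<le> K * real (card A)"
  shows "real (card (diffset (nsums k B) (nsums l B))) \<le> K ^ (k + l) * real (card A)"
proof -
  obtain X where X: "X \<subseteq> A" "X \<noteq> {}"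
    and pl: "\<And>k. real (card (X + nsums k B)) \<le> K ^ k * real (card X)"
    using pluennecke_subset[OF assms] by metis
  have finX: "finite X" using X fin finite_subset by blast
  then have X0: "real (card X) > 0" using X by (simp add: card_gt_0_iff)
  have K0: "K \<ge> 0"
  proof -
    have "0 \<le> K * real (card A)" "real (card A) > 0"
      using A fin by (auto simp: card_gt_0_iff intro: order_trans[OF of_nat_0_le_iff le])
    then show ?thesis by (simp add: zero_le_mult_iff)
  qed
  have "real (card X) * real (card (diffset (nsums k B) (nsums l B)))
      \<le> real (card (X + nsums k B)) * real (card (X + nsums l B))"
    using diffset_triangle[of X "nsums k B" "nsums l B"] finX fin
    by (simp flip: of_nat_mult)
  also have "\<dots> \<le> (K ^ k * real (card X)) * (K ^ l * real (card X))"
    using pl K0 by (intro mult_mono) auto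
  finally have "real (card (diffset (nsums k B) (nsums l B))) \<le> K ^ (k + l) * real (card X)"
    using X0 by (simp add: power_add algebra_simps)
  also have "\<dots> \<le> K ^ (k + l) * real (card A)"
    using card_mono[OF fin(1) X(1)] K0 by (intro mult_left_mono) auto
  finally show ?thesis .
qed

section \<open>The Balog--Szemeredi--Gowers theorem\<close>

text \<open>Dependent random choice. A pair in A with few common neighbours lies in few
  neighbourhoods of points b, so some neighbourhood is large and contains few such pairs. For a
  typical point a of it and a typical b in B, many middle vertices a' are adjacent to b and share
  many neighbours b' with a.\<close>

lemma paths_of_length_three:
  fixes E :: "('a \<times> 'b) set" and N \<epsilon> :: real
  assumes fin: "finite A" "finite B" and E: "E \<subseteq> A \<times> B"
    and N: "N > 0" "real (card A) \<le> N" "real (card B) \<le> N"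
    and \<epsilon>: "\<epsilon> > 0" "real (card E) \<ge> \<epsilon> * N\<^sup>2"
  obtains A' B' where "A' \<subseteq> A" "B' \<subseteq> B" "real (card A') \<ge> \<epsilon> * N / 6" "real (card B') \<ge> \<epsilon> * N / 4"
    "\<And>a b. a \<in> A' \<Longrightarrow> b \<in> B' \<Longrightarrow>
       real (card {(b', a') \<in> B \<times> A. (a, b') \<in> E \<and> (a', b') \<in> E \<and> (a', b) \<in> E}) \<ge> \<epsilon> ^ 5 / 3072 * N\<^sup>2"
proof -
  define deg where "deg a = real (card {b\<in>B. (a, b) \<in> E})" for a
  \<comment> \<open>Vertices of degree below \<epsilon>N/2 carry at most half of the guaranteed
    \<epsilon>N^2 edges. The degree bound is needed again to count the edges leaving the chosen
    neighbourhood.\<close>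
  define A1 where "A1 = {a\<in>A. deg a \<ge> \<epsilon> * N / 2}"
  define nb where "nb b = {a\<in>A1. (a, b) \<in> E}" for b
  define cod where "cod a a' = real (card {b\<in>B. (a, b) \<in> E \<and> (a', b) \<in> E})" for a a'
  define Bad where "Bad = {(a, a') \<in> A1 \<times> A1. cod a a' < \<epsilon> ^ 3 / 128 * N}"
  define bad where "bad b = {p\<in>Bad. (fst p, b) \<in> E \<and> (snd p, b) \<in> E}" for b
  have finA1: "finite A1" and A1: "A1 \<subseteq> A" using fin by (auto simp: A1_def)
  have finBad: "finite Bad"
    by (rule finite_subset[of _ "A1 \<times> A1"]) (auto simp: Bad_def finA1)
  have fin_nb: "finite (nb b)" for b using finA1 by (auto simp: nb_def)
  have cardA1: "real (card A1) \<le> N" using card_mono[OF fin(1) A1] N by linarith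

  have "(\<Sum>a\<in>A. deg a) = real (card (Sigma A (\<lambda>a. {b\<in>B. (a, b) \<in> E})))"
    using fin by (simp add: deg_def)
  also have "Sigma A (\<lambda>a. {b\<in>B. (a, b) \<in> E}) = E" using E by auto
  finally have "real (card E) = (\<Sum>a\<in>A. deg a)" ..
  also have "\<dots> = (\<Sum>a\<in>A1. deg a) + (\<Sum>a\<in>A - A1. deg a)"
    using fin A1 by (subst sum.subset_diff[of A1]) auto
  also have "(\<Sum>a\<in>A - A1. deg a) \<le> (\<Sum>a\<in>A - A1. \<epsilon> * N / 2)"
    by (intro sum_mono) (auto simp: A1_def)
  also have "\<dots> = real (card (A - A1)) * (\<epsilon> * N / 2)" by simp
  also have "\<dots> \<le> N * (\<epsilon> * N / 2)"
    using card_mono[of A "A - A1"] fin N \<epsilon> by (intro mult_right_mono) auto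
  finally have deg_sum: "(\<Sum>a\<in>A1. deg a) \<ge> \<epsilon> * N\<^sup>2 / 2"
    using \<epsilon> by (simp add: power2_eq_square algebra_simps)
  have "(\<Sum>a\<in>A1. deg a) = (\<Sum>b\<in>B. real (card (nb b)))"
    unfolding deg_def nb_def using sum_card_swap[OF finA1 fin(2), of "\<lambda>a b. (a, b) \<in> E"]
    by (simp flip: of_nat_sum)
  with deg_sum have "\<epsilon> * N\<^sup>2 / 2 \<le> (\<Sum>b\<in>B. real (card (nb b)))" by simp
  then have "(\<epsilon> * N\<^sup>2 / 2)\<^sup>2 \<le> (\<Sum>b\<in>B. real (card (nb b)))\<^sup>2"
    using \<epsilon> by (intro power_mono) auto
  also have "\<dots> \<le> (\<Sum>b\<in>B. 1\<^sup>2) * (\<Sum>b\<in>B. (real (card (nb b)))\<^sup>2)"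
    using Cauchy_Schwarz_ineq_sum[of "\<lambda>_. 1" "\<lambda>b. real (card (nb b))" B] by simp
  also have "\<dots> \<le> N * (\<Sum>b\<in>B. (real (card (nb b)))\<^sup>2)"
    using N by (intro mult_right_mono) (auto intro: sum_nonneg)
  finally have "N * (\<epsilon>\<^sup>2 * N ^ 3 / 4) \<le> N * (\<Sum>b\<in>B. (real (card (nb b)))\<^sup>2)"
    by (simp add: power2_eq_square power3_eq_cube algebra_simps)
  then have sq: "(\<Sum>b\<in>B. (real (card (nb b)))\<^sup>2) \<ge> \<epsilon>\<^sup>2 * N ^ 3 / 4"
    using N by simp

  have "(\<Sum>b\<in>B. real (card (bad b))) = (\<Sum>p\<in>Bad. cod (fst p) (snd p))"
    unfolding bad_def cod_def
    using sum_card_swap[OF fin(2) finBad, of "\<lambda>b p. (fst p, b) \<in> E \<and> (snd p, b) \<in> E"]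
    by (simp flip: of_nat_sum)
  also have "\<dots> \<le> (\<Sum>p\<in>Bad. \<epsilon> ^ 3 / 128 * N)"
    by (intro sum_mono) (auto simp: Bad_def)
  also have "\<dots> = real (card Bad) * (\<epsilon> ^ 3 / 128 * N)" by simp
  also have "\<dots> \<le> (N * N) * (\<epsilon> ^ 3 / 128 * N)"
  proof (rule mult_right_mono)
    have "card Bad \<le> card (A1 \<times> A1)" by (rule card_mono) (auto simp: Bad_def finA1)
    then have "real (card Bad) \<le> real (card A1) * real (card A1)"
      by (simp add: card_cartesian_product flip: of_nat_mult)
    also have "\<dots> \<le> N * N" using cardA1 N by (intro mult_mono) auto
    finally show "real (card Bad) \<le> N * N" .
  qed (use \<epsilon> N in auto)
  finally have bad_sum: "(\<Sum>b\<in>B. real (card (bad b))) \<le> \<epsilon> ^ 3 / 128 * N ^ 3"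
    by (simp add: power3_eq_cube algebra_simps)

  \<comment> \<open>The weight 16/\<epsilon> matches the threshold \<epsilon>^3/128 in
    \<open>Bad\<close>: summed over b, the penalty is at most half of the sum of squares, and at the
    chosen b it forces the bad pairs to be at most an \<epsilon>/16 fraction of all pairs.\<close>
  have "\<exists>b\<in>B. (real (card (nb b)))\<^sup>2 - 16 / \<epsilon> * real (card (bad b)) \<ge> \<epsilon>\<^sup>2 * N\<^sup>2 / 8"
  proof (rule ccontr)
    assume "\<not> ?thesis"
    then have less: "(real (card (nb b)))\<^sup>2 - 16 / \<epsilon> * real (card (bad b)) < \<epsilon>\<^sup>2 * N\<^sup>2 / 8" if "b \<in> B" for b
      using that by (meson not_le)
    have "B \<noteq> {}"
    proof
      assume "B = {}"
      then have "\<epsilon> * N\<^sup>2 \<le> 0" using \<epsilon> E by simp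
      moreover have "\<epsilon> * N\<^sup>2 > 0" using \<epsilon> N by simp
      ultimately show False by linarith
    qed
    then have "(\<Sum>b\<in>B. (real (card (nb b)))\<^sup>2 - 16 / \<epsilon> * real (card (bad b))) < (\<Sum>b\<in>B. \<epsilon>\<^sup>2 * N\<^sup>2 / 8)"
      using fin less by (intro sum_strict_mono) auto
    also have "\<dots> \<le> N * (\<epsilon>\<^sup>2 * N\<^sup>2 / 8)" using N by (simp add: mult_right_mono)
    finally have "(\<Sum>b\<in>B. (real (card (nb b)))\<^sup>2) - 16 / \<epsilon> * (\<Sum>b\<in>B. real (card (bad b))) < \<epsilon>\<^sup>2 * N ^ 3 / 8"
      unfolding sum_subtractf sum_distrib_left[symmetric]
      by (simp add: power2_eq_square power3_eq_cube mult_ac)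
    moreover have "16 / \<epsilon> * (\<Sum>b\<in>B. real (card (bad b))) \<le> \<epsilon>\<^sup>2 * N ^ 3 / 8"
    proof -
      have "16 / \<epsilon> * (\<Sum>b\<in>B. real (card (bad b))) \<le> 16 / \<epsilon> * (\<epsilon> ^ 3 / 128 * N ^ 3)"
        using bad_sum \<epsilon> by (intro mult_left_mono) auto
      also have "\<dots> = \<epsilon>\<^sup>2 * N ^ 3 / 8"
        using \<epsilon> by (simp add: power2_eq_square power3_eq_cube)
      finally show ?thesis .
    qed
    ultimately show False using sq by argo
  qed
  then obtain b0 where b0: "b0 \<in> B"
    and nb0: "(real (card (nb b0)))\<^sup>2 \<ge> \<epsilon>\<^sup>2 * N\<^sup>2 / 8 + 16 / \<epsilon> * real (card (bad b0))"
    by force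
  define A2 where "A2 = nb b0"
  define n where "n = real (card A2)"
  have A2: "A2 \<subseteq> A1" "finite A2" using fin_nb by (auto simp: A2_def nb_def)
  have n_ge: "n \<ge> \<epsilon> * N / 3"
  proof (rule power2_le_imp_le)
    have "(\<epsilon> * N / 3)\<^sup>2 \<le> \<epsilon>\<^sup>2 * N\<^sup>2 / 8" by (simp add: power_mult_distrib power_divide)
    also have "\<dots> \<le> n\<^sup>2" 
    proof -
      have "0 \<le> 16 / \<epsilon> * real (card (bad b0))" using \<epsilon> by simp
      then show ?thesis using nb0 by (simp only: n_def A2_def)
    qed
    finally show "(\<epsilon> * N / 3)\<^sup>2 \<le> n\<^sup>2" .
  qed (simp add: n_def)
  have n0: "n > 0" using n_ge \<epsilon> N by (intro less_le_trans[OF _ n_ge]) simp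
  define bd where "bd a = real (card {a'\<in>A2. (a, a') \<in> Bad})" for a
  have "(\<Sum>a\<in>A2. bd a) = real (card (Sigma A2 (\<lambda>a. {a'\<in>A2. (a, a') \<in> Bad})))"
    using A2 by (simp add: bd_def)
  also have "Sigma A2 (\<lambda>a. {a'\<in>A2. (a, a') \<in> Bad}) = bad b0"
    by (auto simp: bad_def A2_def nb_def Bad_def)
  also have "real (card (bad b0)) \<le> \<epsilon> / 16 * n\<^sup>2"
  proof -
    have "\<epsilon>\<^sup>2 * N\<^sup>2 / 8 \<ge> 0" by simp
    then have "16 / \<epsilon> * real (card (bad b0)) \<le> n\<^sup>2" using nb0 unfolding n_def A2_def by argo
    then show ?thesis using \<epsilon> by (simp add: field_simps)
  qed
  finally have bd_sum: "(\<Sum>a\<in>A2. bd a) \<le> \<epsilon> / 16 * n\<^sup>2" .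
  \<comment> \<open>Markov's inequality: the mean number of bad partners is at most \<epsilon>n/16,
    so at least half of the points stay below twice this.\<close>
  define A' where "A' = {a\<in>A2. bd a \<le> \<epsilon> / 8 * n}"
  have A': "A' \<subseteq> A2" "finite A'" using A2 by (auto simp: A'_def)
  have "(\<Sum>a\<in>A2 - A'. \<epsilon> / 8 * n) \<le> (\<Sum>a\<in>A2 - A'. bd a)"
    by (intro sum_mono) (auto simp: A'_def)
  also have "\<dots> \<le> (\<Sum>a\<in>A2. bd a)"
    using A2 by (intro sum_mono2) (auto simp: bd_def)
  finally have "real (card (A2 - A')) * (\<epsilon> / 8 * n) \<le> (\<epsilon> / 8 * n) * (n / 2)"
    using bd_sum by (simp add: power2_eq_square mult_ac)
  then have "real (card (A2 - A')) \<le> n / 2"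
    using \<epsilon> n0 by (simp add: mult.commute)
  moreover have "real (card (A2 - A')) = n - real (card A')"
    using A' card_mono[OF A2(2) A'(1)] by (simp add: card_Diff_subset n_def of_nat_diff)
  ultimately have cardA': "real (card A') \<ge> n / 2" by simp

  define d2 where "d2 b = real (card {a\<in>A2. (a, b) \<in> E})" for b
  \<comment> \<open>The threshold \<epsilon>/4 exceeds the \<epsilon>/8 of \<open>A'\<close>, so
    that discarding the bad partners of a still leaves \<epsilon>n/8 middle vertices.\<close>
  define B' where "B' = {b\<in>B. d2 b \<ge> \<epsilon> / 4 * n}"
  have B': "B' \<subseteq> B" "finite B'" using fin by (auto simp: B'_def)
  have "n * (\<epsilon> * N / 2) = (\<Sum>a\<in>A2. \<epsilon> * N / 2)" by (simp add: n_def)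
  also have "\<dots> \<le> (\<Sum>a\<in>A2. deg a)"
    using A2 by (intro sum_mono) (auto simp: A1_def)
  also have "\<dots> = (\<Sum>b\<in>B. d2 b)"
    unfolding deg_def d2_def using sum_card_swap[OF A2(2) fin(2), of "\<lambda>a b. (a, b) \<in> E"]
    by (simp flip: of_nat_sum)
  also have "\<dots> = (\<Sum>b\<in>B'. d2 b) + (\<Sum>b\<in>B - B'. d2 b)"
    using fin B' by (subst sum.subset_diff[of B']) auto
  also have "(\<Sum>b\<in>B - B'. d2 b) \<le> (\<Sum>b\<in>B - B'. \<epsilon> / 4 * n)"
    by (intro sum_mono) (auto simp: B'_def)
  also have "\<dots> = real (card (B - B')) * (\<epsilon> / 4 * n)" by simp
  also have "\<dots> \<le> N * (\<epsilon> / 4 * n)"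
    using card_mono[of B "B - B'"] fin N \<epsilon> n0 by (intro mult_right_mono) auto
  also have "(\<Sum>b\<in>B'. d2 b) \<le> (\<Sum>b\<in>B'. n)"
    using A2 by (intro sum_mono) (auto simp: d2_def n_def intro!: card_mono)
  finally have "n * (\<epsilon> * N / 4) \<le> n * real (card B')" by (simp add: algebra_simps)
  then have cardB': "real (card B') \<ge> \<epsilon> * N / 4" using n0 by simp

  show ?thesis
  proof (rule that[of A' B'])
    show "A' \<subseteq> A" using A' A2 A1 by blast
    show "B' \<subseteq> B" by (rule B')
    show "real (card A') \<ge> \<epsilon> * N / 6" using cardA' n_ge by simp
    show "real (card B') \<ge> \<epsilon> * N / 4" by (rule cardB')
    fix a b assume a: "a \<in> A'" and b: "b \<in> B'"
    define G where "G = {a'\<in>A2. (a', b) \<in> E \<and> (a, a') \<notin> Bad}"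
    have finG: "finite G" using A2 by (auto simp: G_def)
    have aA1: "a \<in> A1" using a A' A2 by auto
    have "{a'\<in>A2. (a', b) \<in> E} \<subseteq> G \<union> {a'\<in>A2. (a, a') \<in> Bad}" by (auto simp: G_def)
    then have "card {a'\<in>A2. (a', b) \<in> E} \<le> card (G \<union> {a'\<in>A2. (a, a') \<in> Bad})"
      using A2 finG by (intro card_mono) auto
    also have "\<dots> \<le> card G + card {a'\<in>A2. (a, a') \<in> Bad}" by (rule card_Un_le)
    finally have "d2 b \<le> real (card G) + bd a" by (simp add: d2_def bd_def)
    moreover have "d2 b \<ge> \<epsilon> / 4 * n" using b by (simp add: B'_def)
    moreover have "bd a \<le> \<epsilon> / 8 * n" using a by (simp add: A'_def)
    ultimately have "real (card G) \<ge> \<epsilon> / 8 * n" by simp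
    moreover have "\<epsilon> / 8 * n \<ge> \<epsilon> / 8 * (\<epsilon> * N / 3)" using n_ge \<epsilon> by (intro mult_left_mono) auto
    ultimately have cardG: "real (card G) \<ge> \<epsilon>\<^sup>2 * N / 24" by (simp add: power2_eq_square mult_ac)
    have "\<epsilon> ^ 5 / 3072 * N\<^sup>2 = (\<epsilon>\<^sup>2 * N / 24) * (\<epsilon> ^ 3 / 128 * N)"
      by (simp add: power2_eq_square power3_eq_cube eval_nat_numeral)
    also have "\<dots> \<le> real (card G) * (\<epsilon> ^ 3 / 128 * N)"
      using cardG \<epsilon> N by (intro mult_right_mono) auto
    also have "\<dots> = (\<Sum>a'\<in>G. \<epsilon> ^ 3 / 128 * N)" by simp
    also have "\<dots> \<le> (\<Sum>a'\<in>G. cod a a')"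
      using aA1 A2 by (intro sum_mono) (auto simp: G_def Bad_def)
    also have "\<dots> = real (card (Sigma G (\<lambda>a'. {b'\<in>B. (a, b') \<in> E \<and> (a', b') \<in> E})))"
      using finG fin by (simp add: cod_def)
    also have "\<dots> = real (card (prod.swap ` Sigma G (\<lambda>a'. {b'\<in>B. (a, b') \<in> E \<and> (a', b') \<in> E})))"
      by (simp add: card_image inj_on_def)
    also have "\<dots> \<le> real (card {(b', a') \<in> B \<times> A. (a, b') \<in> E \<and> (a', b') \<in> E \<and> (a', b) \<in> E})"
    proof (rule of_nat_mono, rule card_mono)
      show "finite {(b', a') \<in> B \<times> A. (a, b') \<in> E \<and> (a', b') \<in> E \<and> (a', b) \<in> E}"
        by (rule finite_subset[of _ "B \<times> A"]) (auto simp: fin)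
    qed (use A2 A1 in \<open>auto simp: G_def\<close>)
    finally show "real (card {(b', a') \<in> B \<times> A. (a, b') \<in> E \<and> (a', b') \<in> E \<and> (a', b) \<in> E}) \<ge> \<epsilon> ^ 5 / 3072 * N\<^sup>2" .
  qed
qed

lemma card_quadruples:
  assumes "finite A" "P \<subseteq> A \<times> A"
  shows "card {(a, b, c, d). (a, b) \<in> P \<and> c \<in> A \<and> d \<in> A \<and> f a b c d} =
    (\<Sum>(a, b)\<in>P. card {(c, d). c \<in> A \<and> d \<in> A \<and> f a b c d})"
proof -
  have finP: "finite P" using assms finite_subset by blast
  have fin: "finite {(c, d). c \<in> A \<and> d \<in> A \<and> f a b c d}" for a b
    by (rule finite_subset[of _ "A \<times> A"]) (auto simp: assms)
  have "{(a, b, c, d). (a, b) \<in> P \<and> c \<in> A \<and> d \<in> A \<and> f a b c d} =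
      (\<lambda>((a, b), (c, d)). (a, b, c, d)) ` Sigma P (\<lambda>(a, b). {(c, d). c \<in> A \<and> d \<in> A \<and> f a b c d})"
    by (auto simp: image_iff Bex_def)
  also have "card \<dots> = card (Sigma P (\<lambda>(a, b). {(c, d). c \<in> A \<and> d \<in> A \<and> f a b c d}))"
    by (rule card_image) (auto simp: inj_on_def)
  also have "\<dots> = (\<Sum>(a, b)\<in>P. card {(c, d). c \<in> A \<and> d \<in> A \<and> f a b c d})"
    using finP fin by (subst card_SigmaI) (auto intro!: sum.cong)
  finally show ?thesis .
qed

text \<open>Join a and b when a + b is a popular sum. Along a path a, b', a', b one has a + b = (a +
  b') - (a' + b') + (a' + b), so every element of A' + B' is an alternating sum of three popular
  sums in many ways, while popular sums are few.\<close>

lemma balog_szemeredi_gowers: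
  fixes A :: "'a::ab_group_add set" and N c :: real
  assumes fin: "finite A" and N: "N > 0" "real (card A) \<le> N" and c: "c > 0"
    and energy: "real (card {(a, b, c, d). (a, b) \<in> A \<times> A \<and> c \<in> A \<and> d \<in> A \<and> a + b = c + d}) \<ge> c * N ^ 3"
  obtains A' B' where "A' \<subseteq> A" "B' \<subseteq> A" "real (card A') \<ge> c * N / 12" "real (card B') \<ge> c * N / 8"
    "real (card (A' + B')) \<le> 2 ^ 20 * N / c ^ 8"
proof -
  define r where "r s = real (card {(a, b). a \<in> A \<and> b \<in> A \<and> s = a + b})" for s
  define D where "D = {s \<in> A + A. r s \<ge> c * N / 2}"
  define E where "E = {(a, b) \<in> A \<times> A. a + b \<in> D}"
  have finE: "finite E" by (rule finite_subset[of _ "A \<times> A"]) (auto simp: fin E_def)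
  have finD: "finite D" unfolding D_def by (intro finite_Collect_conjI disjI1) (simp add: finite_set_plus fin)
  have r_le: "r s \<le> N" for s
  proof -
    have "card {(a, b). a \<in> A \<and> b \<in> A \<and> s = a + b} \<le> card A"
      by (rule card_inj_on_le[of fst]) (auto simp: inj_on_def fin)
    then show ?thesis using N by (simp add: r_def)
  qed
  have "c * N ^ 3 \<le> (\<Sum>(a, b)\<in>A \<times> A. r (a + b))"
    using energy unfolding card_quadruples[OF fin order_refl] of_nat_sum
    by (simp add: r_def case_prod_beta)
  also have "\<dots> = (\<Sum>(a, b)\<in>E. r (a + b)) + (\<Sum>(a, b)\<in>A \<times> A - E. r (a + b))"
    using fin by (subst sum.subset_diff[of E]) (auto simp: E_def)
  also have "(\<Sum>(a, b)\<in>A \<times> A - E. r (a + b)) \<le> (\<Sum>(a, b)\<in>A \<times> A - E. c * N / 2)"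
    by (intro sum_mono) (auto simp: E_def D_def)
  also have "\<dots> = real (card (A \<times> A - E)) * (c * N / 2)" by simp
  also have "\<dots> \<le> (N * N) * (c * N / 2)"
  proof (rule mult_right_mono)
    have "card (A \<times> A - E) \<le> card (A \<times> A)" by (rule card_mono) (auto simp: fin)
    then have "real (card (A \<times> A - E)) \<le> real (card A) * real (card A)"
      by (simp add: card_cartesian_product flip: of_nat_mult)
    also have "\<dots> \<le> N * N" using N by (intro mult_mono) auto
    finally show "real (card (A \<times> A - E)) \<le> N * N" .
  qed (use c N in auto)
  also have "(\<Sum>(a, b)\<in>E. r (a + b)) \<le> (\<Sum>(a, b)\<in>E. N)"
    by (intro sum_mono) (use r_le in auto)
  also have "\<dots> = real (card E) * N" by simp
  finally have "(c / 2 * N\<^sup>2) * N \<le> real (card E) * N"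
    by (simp add: power2_eq_square power3_eq_cube algebra_simps)
  then have cardE: "real (card E) \<ge> c / 2 * N\<^sup>2" using N by simp
  \<comment> \<open>Each popular sum uses up cN/2 of the at most N^2 pairs.\<close>
  have "real (card D) * (c * N / 2) = (\<Sum>s\<in>D. c * N / 2)" by simp
  also have "\<dots> \<le> (\<Sum>s\<in>D. r s)" by (intro sum_mono) (auto simp: D_def)
  also have "\<dots> = real (card (Sigma D (\<lambda>s. {(a, b). a \<in> A \<and> b \<in> A \<and> s = a + b})))"
  proof -
    have "finite {(a, b). a \<in> A \<and> b \<in> A \<and> s = a + b}" for s
      by (rule finite_subset[of _ "A \<times> A"]) (auto simp: fin)
    then show ?thesis using finD by (subst card_SigmaI) (auto simp: r_def)
  qed
  also have "\<dots> \<le> real (card (A \<times> A))"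
    by (rule of_nat_mono, rule card_inj_on_le[of snd]) (auto simp: inj_on_def fin)
  also have "\<dots> \<le> N * N" using N by (simp add: card_cartesian_product mult_mono)
  finally have cardD: "real (card D) \<le> 2 * N / c" using c N by (simp add: field_simps)

  obtain A' B' where AB: "A' \<subseteq> A" "B' \<subseteq> A" "real (card A') \<ge> c / 2 * N / 6" "real (card B') \<ge> c / 2 * N / 4"
    and paths: "\<And>a b. a \<in> A' \<Longrightarrow> b \<in> B' \<Longrightarrow>
       real (card {(b', a') \<in> A \<times> A. (a, b') \<in> E \<and> (a', b') \<in> E \<and> (a', b) \<in> E}) \<ge> (c / 2) ^ 5 / 3072 * N\<^sup>2"
    using paths_of_length_three[OF fin fin _ N(1,2) N(2) _ cardE] c unfolding E_def by auto
  define T where "T s = {(x, y, z) \<in> D \<times> D \<times> D. x - y + z = s}" for s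
  have finT: "finite (T s)" for s
    by (rule finite_subset[of _ "D \<times> D \<times> D"]) (auto simp: T_def finD)
  have T_ge: "real (card (T s)) \<ge> (c / 2) ^ 5 / 3072 * N\<^sup>2" if "s \<in> A' + B'" for s
  proof -
    from that obtain a b where s: "s = a + b" "a \<in> A'" "b \<in> B'" by (auto elim: set_plus_elim)
    have "card {(b', a') \<in> A \<times> A. (a, b') \<in> E \<and> (a', b') \<in> E \<and> (a', b) \<in> E} \<le> card (T s)"
      by (rule card_inj_on_le[of "\<lambda>(b', a'). (a + b', a' + b', a' + b)", OF _ _ finT])
        (auto simp: inj_on_def T_def E_def s)
    then show ?thesis using paths[OF s(2,3)] by linarith
  qed
  have finAB: "finite (A' + B')" using AB fin by (meson finite_set_plus finite_subset)
  have "real (card (A' + B')) * ((c / 2) ^ 5 / 3072 * N\<^sup>2) = (\<Sum>s\<in>A' + B'. (c / 2) ^ 5 / 3072 * N\<^sup>2)" by simp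
  also have "\<dots> \<le> (\<Sum>s\<in>A' + B'. real (card (T s)))" by (intro sum_mono T_ge)
  also have "\<dots> = real (card (Sigma (A' + B') T))"
    using finAB finT by (subst card_SigmaI) auto
  also have "\<dots> \<le> real (card (D \<times> D \<times> D))"
    by (rule of_nat_mono, rule card_inj_on_le[of snd]) (auto simp: inj_on_def T_def finD)
  also have "\<dots> = real (card D) ^ 3" by (simp add: card_cartesian_product power3_eq_cube)
  also have "\<dots> \<le> (2 * N / c) ^ 3" using cardD by (intro power_mono) auto
  finally have *: "real (card (A' + B')) * ((c / 2) ^ 5 / 3072 * N\<^sup>2) \<le> (2 * N / c) ^ 3" .
  have "real (card (A' + B')) \<le> (2 * N / c) ^ 3 / ((c / 2) ^ 5 / 3072 * N\<^sup>2)"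
    using * c N by (subst pos_le_divide_eq) auto
  also have "\<dots> = 786432 * N / c ^ 8"
    using c N by (simp add: field_simps eval_nat_numeral)
  also have "\<dots> \<le> 2 ^ 20 * N / c ^ 8"
    using c N by (intro divide_right_mono mult_right_mono) auto
  finally show ?thesis using that[of A' B'] AB by simp
qed

section \<open>Fourier analysis over a finite field\<close>

lemma sum_UNIV_shift:
  fixes F :: "'a::{ab_group_add,finite} \<Rightarrow> 'b::comm_monoid_add"
  shows "(\<Sum>x\<in>UNIV. F (x + u)) = (\<Sum>x\<in>UNIV. F x)" "(\<Sum>x\<in>UNIV. F (u + x)) = (\<Sum>x\<in>UNIV. F x)"
  by (rule sum.reindex_bij_witness[of _ "\<lambda>x. x - u" "\<lambda>x. x + u"]; simp)
     (rule sum.reindex_bij_witness[of _ "\<lambda>x. x - u" "\<lambda>x. u + x"]; simp)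

text \<open>Writing the second variable as x + d turns the square into a sum over multiplicative
  derivatives; this is how all squares over the whole group are expanded below.\<close>

lemma cmod_sum_square_eq:
  fixes F :: "'a::{ab_group_add,finite} \<Rightarrow> complex"
  shows "of_real ((cmod (\<Sum>x\<in>UNIV. F x))\<^sup>2) = (\<Sum>x\<in>UNIV. \<Sum>d\<in>UNIV. F x * cnj (F (x + d)))"
  by (simp only: complex_norm_square cnj_sum sum_product
      sum_UNIV_shift(2)[of "\<lambda>y. F x * cnj (F y)" x for x])

text \<open>After the expansion, the substitution z = x + v decouples the two functions, leaving the
  pairing of their autocorrelations.\<close>

lemma sum_cmod_square_correlation:
  fixes a b :: "'a::{ab_group_add,finite} \<Rightarrow> complex"
  shows "of_real (\<Sum>v\<in>UNIV. (cmod (\<Sum>x\<in>UNIV. b x * a (x + v)))\<^sup>2) =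
    (\<Sum>d\<in>UNIV. (\<Sum>x\<in>UNIV. b x * cnj (b (x + d))) * (\<Sum>z\<in>UNIV. a z * cnj (a (z + d))))"
proof -
  have "of_real (\<Sum>v\<in>UNIV. (cmod (\<Sum>x\<in>UNIV. b x * a (x + v)))\<^sup>2) =
      (\<Sum>v\<in>UNIV. \<Sum>x\<in>UNIV. \<Sum>d\<in>UNIV. b x * a (x + v) * cnj (b (x + d) * a (x + d + v)))"
    by (simp only: of_real_sum cmod_sum_square_eq)
  also have "\<dots> = (\<Sum>x\<in>UNIV. \<Sum>v\<in>UNIV. \<Sum>d\<in>UNIV. b x * a (x + v) * cnj (b (x + d) * a (x + d + v)))"
    by (rule sum.swap)
  also have "\<dots> = (\<Sum>x\<in>UNIV. \<Sum>d\<in>UNIV. \<Sum>v\<in>UNIV. b x * a (x + v) * cnj (b (x + d) * a (x + d + v)))"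
    by (intro sum.cong refl sum.swap)
  also have "\<dots> = (\<Sum>x\<in>UNIV. \<Sum>d\<in>UNIV. b x * cnj (b (x + d)) * (\<Sum>v\<in>UNIV. a (x + v) * cnj (a (x + v + d))))"
    by (simp add: sum_distrib_left algebra_simps)
  also have "\<dots> = (\<Sum>x\<in>UNIV. \<Sum>d\<in>UNIV. b x * cnj (b (x + d)) * (\<Sum>z\<in>UNIV. a z * cnj (a (z + d))))"
    by (simp only: sum_UNIV_shift(2)[of "\<lambda>z. a z * cnj (a (z + d))" for d])
  also have "\<dots> = (\<Sum>d\<in>UNIV. \<Sum>x\<in>UNIV. b x * cnj (b (x + d)) * (\<Sum>z\<in>UNIV. a z * cnj (a (z + d))))"
    by (rule sum.swap)
  finally show ?thesis by (simp add: sum_distrib_right)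
qed

lemma sum_square_le_card:
  fixes f :: "'a \<Rightarrow> real"
  shows "(\<Sum>x\<in>A. f x)\<^sup>2 \<le> real (card A) * (\<Sum>x\<in>A. (f x)\<^sup>2)"
  using Cauchy_Schwarz_ineq_sum[of "\<lambda>_. 1" f A] by simp

lemma sum_sum_square_le_card:
  fixes f :: "'a \<Rightarrow> 'b \<Rightarrow> real"
  shows "(\<Sum>x\<in>A. \<Sum>y\<in>B. f x y)\<^sup>2 \<le> real (card A) * real (card B) * (\<Sum>x\<in>A. \<Sum>y\<in>B. (f x y)\<^sup>2)"
proof -
  have "(\<Sum>x\<in>A. \<Sum>y\<in>B. f x y)\<^sup>2 \<le> real (card A) * (\<Sum>x\<in>A. (\<Sum>y\<in>B. f x y)\<^sup>2)"
    by (rule sum_square_le_card)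
  also have "\<dots> \<le> real (card A) * (\<Sum>x\<in>A. real (card B) * (\<Sum>y\<in>B. (f x y)\<^sup>2))"
    by (intro mult_left_mono sum_mono sum_square_le_card) auto
  finally show ?thesis by (simp add: sum_distrib_left algebra_simps)
qed

lemma ex_le_average:
  fixes f :: "'a \<Rightarrow> real"
  assumes "finite A" "A \<noteq> {}"
  shows "\<exists>x\<in>A. real (card A) * f x \<le> (\<Sum>x\<in>A. f x)"
proof (rule ccontr)
  assume "\<not> ?thesis"
  then have "(\<Sum>x\<in>A. f x) / real (card A) < f x" if "x \<in> A" for x
    using that assms by (simp add: field_simps card_gt_0_iff not_le)
  then have "(\<Sum>x\<in>A. (\<Sum>x\<in>A. f x) / real (card A)) < (\<Sum>x\<in>A. f x)"
    using assms by (intro sum_strict_mono) auto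
  then show False using assms by simp
qed

lemma ex_ge_average:
  fixes f :: "'a \<Rightarrow> real"
  assumes "finite A" "A \<noteq> {}"
  shows "\<exists>x\<in>A. (\<Sum>x\<in>A. f x) \<le> real (card A) * f x"
  using ex_le_average[OF assms, of "\<lambda>x. - f x"] by (simp add: sum_negf)

lemma sum_character_eq_0:
  fixes \<psi> :: "'a::ab_group_add \<Rightarrow> complex"
  assumes fin: "finite S" and closed: "\<And>x y. x \<in> S \<Longrightarrow> y \<in> S \<Longrightarrow> x + y \<in> S"
    and mult: "\<And>x y. x \<in> S \<Longrightarrow> y \<in> S \<Longrightarrow> \<psi> (x + y) = \<psi> x * \<psi> y"
    and s: "s \<in> S" "\<psi> s \<noteq> 1"
  shows "(\<Sum>x\<in>S. \<psi> x) = 0"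
proof -
  have inj: "inj_on (\<lambda>x. x + s) S" by (simp add: inj_on_def)
  have "(\<lambda>x. x + s) ` S = S"
    by (rule endo_inj_surj[OF fin _ inj]) (use closed s in auto)
  then have "(\<Sum>x\<in>S. \<psi> x) = (\<Sum>x\<in>S. \<psi> (x + s))"
    by (metis (no_types, lifting) inj sum.reindex_cong)
  also have "\<dots> = (\<Sum>x\<in>S. \<psi> x) * \<psi> s" using mult s by (simp add: sum_distrib_right)
  finally show ?thesis using s by simp
qed

section \<open>The standard bilinear form, annihilators and separating subspaces\<close>

lemma scalar_product_simps:
  fixes x y z :: "'a::comm_ring_1 ^ 'n"
  shows "scalar_product x (y + z) = scalar_product x y + scalar_product x z"
    "scalar_product (x + y) z = scalar_product x z + scalar_product y z"
    "scalar_product x (y - z) = scalar_product x y - scalar_product x z"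
    "scalar_product (x - y) z = scalar_product x z - scalar_product y z"
    "scalar_product x (- y) = - scalar_product x y"
    "scalar_product (- x) y = - scalar_product x y"
    "scalar_product x 0 = 0" "scalar_product 0 x = 0"
    "scalar_product x (c *s y) = c * scalar_product x y"
    "scalar_product (c *s x) y = c * scalar_product x y"
  by (simp_all add: scalar_product_def sum.distrib sum_subtractf sum_negf sum_distrib_left algebra_simps)

lemma scalar_product_commute:
  "scalar_product x y = scalar_product y (x :: 'a::comm_ring_1 ^ 'n)"
  by (simp add: scalar_product_def mult.commute)

lemma scalar_product_surj:
  fixes x :: "'a::field ^ 'n"
  assumes "x \<noteq> 0"
  obtains r where "scalar_product r x = a"
proof -
  obtain i where i: "x $ i \<noteq> 0" using assms by (auto simp: vec_eq_iff)
  have "scalar_product (axis i (a / x $ i)) x = (\<Sum>j\<in>UNIV. if j = i then a else 0)"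
    unfolding scalar_product_def using i by (intro sum.cong) (auto simp: axis_def)
  also have "\<dots> = a" by simp
  finally show ?thesis by (rule that)
qed

lemma card_hyperplane:
  fixes v :: "'F::{field,finite} ^ 'n"
  assumes "v \<noteq> 0"
  shows "CARD('F) * card {y. scalar_product y v = 0} = CARD('F ^ 'n)"
proof -
  have eq: "card {y. scalar_product y v = c} = card {y. scalar_product y v = 0}" for c
  proof -
    obtain r where r: "scalar_product r v = c" using scalar_product_surj[OF assms] by blast
    have "bij_betw (\<lambda>y. y + r) {y. scalar_product y v = 0} {y. scalar_product y v = c}"
      by (rule bij_betw_byWitness[of _ "\<lambda>y. y - r"]) (auto simp: scalar_product_simps r)
    then show ?thesis by (simp add: bij_betw_same_card)
  qed
  have "CARD('F ^ 'n) = card (\<Union>c. {y :: 'F ^ 'n. scalar_product y v = c})"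
    by (rule arg_cong[of _ _ card]) auto
  also have "\<dots> = (\<Sum>c\<in>UNIV. card {y :: 'F ^ 'n. scalar_product y v = c})"
    by (rule card_UN_disjoint) auto
  also have "\<dots> = (\<Sum>c::'F\<in>UNIV. card {y :: 'F ^ 'n. scalar_product y v = 0})"
    by (rule sum.cong[OF refl eq])
  finally show ?thesis by simp
qed

lemma subspace_annihilator: "vec.subspace {w :: 'F::field ^ 'n. \<forall>r\<in>R. scalar_product r w = 0}"
  by (auto simp: vec.subspace_def scalar_product_simps)

lemma codim_annihilator:
  fixes R :: "('F::field ^ 'n) set"
  assumes "finite R"
  shows "CARD('n) \<le> vec.dim {w. \<forall>r\<in>R. scalar_product r w = 0} + card R"
  using assms
proof (induction R rule: finite_induct)
  case empty
  then show ?case by (simp add: vec_dim_card del: vec.dim_UNIV)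
next
  case (insert y R)
  let ?W = "{w. \<forall>r\<in>R. scalar_product r w = 0}"
  let ?W' = "{w. \<forall>r\<in>insert y R. scalar_product r w = 0}"
  have "vec.dim ?W \<le> vec.dim ?W' + 1"
  proof (cases "\<exists>w\<in>?W. scalar_product y w \<noteq> 0")
    case True
    then obtain w where w: "w \<in> ?W" "scalar_product y w \<noteq> 0" by blast
    have "?W \<subseteq> vec.span (insert w ?W')"
    proof
      fix x assume x: "x \<in> ?W"
      define k where "k = scalar_product y x / scalar_product y w"
      have "x - k *s w \<in> ?W'"
        using x w by (auto simp: scalar_product_simps k_def)
      then have "x - k *s w \<in> vec.span (insert w ?W')" "k *s w \<in> vec.span (insert w ?W')"
        by (auto intro: vec.span_base vec.span_scale)
      then have "(x - k *s w) + k *s w \<in> vec.span (insert w ?W')"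
        by (rule vec.span_add)
      then show "x \<in> vec.span (insert w ?W')" by simp
    qed
    then have "vec.dim ?W \<le> vec.dim (insert w ?W')" by (rule vec.dim_mono)
    also have "\<dots> \<le> vec.dim ?W' + 1" by (simp add: vec.dim_insert)
    finally show ?thesis .
  next
    case False
    then have "?W' = ?W" by auto
    then show ?thesis by simp
  qed
  then show ?case using insert by simp
qed

text \<open>
  Every step cuts down to a random hyperplane, which contains only the expected fraction
  of \<open>V\<close>, and to its most popular coset.
\<close>
lemma separating_subspace:
  fixes V :: "('F::{field,finite} ^ 'n) set" and p :: "'b \<Rightarrow> 'F ^ 'n"
  assumes V: "0 \<notin> V" and S: "finite S"
  shows "\<exists>U S'. vec.subspace U \<and> S' \<subseteq> S \<and> (\<forall>s\<in>S'. \<forall>t\<in>S'. p s - p t \<in> U) \<and>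
    card (U \<inter> V) * CARD('F) ^ m \<le> card V \<and> card S \<le> card S' * CARD('F) ^ m"
proof (induction m)
  case 0
  show ?case by (rule exI[of _ UNIV], rule exI[of _ S]) auto
next
  case (Suc m)
  then obtain U S' where U: "vec.subspace U" and S': "S' \<subseteq> S" "\<forall>s\<in>S'. \<forall>t\<in>S'. p s - p t \<in> U"
    and cV: "card (U \<inter> V) * CARD('F) ^ m \<le> card V" and cS: "card S \<le> card S' * CARD('F) ^ m"
    by blast
  have finS': "finite S'" using S S' finite_subset by blast
  let ?q = "CARD('F)" and ?N = "CARD('F ^ 'n)"
  \<comment> \<open>Every nonzero v is orthogonal to exactly one y in CARD('F), so some y retains at
    most this share of U \<inter> V.\<close>
  obtain y where y: "real ?N * real (card {v\<in>U \<inter> V. scalar_product y v = 0})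
      \<le> (\<Sum>y\<in>UNIV. real (card {v\<in>U \<inter> V. scalar_product y v = 0}))"
    using ex_le_average[of UNIV "\<lambda>y. real (card {v\<in>U \<inter> V. scalar_product y v = 0})"] by auto
  have "(\<Sum>y\<in>UNIV. card {v\<in>U \<inter> V. scalar_product y v = 0}) =
      (\<Sum>v\<in>U \<inter> V. card {y\<in>UNIV. scalar_product y v = 0})"
    using sum.swap_restrict[of "UNIV :: ('F ^ 'n) set" "U \<inter> V" "\<lambda>_ _. 1::nat" "\<lambda>y v. scalar_product y v = 0"]
    by simp
  then have "?q * (\<Sum>y\<in>UNIV. card {v\<in>U \<inter> V. scalar_product y v = 0}) =
      (\<Sum>v\<in>U \<inter> V. ?q * card {y. scalar_product y v = 0})"
    by (simp add: sum_distrib_left)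
  also have "\<dots> = (\<Sum>v\<in>U \<inter> V. ?N)"
    using V by (intro sum.cong refl card_hyperplane) auto
  also have "\<dots> = card (U \<inter> V) * ?N" by simp
  finally have "real ?q * (\<Sum>y\<in>UNIV. real (card {v\<in>U \<inter> V. scalar_product y v = 0})) =
      real (card (U \<inter> V)) * real ?N"
    by (simp flip: of_nat_sum of_nat_mult del: CARD_vec)
  then have "real ?N * (real ?q * real (card {v\<in>U \<inter> V. scalar_product y v = 0}))
      \<le> real ?N * real (card (U \<inter> V))"
    using mult_left_mono[OF y, of "real ?q"] by (simp add: algebra_simps)
  then have cy: "?q * card {v\<in>U \<inter> V. scalar_product y v = 0} \<le> card (U \<inter> V)"
    by (simp flip: of_nat_mult)
  \<comment> \<open>Pigeonhole over the values of the functional y: the fullest level set keeps at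
    least a share 1/CARD('F) of S', and differences within it are orthogonal to y.\<close>
  obtain c where "(\<Sum>c\<in>UNIV. real (card {s\<in>S'. scalar_product y (p s) = c})) \<le>
      real ?q * real (card {s\<in>S'. scalar_product y (p s) = c})"
    using ex_ge_average[of UNIV "\<lambda>c. real (card {s\<in>S'. scalar_product y (p s) = c})"] by auto
  moreover have "(\<Sum>c\<in>UNIV. card {s\<in>S'. scalar_product y (p s) = c}) = card S'"
  proof -
    have "(\<Sum>c\<in>UNIV. card {s\<in>S'. scalar_product y (p s) = c}) =
        card (\<Union>c. {s\<in>S'. scalar_product y (p s) = c})"
      using finS' by (subst card_UN_disjoint) auto
    also have "(\<Union>c. {s\<in>S'. scalar_product y (p s) = c}) = S'" by auto
    finally show ?thesis .
  qed
  ultimately have cc: "card S' \<le> ?q * card {s\<in>S'. scalar_product y (p s) = c}"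
    by (simp flip: of_nat_sum of_nat_mult)
  define U' where "U' = U \<inter> {w. \<forall>r\<in>{y}. scalar_product r w = 0}"
  define S'' where "S'' = {s\<in>S'. scalar_product y (p s) = c}"
  have "vec.subspace U'" unfolding U'_def by (intro vec.subspace_inter U subspace_annihilator)
  moreover have "S'' \<subseteq> S" using S' by (auto simp: S''_def)
  moreover have "\<forall>s\<in>S''. \<forall>t\<in>S''. p s - p t \<in> U'"
    using S' by (auto simp: S''_def U'_def scalar_product_simps)
  moreover have "card (U' \<inter> V) * ?q ^ Suc m \<le> card V"
  proof -
    have "U' \<inter> V = {v\<in>U \<inter> V. scalar_product y v = 0}" by (auto simp: U'_def)
    then have "card (U' \<inter> V) * ?q ^ Suc m \<le> card (U \<inter> V) * ?q ^ m"
      using mult_right_mono[OF cy, of "?q ^ m"] by (simp add: algebra_simps)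
    with cV show ?thesis by linarith
  qed
  moreover have "card S \<le> card S'' * ?q ^ Suc m"
    using order_trans[OF cS mult_right_mono[OF cc, of "?q ^ m"]] by (simp add: S''_def mult_ac)
  ultimately show ?case by blast
qed

text \<open>These properties give orthogonality, hence Parseval and everything up to the inverse
  theorem. A concrete character is needed only at the end, where residues modulo a prime provide
  one.\<close>

locale additive_character =
  fixes e :: "'F::{field,finite} \<Rightarrow> complex"
  assumes e_add: "e (a + b) = e a * e b"
    and cmod_e [simp]: "cmod (e a) = 1"
    and nontrivial: "\<exists>a. e a \<noteq> 1"
begin

lemma e_nonzero [simp]: "e a \<noteq> 0"
  using cmod_e[of a] by fastforce

lemma e_0 [simp]: "e 0 = 1"
  using e_add[of 0 0] by simp

lemma e_minus: "e (- a) = cnj (e a)"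
proof -
  have "e a * e (- a) = e a * cnj (e a)"
    using e_add[of a "- a"] by (simp add: complex_norm_square[symmetric])
  then show ?thesis by simp
qed

lemma e_diff: "e (a - b) = e a * cnj (e b)"
  using e_add[of a "- b"] by (simp add: e_minus)

definition ch :: "'F ^ 'n \<Rightarrow> 'F ^ 'n \<Rightarrow> complex" where
  "ch r x = e (scalar_product r x)"

lemma cmod_ch [simp]: "cmod (ch r x) = 1"
  by (simp add: ch_def)

lemma ch_0 [simp]: "ch 0 x = 1" "ch r 0 = 1"
  by (simp_all add: ch_def scalar_product_simps)

lemma ch_right: "ch r (x + y) = ch r x * ch r y" "ch r (- x) = cnj (ch r x)"
    "ch r (x - y) = ch r x * cnj (ch r y)"
  and ch_left: "ch (r + s) x = ch r x * ch s x" "ch (- r) x = cnj (ch r x)"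
    "ch (r - s) x = ch r x * cnj (ch s x)"
  by (simp_all add: ch_def scalar_product_simps e_add e_minus e_diff)

lemma ch_commute: "ch r x = ch x r"
  by (simp add: ch_def scalar_product_commute)

lemma sum_ch: "(\<Sum>r\<in>UNIV. ch r x) = (if x = 0 then of_nat CARD('F ^ 'n) else 0)"
  for x :: "'F ^ 'n"
proof (cases "x = 0")
  case False
  obtain a where a: "e a \<noteq> 1" using nontrivial by blast
  obtain r where "scalar_product r x = a" using scalar_product_surj[OF False] by blast
  then have "(\<Sum>r\<in>UNIV. ch r x) = 0"
    using a by (intro sum_character_eq_0[of _ _ r]) (auto simp: ch_left, simp add: ch_def)
  then show ?thesis using False by simp
qed simp

lemma sum_ch': "(\<Sum>r\<in>UNIV. ch x r) = (if x = 0 then of_nat CARD('F ^ 'n) else 0)"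
  for x :: "'F ^ 'n"
  by (subst ch_commute) (rule sum_ch)

lemma parseval:
  fixes b :: "'F ^ 'n \<Rightarrow> complex"
  shows "(\<Sum>r\<in>UNIV. (cmod (\<Sum>x\<in>UNIV. b x * ch r x))\<^sup>2) = real CARD('F ^ 'n) * (\<Sum>x\<in>UNIV. (cmod (b x))\<^sup>2)"
proof -
  have "complex_of_real (\<Sum>r\<in>UNIV. (cmod (\<Sum>x\<in>UNIV. b x * ch r x))\<^sup>2) =
      (\<Sum>r\<in>UNIV. \<Sum>x\<in>UNIV. \<Sum>d\<in>UNIV. b x * ch r x * cnj (b (x + d) * ch r (x + d)))"
    by (simp only: of_real_sum cmod_sum_square_eq)
  also have "\<dots> = (\<Sum>r\<in>UNIV. \<Sum>x\<in>UNIV. \<Sum>d\<in>UNIV. b x * cnj (b (x + d)) * ch r (- d))"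
  proof (intro sum.cong refl)
    fix r x d :: "'F ^ 'n"
    have "ch r x * cnj (ch r x) = 1" by (simp add: complex_norm_square[symmetric])
    then show "b x * ch r x * cnj (b (x + d) * ch r (x + d)) = b x * cnj (b (x + d)) * ch r (- d)"
      by (simp add: ch_right algebra_simps)
  qed
  also have "\<dots> = (\<Sum>x\<in>UNIV. \<Sum>r\<in>UNIV. \<Sum>d\<in>UNIV. b x * cnj (b (x + d)) * ch r (- d))"
    by (rule sum.swap)
  also have "\<dots> = (\<Sum>x\<in>UNIV. \<Sum>d\<in>UNIV. \<Sum>r\<in>UNIV. b x * cnj (b (x + d)) * ch r (- d))"
    by (intro sum.cong refl sum.swap)
  also have "\<dots> = (\<Sum>x\<in>UNIV. \<Sum>d\<in>UNIV. if d = 0 then b x * cnj (b (x + d)) * of_nat CARD('F ^ 'n) else 0)"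
    by (intro sum.cong refl) (simp add: sum_distrib_left[symmetric] sum_ch del: CARD_vec)
  also have "\<dots> = (\<Sum>x\<in>UNIV. b x * cnj (b x) * of_nat CARD('F ^ 'n))" by simp
  also have "\<dots> = of_real (real CARD('F ^ 'n) * (\<Sum>x\<in>UNIV. (cmod (b x))\<^sup>2))"
    by (simp add: complex_norm_square[symmetric] sum_distrib_left mult.commute)
  finally show ?thesis by (simp only: of_real_eq_iff)
qed

text \<open>The transform of the correlation at r is the product of the transforms of b at -r and of
  a at r; the first is bounded by M, and Parseval is applied to the correlation and to a. With M the
  largest coefficient this is an inverse theorem for the U^2 norm; it also yields the final bound by
  u^3 norms.\<close>

lemma sum_correlation_le:
  fixes a b :: "'F ^ 'n \<Rightarrow> complex"
  assumes M: "\<And>r. cmod (\<Sum>x\<in>UNIV. b x * ch r x) \<le> M"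
  shows "(\<Sum>v\<in>UNIV. (cmod (\<Sum>x\<in>UNIV. b x * a (x + v)))\<^sup>2) \<le> M\<^sup>2 * (\<Sum>x\<in>UNIV. (cmod (a x))\<^sup>2)"
proof -
  let ?N = "real CARD('F ^ 'n)"
  have fourier: "(\<Sum>v\<in>UNIV. (\<Sum>x\<in>UNIV. b x * a (x + v)) * ch r v) =
      (\<Sum>x\<in>UNIV. b x * ch (- r) x) * (\<Sum>z\<in>UNIV. a z * ch r z)" for r :: "'F ^ 'n"
  proof -
    have "(\<Sum>v\<in>UNIV. (\<Sum>x\<in>UNIV. b x * a (x + v)) * ch r v) =
        (\<Sum>v\<in>UNIV. \<Sum>x\<in>UNIV. b x * a (x + v) * ch r v)"
      by (simp add: sum_distrib_right)
    also have "\<dots> = (\<Sum>x\<in>UNIV. \<Sum>v\<in>UNIV. b x * a (x + v) * ch r v)" by (rule sum.swap)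
    also have "\<dots> = (\<Sum>x\<in>UNIV. b x * ch (- r) x * (\<Sum>v\<in>UNIV. a (x + v) * ch r (x + v)))"
    proof (intro sum.cong refl)
      fix x :: "'F ^ 'n"
      have "cnj (ch r x) * ch r x = 1" by (simp add: complex_norm_square[symmetric] mult.commute)
      then have "b x * a (x + v) * ch r v = b x * ch (- r) x * (a (x + v) * ch r (x + v))" for v
        by (simp add: ch_right ch_left algebra_simps)
      then show "(\<Sum>v\<in>UNIV. b x * a (x + v) * ch r v) =
          b x * ch (- r) x * (\<Sum>v\<in>UNIV. a (x + v) * ch r (x + v))"
        by (simp only: sum_distrib_left)
    qed
    also have "\<dots> = (\<Sum>x\<in>UNIV. b x * ch (- r) x * (\<Sum>z\<in>UNIV. a z * ch r z))"
      by (simp only: sum_UNIV_shift(2)[of "\<lambda>z. a z * ch r z"])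
    finally show ?thesis by (simp add: sum_distrib_right)
  qed
  have "?N * (\<Sum>v\<in>UNIV. (cmod (\<Sum>x\<in>UNIV. b x * a (x + v)))\<^sup>2) =
      (\<Sum>r\<in>UNIV. (cmod ((\<Sum>x\<in>UNIV. b x * ch (- r) x) * (\<Sum>z\<in>UNIV. a z * ch r z)))\<^sup>2)"
    by (simp only: parseval[symmetric] fourier)
  also have "\<dots> \<le> (\<Sum>r\<in>UNIV. M\<^sup>2 * (cmod (\<Sum>z\<in>UNIV. a z * ch r z))\<^sup>2)"
    unfolding norm_mult power_mult_distrib
    by (intro sum_mono mult_right_mono power_mono M) auto
  also have "\<dots> = ?N * (M\<^sup>2 * (\<Sum>x\<in>UNIV. (cmod (a x))\<^sup>2))"
    by (simp only: sum_distrib_left[symmetric] parseval) (simp add: algebra_simps)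
  finally show ?thesis by (simp del: CARD_vec)
qed

text \<open>Expanding with shift u leaves the phase ch (\<xi> h) u and a derivative of f at h + x.
  Two Cauchy--Schwarz steps eliminate f altogether, and orthogonality in u then counts the
  quadruples respected by \<xi>. The exponent 9 is 3 doubled for the first step, 2 for the second
  and 1 for orthogonality.\<close>

lemma card_additive_quadruples:
  fixes f :: "'F ^ 'n \<Rightarrow> complex" and \<xi> :: "'F ^ 'n \<Rightarrow> 'F ^ 'n"
  assumes f: "\<And>x. cmod (f x) \<le> 1"
    and D: "D \<le> (\<Sum>h\<in>B. (cmod (\<Sum>x\<in>UNIV. f (x + h) * cnj (f x) * cnj (ch (\<xi> h) x)))\<^sup>2)" "D \<ge> 0"
  shows "D ^ 4 \<le> real CARD('F ^ 'n) ^ 9 * real (card {(d, h, k). h \<in> B \<and> h + d \<in> B \<and> k \<in> B \<and> k + d \<in> B \<and>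
    \<xi> h + \<xi> (k + d) = \<xi> k + \<xi> (h + d)})"
proof -
  let ?N = "real CARD('F ^ 'n)"
  \<comment> \<open>\<open>g\<close> depends on h and x only through h + x, so for fixed u the sum
    over h is a correlation of \<open>a u\<close> with \<open>g u\<close>. Cutting \<open>a\<close>
    off outside B lets h range over the whole group.\<close>
  define g where "g u z = f z * cnj (f (z + u))" for u z
  define a where "a u h = (if h \<in> B then ch (\<xi> h) u else 0)" for u h
  define T where "T u d = (\<Sum>h\<in>UNIV. a u h * cnj (a u (h + d)))" for u d
  define S where "S u x = cmod (\<Sum>h\<in>UNIV. a u h * g u (h + x))" for u x
  have g_le: "cmod (g u z) \<le> 1" for u z
    using f[of z] f[of "z + u"] by (simp add: g_def norm_mult mult_le_one)
  have one: "cnj (ch r x) * ch r x = 1" for r x :: "'F ^ 'n"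
    by (simp add: complex_norm_square[symmetric] mult.commute)
  have "complex_of_real (\<Sum>h\<in>B. (cmod (\<Sum>x\<in>UNIV. f (x + h) * cnj (f x) * cnj (ch (\<xi> h) x)))\<^sup>2) =
      (\<Sum>h\<in>B. \<Sum>x\<in>UNIV. \<Sum>u\<in>UNIV. f (x + h) * cnj (f x) * cnj (ch (\<xi> h) x) *
         cnj (f (x + u + h) * cnj (f (x + u)) * cnj (ch (\<xi> h) (x + u))))"
    by (simp only: of_real_sum cmod_sum_square_eq)
  also have "\<dots> = (\<Sum>h\<in>B. \<Sum>x\<in>UNIV. \<Sum>u\<in>UNIV. cnj (f x) * f (x + u) * (a u h * g u (h + x)))"
  proof (intro sum.cong refl)
    fix h x u assume "h \<in> B"
    then show "f (x + h) * cnj (f x) * cnj (ch (\<xi> h) x) *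
         cnj (f (x + u + h) * cnj (f (x + u)) * cnj (ch (\<xi> h) (x + u))) =
       cnj (f x) * f (x + u) * (a u h * g u (h + x))"
      using one[of "\<xi> h" x] by (simp add: a_def g_def ch_right algebra_simps)
  qed
  also have "\<dots> = (\<Sum>h\<in>UNIV. \<Sum>x\<in>UNIV. \<Sum>u\<in>UNIV. cnj (f x) * f (x + u) * (a u h * g u (h + x)))"
    by (rule sum.mono_neutral_left) (auto simp: a_def)
  also have "\<dots> = (\<Sum>x\<in>UNIV. \<Sum>h\<in>UNIV. \<Sum>u\<in>UNIV. cnj (f x) * f (x + u) * (a u h * g u (h + x)))"
    by (rule sum.swap)
  also have "\<dots> = (\<Sum>x\<in>UNIV. \<Sum>u\<in>UNIV. \<Sum>h\<in>UNIV. cnj (f x) * f (x + u) * (a u h * g u (h + x)))"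
    by (intro sum.cong refl sum.swap)
  also have "\<dots> = (\<Sum>u\<in>UNIV. \<Sum>x\<in>UNIV. \<Sum>h\<in>UNIV. cnj (f x) * f (x + u) * (a u h * g u (h + x)))"
    by (rule sum.swap)
  also have "\<dots> = (\<Sum>u\<in>UNIV. \<Sum>x\<in>UNIV. cnj (f x) * f (x + u) * (\<Sum>h\<in>UNIV. a u h * g u (h + x)))"
    by (simp only: sum_distrib_left)
  finally have eq: "complex_of_real (\<Sum>h\<in>B. (cmod (\<Sum>x\<in>UNIV. f (x + h) * cnj (f x) * cnj (ch (\<xi> h) x)))\<^sup>2) = \<dots>" .
  have "D \<le> cmod (complex_of_real (\<Sum>h\<in>B. (cmod (\<Sum>x\<in>UNIV. f (x + h) * cnj (f x) * cnj (ch (\<xi> h) x)))\<^sup>2))"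
    using D(1) by (simp only: norm_of_real)
  also have "\<dots> \<le> (\<Sum>u\<in>UNIV. \<Sum>x\<in>UNIV. S u x)"
    unfolding eq
  proof (intro sum_norm_le)
    fix u x
    have "cmod (cnj (f x) * f (x + u)) \<le> 1"
      using f[of x] f[of "x + u"] by (simp add: norm_mult mult_le_one)
    then show "cmod (cnj (f x) * f (x + u) * (\<Sum>h\<in>UNIV. a u h * g u (h + x))) \<le> S u x"
      unfolding norm_mult[of "cnj (f x) * f (x + u)"] S_def by (intro mult_left_le_one_le) auto
  qed
  finally have "D\<^sup>2 \<le> (\<Sum>u\<in>UNIV. \<Sum>x\<in>UNIV. S u x)\<^sup>2"
    using D(2) by (intro power_mono)
  \<comment> \<open>Cauchy--Schwarz over (u, x). The correlation identity then separates the
    autocorrelation of \<open>g u\<close>, which is at most N.\<close>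
  also have "\<dots> \<le> ?N * ?N * (\<Sum>u\<in>UNIV. \<Sum>x\<in>UNIV. (S u x)\<^sup>2)"
    by (rule sum_sum_square_le_card)
  also have "(\<Sum>u\<in>UNIV. \<Sum>x\<in>UNIV. (S u x)\<^sup>2) \<le> (\<Sum>u\<in>UNIV. \<Sum>d\<in>UNIV. ?N * cmod (T u d))"
  proof (rule sum_mono)
    fix u
    have "(\<Sum>x\<in>UNIV. (S u x)\<^sup>2) = cmod (complex_of_real (\<Sum>x\<in>UNIV. (S u x)\<^sup>2))"
      by (simp only: norm_of_real) (simp add: sum_nonneg)
    also have "complex_of_real (\<Sum>x\<in>UNIV. (S u x)\<^sup>2) =
        (\<Sum>d\<in>UNIV. T u d * (\<Sum>z\<in>UNIV. g u z * cnj (g u (z + d))))"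
      unfolding S_def T_def by (rule sum_cmod_square_correlation)
    also have "cmod \<dots> \<le> (\<Sum>d\<in>UNIV. ?N * cmod (T u d))"
    proof (intro sum_norm_le)
      fix d
      have "cmod (\<Sum>z\<in>UNIV. g u z * cnj (g u (z + d))) \<le> (\<Sum>z\<in>(UNIV :: ('F ^ 'n) set). 1)"
        by (intro sum_norm_le) (simp add: norm_mult mult_le_one g_le)
      then show "cmod (T u d * (\<Sum>z\<in>UNIV. g u z * cnj (g u (z + d)))) \<le> ?N * cmod (T u d)"
        by (simp add: norm_mult mult.commute[of "cmod (T u d)"] mult_right_mono)
    qed
    finally show "(\<Sum>x\<in>UNIV. (S u x)\<^sup>2) \<le> (\<Sum>d\<in>UNIV. ?N * cmod (T u d))" .
  qed
  also have "\<dots> = ?N * (\<Sum>u\<in>UNIV. \<Sum>d\<in>UNIV. cmod (T u d))" by (simp only: sum_distrib_left)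
  finally have D2: "D\<^sup>2 \<le> ?N ^ 3 * (\<Sum>u\<in>UNIV. \<Sum>d\<in>UNIV. cmod (T u d))"
    by (simp add: power3_eq_cube mult_left_mono del: CARD_vec)
  have "D ^ 4 = (D\<^sup>2)\<^sup>2" by (simp flip: power_mult)
  also have "\<dots> \<le> (?N ^ 3 * (\<Sum>u\<in>UNIV. \<Sum>d\<in>UNIV. cmod (T u d)))\<^sup>2"
    by (rule power_mono[OF D2]) simp
  also have "\<dots> = ?N ^ 6 * (\<Sum>u\<in>UNIV. \<Sum>d\<in>UNIV. cmod (T u d))\<^sup>2"
    by (simp add: power_mult_distrib flip: power_mult del: CARD_vec)
  also have "\<dots> \<le> ?N ^ 6 * (?N * ?N * (\<Sum>u\<in>UNIV. \<Sum>d\<in>UNIV. (cmod (T u d))\<^sup>2))"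
    by (intro mult_left_mono sum_sum_square_le_card) simp
  finally have D4: "D ^ 4 \<le> ?N ^ 8 * (\<Sum>u\<in>UNIV. \<Sum>d\<in>UNIV. (cmod (T u d))\<^sup>2)"
    by (simp add: eval_nat_numeral mult_ac del: CARD_vec)
  \<comment> \<open>The square of \<open>T u d\<close> is a sum over h and k of characters in u;
    summing over u keeps exactly the terms whose total frequency vanishes.\<close>
  let ?Q = "{(d, h, k). h \<in> B \<and> h + d \<in> B \<and> k \<in> B \<and> k + d \<in> B \<and> \<xi> h + \<xi> (k + d) = \<xi> k + \<xi> (h + d)}"
  have "complex_of_real (\<Sum>u\<in>UNIV. \<Sum>d\<in>UNIV. (cmod (T u d))\<^sup>2) =
      (\<Sum>u\<in>UNIV. \<Sum>d\<in>UNIV. \<Sum>h\<in>UNIV. \<Sum>k\<in>UNIV. a u h * cnj (a u (h + d)) * cnj (a u k * cnj (a u (k + d))))"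
    by (simp only: of_real_sum complex_norm_square T_def cnj_sum sum_product)
  also have "\<dots> = (\<Sum>u\<in>UNIV. \<Sum>(d, h, k)\<in>UNIV. a u h * cnj (a u (h + d)) * cnj (a u k * cnj (a u (k + d))))"
    by (simp only: UNIV_Times_UNIV[symmetric] sum.cartesian_product)
  also have "\<dots> = (\<Sum>(d, h, k)\<in>UNIV. \<Sum>u\<in>UNIV. a u h * cnj (a u (h + d)) * cnj (a u k * cnj (a u (k + d))))"
    by (subst sum.swap) (simp add: case_prod_beta)
  also have "\<dots> = (\<Sum>p\<in>UNIV. if p \<in> ?Q then of_real ?N else 0)"
  proof (rule sum.cong[OF refl], clarify)
    fix d h k
    show "(\<Sum>u\<in>UNIV. a u h * cnj (a u (h + d)) * cnj (a u k * cnj (a u (k + d)))) =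
      (if (d, h, k) \<in> ?Q then complex_of_real ?N else 0)"
    proof (cases "h \<in> B \<and> h + d \<in> B \<and> k \<in> B \<and> k + d \<in> B")
      case True
      have "(\<Sum>u\<in>UNIV. a u h * cnj (a u (h + d)) * cnj (a u k * cnj (a u (k + d)))) =
          (\<Sum>u\<in>UNIV. ch ((\<xi> h + \<xi> (k + d)) - (\<xi> k + \<xi> (h + d))) u)"
        using True by (intro sum.cong) (simp_all add: a_def ch_left algebra_simps)
      also have "\<dots> = (if (\<xi> h + \<xi> (k + d)) - (\<xi> k + \<xi> (h + d)) = 0 then of_real ?N else 0)"
        by (subst sum_ch') simp
      finally show ?thesis using True by simp
    next
      case False
      then have "a u h * cnj (a u (h + d)) * cnj (a u k * cnj (a u (k + d))) = 0" for u
        by (auto simp: a_def)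
      then have "(\<Sum>u\<in>UNIV. a u h * cnj (a u (h + d)) * cnj (a u k * cnj (a u (k + d)))) = 0"
        by (intro sum.neutral ballI)
      moreover have "(d, h, k) \<notin> ?Q" using False by auto
      ultimately show ?thesis by (simp only: if_False)
    qed
  qed
  also have "\<dots> = of_real (?N * real (card ?Q))"
    by (subst sum.inter_filter[symmetric]) auto
  finally have "(\<Sum>u\<in>UNIV. \<Sum>d\<in>UNIV. (cmod (T u d))\<^sup>2) = ?N * real (card ?Q)"
    by (simp only: of_real_eq_iff)
  then show ?thesis using D4 by (simp add: eval_nat_numeral mult_ac del: CARD_vec)
qed

text \<open>If w has no representation a + b - c - d, then the sum over r of |F r|^4 ch r (-w) is 0.
  The large spectrum R contributes without cancellation, since W annihilates it, and already the
  term r = 0 outweighs everything outside R.\<close>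

lemma bogolyubov:
  fixes H :: "('F ^ 'n) set" and \<alpha> :: real
  assumes \<alpha>: "\<alpha> > 0" "real (card H) \<ge> \<alpha> * real CARD('F ^ 'n)"
  obtains W where "vec.subspace W" "real CARD('n) - real (vec.dim W) \<le> 1 / \<alpha>\<^sup>2"
    "\<And>w. w \<in> W \<Longrightarrow> \<exists>a\<in>H. \<exists>b\<in>H. \<exists>c\<in>H. \<exists>d\<in>H. w = a + b - c - d"
proof -
  let ?N = "real CARD('F ^ 'n)"
  have N0: "?N > 0" by (simp only: of_nat_0_less_iff finite_UNIV_card_ge_0 finite)
  \<comment> \<open>The exact density makes F 0 equal to \<beta>N on the nose; the comparison of the
    term r = 0 with the tail has no room for a mere lower bound.\<close>
  define \<beta> where "\<beta> = real (card H) / ?N"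
  have \<beta>_ge: "\<beta> \<ge> \<alpha>" unfolding \<beta>_def using \<alpha>(2) N0 by (subst pos_le_divide_eq)
  have \<beta>: "\<beta> \<ge> \<alpha>" "\<beta> > 0" "real (card H) = \<beta> * ?N"
    using \<alpha> N0 \<beta>_ge by (simp_all add: \<beta>_def del: CARD_vec)
  have \<beta>1: "\<beta> \<le> 1"
    using card_mono[of UNIV H] N0 by (simp add: \<beta>_def del: CARD_vec)
  define F where "F r = (\<Sum>x\<in>H. ch r x)" for r :: "'F ^ 'n"
  have F0: "F 0 = of_real (\<beta> * ?N)" unfolding \<beta>(3)[symmetric] by (simp add: F_def)
  have F_eq: "F r = (\<Sum>x\<in>UNIV. of_bool (x \<in> H) * ch r x)" for r
    unfolding F_def by (rule sum.mono_neutral_cong_left) auto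
  have pars: "(\<Sum>r\<in>UNIV. (cmod (F r))\<^sup>2) = \<beta> * ?N\<^sup>2"
  proof -
    have "(\<Sum>x\<in>UNIV. (cmod (of_bool (x \<in> H)))\<^sup>2) = (\<Sum>x\<in>H. 1::real)"
      by (rule sum.mono_neutral_cong_right) auto
    also have "\<dots> = \<beta> * ?N" using \<beta>(3) by (simp del: CARD_vec)
    finally show ?thesis unfolding F_eq parseval by (simp add: power2_eq_square del: CARD_vec)
  qed
  \<comment> \<open>By Parseval the threshold \<beta>^3 N^2 gives card R \<le> 1/\<beta>^2.\<close>
  define R where "R = {r. (cmod (F r))\<^sup>2 \<ge> \<beta> ^ 3 * ?N\<^sup>2}"
  have "real (card R) * (\<beta> ^ 3 * ?N\<^sup>2) = (\<Sum>r\<in>R. \<beta> ^ 3 * ?N\<^sup>2)" by simp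
  also have "\<dots> \<le> (\<Sum>r\<in>R. (cmod (F r))\<^sup>2)" by (intro sum_mono) (simp add: R_def)
  also have "\<dots> \<le> (\<Sum>r\<in>UNIV. (cmod (F r))\<^sup>2)" by (intro sum_mono2) auto
  finally have "real (card R) * (\<beta> ^ 3 * ?N\<^sup>2) \<le> \<beta> * ?N\<^sup>2" unfolding pars .
  then have "(real (card R) * \<beta>\<^sup>2) * (\<beta> * ?N\<^sup>2) \<le> 1 * (\<beta> * ?N\<^sup>2)"
    by (simp add: power3_eq_cube power2_eq_square mult_ac del: CARD_vec)
  then have cR: "real (card R) * \<beta>\<^sup>2 \<le> 1"
    using \<beta>(2) N0 by (subst (asm) mult_le_cancel_right_pos) (auto simp del: CARD_vec)
  have "real (card R) \<le> 1 / \<beta>\<^sup>2" using cR \<beta>(2) by (simp add: field_simps)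
  also have "\<dots> \<le> 1 / \<alpha>\<^sup>2" using \<beta> \<alpha> by (intro divide_left_mono power_mono) auto
  finally have cardR: "real (card R) \<le> 1 / \<alpha>\<^sup>2" .
  define W where "W = {w :: 'F ^ 'n. \<forall>r\<in>R. scalar_product r w = 0}"
  have sub: "\<exists>a\<in>H. \<exists>b\<in>H. \<exists>c\<in>H. \<exists>d\<in>H. w = a + b - c - d" if w: "w \<in> W" for w
  proof (rule ccontr)
    assume no: "\<not> ?thesis"
    have FF: "F r * F r = (\<Sum>p\<in>H \<times> H. ch r (fst p + snd p))" for r
      by (simp add: F_def sum_product sum.cartesian_product ch_right case_prod_beta)
    have "(\<Sum>r\<in>UNIV. (F r * F r) * cnj (F r * F r) * ch r (- w)) =
        (\<Sum>r\<in>UNIV. \<Sum>p\<in>H \<times> H. \<Sum>q\<in>H \<times> H. ch r (fst p + snd p - fst q - snd q - w))"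
    proof (rule sum.cong[OF refl])
      fix r
      have "(F r * F r) * cnj (F r * F r) * ch r (- w) =
          (\<Sum>p\<in>H \<times> H. \<Sum>q\<in>H \<times> H. ch r (fst p + snd p) * cnj (ch r (fst q + snd q)) * ch r (- w))"
        by (subst FF, subst FF, subst cnj_sum, subst sum_product) (simp only: sum_distrib_right)
      also have "\<dots> = (\<Sum>p\<in>H \<times> H. \<Sum>q\<in>H \<times> H. ch r (fst p + snd p - fst q - snd q - w))"
        by (intro sum.cong refl) (simp add: ch_right)
      finally show "(F r * F r) * cnj (F r * F r) * ch r (- w) = \<dots>" .
    qed
    also have "\<dots> = (\<Sum>p\<in>H \<times> H. \<Sum>r\<in>UNIV. \<Sum>q\<in>H \<times> H. ch r (fst p + snd p - fst q - snd q - w))"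
      by (rule sum.swap)
    also have "\<dots> = (\<Sum>p\<in>H \<times> H. \<Sum>q\<in>H \<times> H. \<Sum>r\<in>UNIV. ch r (fst p + snd p - fst q - snd q - w))"
      by (intro sum.cong refl sum.swap)
    also have "\<dots> = 0"
    proof (rule sum.neutral, rule ballI, rule sum.neutral, rule ballI)
      fix p q assume "p \<in> H \<times> H" "q \<in> H \<times> H"
      then have "fst p + snd p - fst q - snd q - w \<noteq> 0" using no by force
      then show "(\<Sum>r\<in>UNIV. ch r (fst p + snd p - fst q - snd q - w)) = 0" by (simp add: sum_ch)
    qed
    finally have zero': "(\<Sum>r\<in>UNIV. (F r * F r) * cnj (F r * F r) * ch r (- w)) = 0" .
    have zero: "(\<Sum>r\<in>UNIV. of_real (cmod (F r) ^ 4) * ch r (- w)) = 0"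
    proof -
      have "complex_of_real (cmod (F r) ^ 4) = (F r * F r) * cnj (F r * F r)" for r
        by (simp only: complex_norm_square[symmetric] norm_mult) (simp flip: power2_eq_square power_mult)
      then show ?thesis using zero' by (simp only:)
    qed
    have 0: "0 \<in> R"
    proof -
      have "\<beta> ^ 3 * ?N\<^sup>2 \<le> \<beta>\<^sup>2 * ?N\<^sup>2"
        using \<beta> \<beta>1 by (intro mult_right_mono power_decreasing) auto
      then show ?thesis using \<beta> by (simp add: R_def F0 norm_mult power_mult_distrib del: CARD_vec)
    qed
    have "ch r (- w) = 1" if "r \<in> R" for r
      using w that by (simp add: W_def ch_def scalar_product_simps)
    then have "(\<Sum>r\<in>R. of_real (cmod (F r) ^ 4) * ch r (- w)) = of_real (\<Sum>r\<in>R. cmod (F r) ^ 4)" by simp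
    moreover have "(\<Sum>r\<in>UNIV. of_real (cmod (F r) ^ 4) * ch r (- w)) =
        (\<Sum>r\<in>R. of_real (cmod (F r) ^ 4) * ch r (- w)) + (\<Sum>r\<in>- R. of_real (cmod (F r) ^ 4) * ch r (- w))"
      by (subst sum.union_disjoint[symmetric]) auto
    ultimately have "of_real (\<Sum>r\<in>R. cmod (F r) ^ 4) = - (\<Sum>r\<in>- R. of_real (cmod (F r) ^ 4) * ch r (- w))"
      using zero by (simp add: add_eq_0_iff2)
    then have "cmod (of_real (\<Sum>r\<in>R. cmod (F r) ^ 4)) = cmod (\<Sum>r\<in>- R. of_real (cmod (F r) ^ 4) * ch r (- w))"
      by (simp only: norm_minus_cancel)
    then have "(\<Sum>r\<in>R. cmod (F r) ^ 4) = cmod (\<Sum>r\<in>- R. of_real (cmod (F r) ^ 4) * ch r (- w))"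
      by (simp only: norm_of_real) (simp add: sum_nonneg)
    also have "\<dots> \<le> (\<Sum>r\<in>- R. cmod (F r) ^ 4)"
      by (rule sum_norm_le) (simp add: norm_mult norm_power)
    also have "\<dots> \<le> (\<Sum>r\<in>- R. (\<beta> ^ 3 * ?N\<^sup>2) * (cmod (F r))\<^sup>2)"
    proof (rule sum_mono)
      fix r assume "r \<in> - R"
      then have "(cmod (F r))\<^sup>2 * (cmod (F r))\<^sup>2 \<le> (\<beta> ^ 3 * ?N\<^sup>2) * (cmod (F r))\<^sup>2"
        by (intro mult_right_mono) (auto simp: R_def simp del: CARD_vec)
      then show "cmod (F r) ^ 4 \<le> (\<beta> ^ 3 * ?N\<^sup>2) * (cmod (F r))\<^sup>2"
        by (simp flip: power_add del: CARD_vec)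
    qed
    also have "\<dots> = (\<beta> ^ 3 * ?N\<^sup>2) * (\<Sum>r\<in>- R. (cmod (F r))\<^sup>2)" by (simp only: sum_distrib_left)
    \<comment> \<open>Removing r = 0 from Parseval is the source of the strict inequality: the tail
      is at most (\<beta>^4 - \<beta>^5) N^4, the main term at least \<beta>^4 N^4.\<close>
    also have "(\<Sum>r\<in>- R. (cmod (F r))\<^sup>2) \<le> (\<Sum>r\<in>- {0}. (cmod (F r))\<^sup>2)"
      using 0 by (intro sum_mono2) auto
    also have "\<dots> = \<beta> * ?N\<^sup>2 - (cmod (F 0))\<^sup>2"
      unfolding pars[symmetric] Compl_eq_Diff_UNIV by (subst sum_diff) auto
    also have "\<dots> = \<beta> * ?N\<^sup>2 - \<beta>\<^sup>2 * ?N\<^sup>2"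
      using \<beta> by (simp add: F0 norm_mult power_mult_distrib del: CARD_vec)
    finally have "(\<Sum>r\<in>R. cmod (F r) ^ 4) \<le> (\<beta> ^ 3 * ?N\<^sup>2) * (\<beta> * ?N\<^sup>2 - \<beta>\<^sup>2 * ?N\<^sup>2)"
      using \<beta> by (simp add: mult_left_mono del: CARD_vec)
    moreover have "cmod (F 0) ^ 4 \<le> (\<Sum>r\<in>R. cmod (F r) ^ 4)"
      using 0 by (intro member_le_sum) auto
    moreover have "cmod (F 0) ^ 4 = \<beta> ^ 4 * ?N ^ 4"
      using \<beta> by (simp add: F0 norm_mult power_mult_distrib del: CARD_vec)
    ultimately have "\<beta> ^ 5 * ?N ^ 4 \<le> 0"
      by (simp add: eval_nat_numeral algebra_simps del: CARD_vec)
    moreover have "\<beta> ^ 5 * ?N ^ 4 > 0" using \<beta> N0 by (intro mult_pos_pos zero_less_power)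
    ultimately show False by linarith
  qed
  have "CARD('n) \<le> vec.dim W + card R" unfolding W_def by (rule codim_annihilator) simp
  then have "real CARD('n) - real (vec.dim W) \<le> 1 / \<alpha>\<^sup>2" using cardR by linarith
  moreover have "vec.subspace W" unfolding W_def by (rule subspace_annihilator)
  ultimately show ?thesis using sub by (intro that) auto
qed

end

section \<open>Quadratic phases\<close>

lemma echar_add: "echar (a + b) = echar a * echar b"
  by (simp add: echar_def algebra_simps flip: exp_add)

lemma echar_uminus: "echar (- a) = cnj (echar a)"
  by (simp add: echar_def exp_cnj)

lemma echar_0 [simp]: "echar 0 = 1"
  by (simp add: echar_def)

lemma cmod_echar [simp]: "cmod (echar a) = 1"
  by (simp add: echar_def)

lemma echar_sum: "echar (\<Sum>x\<in>A. f x) = (\<Prod>x\<in>A. echar (f x))"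
  by (induction A rule: infinite_finite_induct) (auto simp: echar_add)

lemma echar_eq_cis: "echar t = cis (2 * pi * t)"
  by (simp add: echar_def cis_conv_exp mult_ac)

lemma echar_eq_1_iff: "echar t = 1 \<longleftrightarrow> [t = 0] (rmod 1)"
proof -
  have "echar t = 1 \<longleftrightarrow> (\<exists>n. t = of_int n)"
    unfolding echar_eq_cis cis_eq_1_iff by (auto simp: field_simps)
  also have "\<dots> \<longleftrightarrow> (\<exists>n. 0 = t + of_int n)"
    by (metis add.inverse_inverse add.right_inverse eq_neg_iff_add_eq_0 of_int_minus)
  finally show ?thesis by (simp add: rcong_altdef)
qed

lemma echar_Arg:
  assumes "cmod z = 1"
  shows "echar (Arg z / (2 * pi)) = z"
proof -
  have "z \<noteq> 0" using assms by auto
  then show ?thesis using assms by (simp add: echar_eq_cis cis_Arg sgn_div_norm)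
qed

lemma quadratic_phase_iff_echar:
  "quadratic_phase B \<phi> \<longleftrightarrow> (\<forall>x h1 h2 h3. (\<forall>\<omega>. vertex x h1 h2 h3 \<omega> \<in> B) \<longrightarrow>
     echar (\<Sum>\<omega>\<in>UNIV. (-1) ^ weight \<omega> * \<phi> (vertex x h1 h2 h3 \<omega>)) = 1)"
  by (simp add: quadratic_phase_def echar_eq_1_iff)

lemma quadratic_phase_diff:
  assumes "quadratic_phase B \<phi>" "quadratic_phase B \<psi>"
  shows "quadratic_phase B (\<lambda>x. \<phi> x - \<psi> x)"
  unfolding quadratic_phase_iff_echar
proof (intro allI impI)
  fix x h1 h2 h3 assume A: "\<forall>\<omega>. vertex x h1 h2 h3 \<omega> \<in> B"
  have "(\<Sum>\<omega>\<in>UNIV. (-1) ^ weight \<omega> * (\<phi> (vertex x h1 h2 h3 \<omega>) - \<psi> (vertex x h1 h2 h3 \<omega>))) =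
      (\<Sum>\<omega>\<in>UNIV. (-1) ^ weight \<omega> * \<phi> (vertex x h1 h2 h3 \<omega>)) +
      - (\<Sum>\<omega>\<in>UNIV. (-1) ^ weight \<omega> * \<psi> (vertex x h1 h2 h3 \<omega>))"
    by (simp add: right_diff_distrib sum_subtractf)
  then show "echar (\<Sum>\<omega>\<in>UNIV. (-1) ^ weight \<omega> * (\<phi> (vertex x h1 h2 h3 \<omega>) - \<psi> (vertex x h1 h2 h3 \<omega>))) = 1"
    using assms A unfolding quadratic_phase_iff_echar by (simp only: echar_add echar_uminus) simp
qed

lemma vertex_affine:
  assumes "\<And>x y. L (x + y) = L x + L y"
  shows "c + L (vertex x h1 h2 h3 \<omega>) = vertex (c + L x) (L h1) (L h2) (L h3) \<omega>"
proof -
  have "L 0 = 0" using assms[of 0 0] by simp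
  then show ?thesis by (cases \<omega> rule: weight.cases) (simp add: assms add.assoc)
qed

text \<open>An affine map carries cubes to cubes. Composing with a map onto a coset therefore
  extends a phase from the coset to the whole space.\<close>

lemma quadratic_phase_affine:
  assumes "quadratic_phase B \<phi>" and L: "\<And>x y. L (x + y) = L x + L y"
    and B: "\<And>x. x \<in> B' \<Longrightarrow> c + L x \<in> B"
  shows "quadratic_phase B' (\<lambda>x. \<phi> (c + L x))"
  unfolding quadratic_phase_def
proof (intro allI impI)
  fix x h1 h2 h3 assume "\<forall>\<omega>. vertex x h1 h2 h3 \<omega> \<in> B'"
  then have "vertex (c + L x) (L h1) (L h2) (L h3) \<omega> \<in> B" for \<omega>
    using B[of "vertex x h1 h2 h3 \<omega>"] unfolding vertex_affine[where L = L, OF L] by blast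
  then show "[(\<Sum>\<omega>\<in>UNIV. (-1) ^ weight \<omega> * \<phi> (c + L (vertex x h1 h2 h3 \<omega>))) = 0] (rmod 1)"
    using assms(1) unfolding vertex_affine[where L = L, OF L] quadratic_phase_def by blast
qed

section \<open>Correlation with quadratic phases and its bound by the U^3 norm\<close>

lemma cmod_avg_le_u3norm:
  assumes "quadratic_phase B \<phi>"
  shows "cmod (avg B (\<lambda>x. f x * echar (- \<phi> x))) \<le> u3norm f B"
  unfolding u3norm_def by (rule cSUP_upper) (use assms u3norm_bdd_above in auto)

lemma u3norm_le:
  assumes "\<And>\<phi>. quadratic_phase B \<phi> \<Longrightarrow> cmod (avg B (\<lambda>x. f x * echar (- \<phi> x))) \<le> M"
  shows "u3norm f B \<le> M"
  unfolding u3norm_def using assms quadratic_phase_0 by (intro cSUP_least) auto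

lemma u3norm_nonneg: "u3norm f B \<ge> 0"
  by (rule order_trans[OF norm_ge_zero cmod_avg_le_u3norm[OF quadratic_phase_0]])

lemma u3norm_le_1:
  assumes f: "\<And>x. x \<in> B \<Longrightarrow> cmod (f x) \<le> 1" and B: "finite B"
  shows "u3norm f B \<le> 1"
proof (rule u3norm_le)
  fix \<phi>
  have "(\<Sum>x\<in>B. cmod (f x)) \<le> real (card B)" using sum_mono[of B "\<lambda>x. cmod (f x)" "\<lambda>_. 1"] f by simp
  then have "(\<Sum>x\<in>B. cmod (f x)) / real (card B) \<le> 1" by (simp add: divide_le_eq)
  then show "cmod (avg B (\<lambda>x. f x * echar (- \<phi> x))) \<le> 1"
    using cmod_avg_echar_le order_trans by blast
qed

text \<open>Conjugating \<open>weight \<omega>\<close> times gives the phase the sign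
  (-1)^\<open>weight \<omega>\<close>, so the phases at the eight vertices multiply to
  \<open>echar\<close> of the alternating sum, up to conjugation.\<close>

lemma U3avg_mult_quadratic_phase:
  fixes f :: "'a::{ab_group_add,finite} \<Rightarrow> complex"
  assumes "quadratic_phase UNIV \<phi>"
  shows "U3avg (\<lambda>x. f x * echar (- \<phi> x)) = U3avg f"
proof -
  have pow: "(cnj ^^ k) (a * echar (- t)) = (cnj ^^ k) a * echar (- ((-1) ^ k * t))" for k a t
    by (induction k) (auto simp flip: echar_uminus)
  have "(\<Prod>\<omega>\<in>UNIV. (cnj ^^ weight \<omega>) (f (vertex x h1 h2 h3 \<omega>) * echar (- \<phi> (vertex x h1 h2 h3 \<omega>)))) =
      (\<Prod>\<omega>\<in>UNIV. (cnj ^^ weight \<omega>) (f (vertex x h1 h2 h3 \<omega>)))" for x h1 h2 h3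
  proof -
    have "(\<Prod>\<omega>\<in>UNIV. echar (- ((-1) ^ weight \<omega> * \<phi> (vertex x h1 h2 h3 \<omega>)))) =
        cnj (echar (\<Sum>\<omega>\<in>UNIV. (-1) ^ weight \<omega> * \<phi> (vertex x h1 h2 h3 \<omega>)))"
      by (simp only: echar_sum echar_uminus cnj_prod)
    also have "\<dots> = 1" using assms by (simp add: quadratic_phase_iff_echar)
    finally show ?thesis by (simp only: pow prod.distrib) simp
  qed
  then show ?thesis by (simp add: U3avg_def)
qed

text \<open>Monotonicity of the Gowers norms from U^1 to U^3: alternately expand a square into
  derivatives and apply Cauchy--Schwarz to the sum over the shifts.\<close>

lemma cmod_avg_le_U3norm:
  fixes f :: "'a::{ab_group_add,finite} \<Rightarrow> complex"
  shows "cmod (avg UNIV f) \<le> U3norm f"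
proof -
  let ?N = "real CARD('a)"
  have N0: "?N > 0" by simp
  define S where "S h = (\<Sum>x\<in>UNIV. f x * cnj (f (x + h)))" for h
  define T where "T h1 h2 = (\<Sum>x\<in>UNIV. f x * cnj (f (x + h1)) * cnj (f (x + h2)) * f (x + h1 + h2))" for h1 h2
  have S: "complex_of_real ((cmod (sum f UNIV))\<^sup>2) = (\<Sum>h\<in>UNIV. S h)"
    unfolding cmod_sum_square_eq S_def by (rule sum.swap)
  have T: "complex_of_real ((cmod (S h))\<^sup>2) = (\<Sum>h2\<in>UNIV. T h h2)" for h
    unfolding cmod_sum_square_eq S_def T_def
    by (subst sum.swap) (simp add: mult.assoc add.assoc add.commute[of h])
  have "(cmod (sum f UNIV))\<^sup>2 = cmod (\<Sum>h\<in>UNIV. S h)" unfolding S[symmetric] norm_of_real by simp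
  also have "\<dots> \<le> (\<Sum>h\<in>UNIV. cmod (S h))" by (rule norm_sum)
  finally have "((cmod (sum f UNIV))\<^sup>2)\<^sup>2 \<le> (\<Sum>h\<in>UNIV. cmod (S h))\<^sup>2" by (rule power_mono) simp
  also have "\<dots> \<le> ?N * (\<Sum>h\<in>UNIV. (cmod (S h))\<^sup>2)" by (rule sum_square_le_card)
  also have "(\<Sum>h\<in>UNIV. (cmod (S h))\<^sup>2) \<le> (\<Sum>h\<in>UNIV. \<Sum>h2\<in>UNIV. cmod (T h h2))"
  proof (rule sum_mono)
    fix h
    have "(cmod (S h))\<^sup>2 = cmod (\<Sum>h2\<in>UNIV. T h h2)" unfolding T[symmetric] norm_of_real by simp
    also have "\<dots> \<le> (\<Sum>h2\<in>UNIV. cmod (T h h2))" by (rule norm_sum)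
    finally show "(cmod (S h))\<^sup>2 \<le> (\<Sum>h2\<in>UNIV. cmod (T h h2))" .
  qed
  finally have "((cmod (sum f UNIV)) ^ 4)\<^sup>2 \<le> (?N * (\<Sum>h\<in>UNIV. \<Sum>h2\<in>UNIV. cmod (T h h2)))\<^sup>2"
    by (intro power_mono) (auto simp flip: power_mult intro: mult_left_mono)
  also have "\<dots> = ?N\<^sup>2 * (\<Sum>h\<in>UNIV. \<Sum>h2\<in>UNIV. cmod (T h h2))\<^sup>2" by (simp add: power_mult_distrib)
  also have "\<dots> \<le> ?N\<^sup>2 * (?N * ?N * (\<Sum>h\<in>UNIV. \<Sum>h2\<in>UNIV. (cmod (T h h2))\<^sup>2))"
    by (intro mult_left_mono sum_sum_square_le_card) simp
  finally have "cmod (sum f UNIV) ^ 8 \<le> ?N ^ 4 * (\<Sum>h\<in>UNIV. \<Sum>h2\<in>UNIV. (cmod (T h h2))\<^sup>2)"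
    by (simp add: eval_nat_numeral mult_ac)
  then have "cmod (sum f UNIV) ^ 8 / ?N ^ 8 \<le> (\<Sum>h\<in>UNIV. \<Sum>h2\<in>UNIV. (cmod (T h h2))\<^sup>2) / ?N ^ 4"
    using N0 by (simp add: field_simps eval_nat_numeral)
  also have "\<dots> = Re (U3avg f)"
    unfolding U3avg_eq T_def by (simp add: eval_nat_numeral mult_ac)
  also have "\<dots> = U3norm f ^ 8" by (metis Re_complex_of_real U3norm_power8)
  finally have "cmod (avg UNIV f) ^ 8 \<le> U3norm f ^ 8"
    by (simp add: avg_def norm_divide power_divide)
  then show ?thesis by (rule power_mono_iff[THEN iffD1, rotated 3]) (auto simp: U3norm_nonneg)
qed

lemma u3norm_le_U3norm:
  fixes f :: "'a::{ab_group_add,finite} \<Rightarrow> complex"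
  shows "u3norm f UNIV \<le> U3norm f"
proof (rule u3norm_le)
  fix \<phi> :: "'a \<Rightarrow> real" assume "quadratic_phase UNIV \<phi>"
  then have "U3norm (\<lambda>x. f x * echar (- \<phi> x)) = U3norm f"
    by (simp add: U3norm_def U3avg_mult_quadratic_phase)
  then show "cmod (avg UNIV (\<lambda>x. f x * echar (- \<phi> x))) \<le> U3norm f"
    using cmod_avg_le_U3norm[of "\<lambda>x. f x * echar (- \<phi> x)"] by simp
qed

section \<open>Phases from field-valued functions, and extension from cosets\<close>

context additive_character
begin

text \<open>A logarithm of the character. Phases are given by real representatives, so a choice of
  argument is needed; it is additive only modulo 1.\<close>

definition e_arg :: "'F \<Rightarrow> real" where
  "e_arg a = Arg (e a) / (2 * pi)"

lemma echar_e_arg [simp]: "echar (e_arg a) = e a"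
  by (simp add: e_arg_def echar_Arg)

text \<open>The vanishing of the alternating sum is an exact identity in the field; applying
  \<open>e\<close> turns it into the congruence for the real lifts.\<close>

lemma quadratic_phase_e_arg:
  fixes Q :: "'b::ab_group_add \<Rightarrow> 'F"
  assumes "\<And>x h1 h2 h3. (\<And>\<omega>. vertex x h1 h2 h3 \<omega> \<in> B) \<Longrightarrow>
    (\<Sum>\<omega>\<in>UNIV. (-1) ^ weight \<omega> * Q (vertex x h1 h2 h3 \<omega>)) = 0"
  shows "quadratic_phase B (\<lambda>x. e_arg (Q x))"
  unfolding quadratic_phase_iff_echar
proof (intro allI impI)
  fix x h1 h2 h3 assume A: "\<forall>\<omega>. vertex x h1 h2 h3 \<omega> \<in> B"
  have e_sum: "e (\<Sum>x\<in>A. g x) = (\<Prod>x\<in>A. e (g x))" if "finite A" for A and g :: "bool \<times> bool \<times> bool \<Rightarrow> 'F"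
    using that by (induction A rule: finite_induct) (auto simp: e_add)
  have pow: "echar ((-1) ^ k * e_arg a) = e ((-1) ^ k * a)" for k a
    by (cases "even k") (auto simp: echar_uminus e_minus)
  have "echar (\<Sum>\<omega>\<in>UNIV. (-1) ^ weight \<omega> * e_arg (Q (vertex x h1 h2 h3 \<omega>))) =
      e (\<Sum>\<omega>\<in>UNIV. (-1) ^ weight \<omega> * Q (vertex x h1 h2 h3 \<omega>))"
    by (simp only: echar_sum pow e_sum finite)
  then show "echar (\<Sum>\<omega>\<in>UNIV. (-1) ^ weight \<omega> * e_arg (Q (vertex x h1 h2 h3 \<omega>))) = 1"
    using assms A by simp
qed

text \<open>Third differences of a polynomial of degree two vanish. The centre t is there because
  the phases used later are written in the coordinate x - t of a coset through t.\<close>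

lemma quadratic_phase_quadratic_form:
  fixes M :: "'F ^ 'n \<Rightarrow> 'F ^ 'n"
  assumes M: "\<And>x y. M (x + y) = M x + M y"
  shows "quadratic_phase B (\<lambda>x. e_arg (c * scalar_product (M (x - t)) (x - t) + scalar_product r (x - t)))"
proof (rule quadratic_phase_e_arg)
  fix x h1 h2 h3
  define b where "b x y = scalar_product (M x) y" for x y
  have b: "b (x + y) z = b x z + b y z" "b z (x + y) = b z x + b z y" for x y z
    by (simp_all add: b_def M scalar_product_simps)
  have v: "vertex x h1 h2 h3 \<omega> - t = vertex (x - t) h1 h2 h3 \<omega>" for \<omega>
    by (cases \<omega> rule: weight.cases) simp
  show "(\<Sum>\<omega>\<in>UNIV. (-1) ^ weight \<omega> *
      (c * scalar_product (M (vertex x h1 h2 h3 \<omega> - t)) (vertex x h1 h2 h3 \<omega> - t) +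
       scalar_product r (vertex x h1 h2 h3 \<omega> - t))) = 0"
    unfolding v b_def[symmetric]
    by (simp add: UNIV_Times_UNIV[symmetric] UNIV_bool sum.cartesian_product[symmetric]
        b scalar_product_simps(1) numeral_2_eq_2 numeral_3_eq_3 del: UNIV_Times_UNIV) algebra
qed

text \<open>The indicator of the coset is the mean over r of the characters ch r (x - y - \<pi> (x -
  y)). Each is a linear phase in x, so it merges with the extended quadratic phase, and every r
  costs at most N times the global norm.\<close>

lemma u3norm_coset_le:
  fixes W :: "('F ^ 'n) set"
  assumes W: "vec.subspace W"
  shows "real (card W) * u3norm f ((\<lambda>w. y + w) ` W) \<le> real CARD('F ^ 'n) * u3norm f UNIV"
proof -
  let ?N = "real CARD('F ^ 'n)" and ?Y = "(\<lambda>w. y + w) ` W"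
  have cardY: "card ?Y = card W" by (simp add: card_image)
  have W0: "card W > 0" using vec.subspace_0[OF W] by (auto simp: card_gt_0_iff)
  have N0: "?N > 0" by (simp only: of_nat_0_less_iff finite_UNIV_card_ge_0 finite)
  obtain \<pi> where \<pi>: "range \<pi> \<subseteq> W" "Vector_Spaces.linear (*s) (*s) \<pi>" "\<forall>w\<in>W. \<pi> w = w"
    using vec.linear_exists_left_inverse_on[OF vec.linear_id W] by auto
  have \<pi>_add: "\<pi> (x + y) = \<pi> x + \<pi> y" for x y
    using \<pi>(2) by (simp add: Vector_Spaces.linear_iff)
  have \<pi>_diff: "\<pi> (x - y) = \<pi> x - \<pi> y" for x y
    using \<pi>_add[of "x - y" y] by (simp add: algebra_simps)
  have mem_Y: "x \<in> ?Y \<longleftrightarrow> (x - y) - \<pi> (x - y) = 0" for x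
  proof
    assume "(x - y) - \<pi> (x - y) = 0"
    then have "x - y \<in> W" using \<pi>(1) by (metis eq_iff_diff_eq_0 rangeI subsetD)
    then show "x \<in> ?Y" by (intro image_eqI[of _ _ "x - y"]) auto
  qed (use \<pi>(3) in auto)
  have "u3norm f ?Y \<le> ?N * u3norm f UNIV / real (card W)"
  proof (rule u3norm_le)
    fix \<phi> assume \<phi>: "quadratic_phase ?Y \<phi>"
    \<comment> \<open>The point y - \<pi> y + \<pi> x equals y + \<pi> (x - y): it lies in the coset
      for every x and equals x when x does.\<close>
    define g where "g x = f x * echar (- \<phi> (y - \<pi> y + \<pi> x))" for x
    have g_eq: "g x = f x * echar (- \<phi> x)" if "x \<in> ?Y" for x
    proof -
      have "y - \<pi> y + \<pi> x = x" using mem_Y[of x] that by (simp add: \<pi>_diff algebra_simps)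
      then show ?thesis by (simp only: g_def)
    qed
    have bound: "cmod (\<Sum>x\<in>UNIV. g x * ch r (x - y - \<pi> (x - y))) \<le> ?N * u3norm f UNIV" for r
    proof -
      define Q where "Q x = scalar_product r (x - y - \<pi> (x - y))" for x
      have q1: "quadratic_phase UNIV (\<lambda>x. \<phi> (y - \<pi> y + \<pi> x))"
      proof (rule quadratic_phase_affine[OF \<phi> \<pi>_add])
        fix x
        have "y - \<pi> y + \<pi> x = y + \<pi> (x - y)" by (simp add: \<pi>_diff)
        then show "y - \<pi> y + \<pi> x \<in> ?Y" using \<pi>(1) by (intro image_eqI[of _ _ "\<pi> (x - y)"]) auto
      qed
      have q2: "quadratic_phase UNIV (\<lambda>x. e_arg (Q x))"
        by (rule quadratic_phase_e_arg)
          (simp add: Q_def UNIV_Times_UNIV[symmetric] UNIV_bool sum.cartesian_product[symmetric]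
          \<pi>_add \<pi>_diff scalar_product_simps algebra_simps numeral_2_eq_2 numeral_3_eq_3 del: UNIV_Times_UNIV)
      have "g x * ch r (x - y - \<pi> (x - y)) = f x * echar (- (\<phi> (y - \<pi> y + \<pi> x) - e_arg (Q x)))" for x
        by (simp add: g_def Q_def ch_def echar_add diff_conv_add_uminus del: add_uminus_conv_diff)
      then have "(\<Sum>x\<in>UNIV. g x * ch r (x - y - \<pi> (x - y))) =
          of_real ?N * avg UNIV (\<lambda>x. f x * echar (- (\<phi> (y - \<pi> y + \<pi> x) - e_arg (Q x))))"
        using N0 by (simp add: avg_def del: CARD_vec)
      then show ?thesis
        using cmod_avg_le_u3norm[OF quadratic_phase_diff[OF q1 q2], of f]
        by (simp add: norm_mult mult_left_mono del: CARD_vec)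
    qed
    have "of_real ?N * (\<Sum>x\<in>?Y. g x) = (\<Sum>x\<in>UNIV. if x \<in> ?Y then of_real ?N * g x else 0)"
      by (simp add: sum_distrib_left sum.If_cases del: CARD_vec)
    also have "\<dots> = (\<Sum>x\<in>UNIV. \<Sum>r\<in>UNIV. g x * ch r (x - y - \<pi> (x - y)))"
    proof (rule sum.cong[OF refl])
      fix x
      show "(if x \<in> ?Y then of_real ?N * g x else 0) = (\<Sum>r\<in>UNIV. g x * ch r (x - y - \<pi> (x - y)))"
        unfolding mem_Y sum_distrib_left[symmetric] sum_ch by (simp del: CARD_vec)
    qed
    also have "\<dots> = (\<Sum>r\<in>UNIV. \<Sum>x\<in>UNIV. g x * ch r (x - y - \<pi> (x - y)))" by (rule sum.swap)
    finally have "?N * cmod (\<Sum>x\<in>?Y. g x) = cmod (\<Sum>r\<in>UNIV. \<Sum>x\<in>UNIV. g x * ch r (x - y - \<pi> (x - y)))"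
      by (metis norm_mult norm_of_real abs_of_nat)
    also have "\<dots> \<le> (\<Sum>r\<in>(UNIV :: ('F ^ 'n) set). ?N * u3norm f UNIV)"
      by (intro sum_norm_le bound)
    finally have "?N * cmod (\<Sum>x\<in>?Y. g x) \<le> ?N * (?N * u3norm f UNIV)" by simp
    then have "cmod (\<Sum>x\<in>?Y. g x) \<le> ?N * u3norm f UNIV" using N0 by (simp del: CARD_vec)
    moreover have "avg ?Y (\<lambda>x. f x * echar (- \<phi> x)) = (\<Sum>x\<in>?Y. g x) / of_nat (card W)"
      unfolding avg_def cardY using g_eq by (intro arg_cong2[of _ _ _ _ "(/)"] sum.cong) auto
    ultimately show "cmod (avg ?Y (\<lambda>x. f x * echar (- \<phi> x))) \<le> ?N * u3norm f UNIV / real (card W)"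
      by (simp add: norm_divide divide_right_mono del: CARD_vec)
  qed
  then show ?thesis using W0 by (simp add: field_simps del: CARD_vec)
qed

end

section \<open>Linearisation and symmetry\<close>

context additive_character
begin

text \<open>
  Sums of six terms are what is needed: additivity of \<open>M\<close> compares three elements of
  \<open>2H - 2H\<close>. \<open>V\<close> collects the vertical differences of such sums.
\<close>
lemma linear_on_dense_coset:
  fixes B :: "('F ^ 'n) set" and \<xi> :: "'F ^ 'n \<Rightarrow> 'F ^ 'n"
  defines "N \<equiv> real CARD('F ^ 'n)"
  assumes q: "CARD('F) \<le> 8" and c: "0 < c" "c \<le> 1"
    and quads: "c * N ^ 3 \<le> real (card {(d, h, k). h \<in> B \<and> h + d \<in> B \<and> k \<in> B \<and> k + d \<in> B \<and>
      \<xi> h + \<xi> (k + d) = \<xi> k + \<xi> (h + d)})"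
  defines "\<alpha> \<equiv> c ^ 119 / 2 ^ 321"
  obtains W M h\<^sub>0 P where "vec.subspace W" "real CARD('n) - real (vec.dim W) \<le> 1 / \<alpha>\<^sup>2"
    "\<And>x y. M (x + y) = M x + M y" "P \<subseteq> B"
    "\<And>h. h \<in> P \<Longrightarrow> h - h\<^sub>0 \<in> W \<and> \<xi> h = \<xi> h\<^sub>0 + M (h - h\<^sub>0)" "real (card P) \<ge> \<alpha> * real (card W)"
proof -
  let ?q = "CARD('F)"
  have N0: "N > 0" unfolding N_def by (simp only: of_nat_0_less_iff finite_UNIV_card_ge_0 finite)
  have \<alpha>0: "\<alpha> > 0" using c by (simp add: \<alpha>_def)
  \<comment> \<open>In the product group, additive quadruples of the graph are exactly additive
    quadruples in B that \<xi> respects.\<close>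
  define A where "A = (\<lambda>h. (h, \<xi> h)) ` B"
  have finA: "finite A" by (simp add: A_def)
  have graph: "snd z = \<xi> (fst z)" "fst z \<in> B" if "z \<in> A" for z
    using that by (auto simp: A_def)
  have "card A \<le> card B" unfolding A_def by (rule card_image_le) simp
  also have "card B \<le> CARD('F ^ 'n)" by (rule card_mono) auto
  finally have cardA: "real (card A) \<le> N" by (simp add: N_def del: CARD_vec)

  have "card {(d, h, k). h \<in> B \<and> h + d \<in> B \<and> k \<in> B \<and> k + d \<in> B \<and> \<xi> h + \<xi> (k + d) = \<xi> k + \<xi> (h + d)}
      \<le> card {(a, b, c, d). (a, b) \<in> A \<times> A \<and> c \<in> A \<and> d \<in> A \<and> a + b = c + d}"
  proof (rule card_inj_on_le[of "\<lambda>(d, h, k). ((h, \<xi> h), (k + d, \<xi> (k + d)), (k, \<xi> k), (h + d, \<xi> (h + d)))"])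
    show "finite {(a, b, c, d). (a, b) \<in> A \<times> A \<and> c \<in> A \<and> d \<in> A \<and> a + b = c + d}"
      by (rule finite_subset[of _ "A \<times> A \<times> A \<times> A"]) (auto simp: finA)
  qed (auto simp: inj_on_def A_def algebra_simps)
  then have "c * N ^ 3 \<le> real (card {(a, b, c, d). (a, b) \<in> A \<times> A \<and> c \<in> A \<and> d \<in> A \<and> a + b = c + d})"
    using quads by linarith
  then obtain A' B' where A': "A' \<subseteq> A" "real (card A') \<ge> c * N / 12"
    and B': "B' \<subseteq> A" "real (card B') \<ge> c * N / 8"
    and AB: "real (card (A' + B')) \<le> 2 ^ 20 * N / c ^ 8"
    by (rule balog_szemeredi_gowers[OF finA N0 cardA c(1)])
  have finA': "finite A'" and finB': "finite B'" using A' B' finA finite_subset by blast+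
  have "c * N > 0" using c N0 by simp
  then have A'0: "A' \<noteq> {}" using A'(2) by auto
  \<comment> \<open>Doubling relative to card A' \<ge> cN/12: the factor 12 * 2^20 is rounded up to
    2^24.\<close>
  define K where "K = 2 ^ 24 / c ^ 9"
  have K1: "K \<ge> 1"
  proof -
    have "c ^ 9 \<le> 1" using c by (intro power_le_one) auto
    then show ?thesis using c by (simp add: K_def)
  qed
  have "real (card (A' + B')) \<le> K * real (card A')"
  proof -
    have "2 ^ 20 * N / c ^ 8 \<le> K * (c * N / 12)"
      using c N0 by (simp add: K_def field_simps eval_nat_numeral)
    also have "\<dots> \<le> K * real (card A')" using A' K1 by (intro mult_left_mono) auto
    finally show ?thesis using AB by linarith
  qed
  then have "real (card (diffset (nsums 7 B') (nsums 6 B'))) \<le> K ^ (7 + 6) * real (card A')"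
    by (rule pluennecke_ruzsa[OF finA' finB' A'0])
  also have "\<dots> \<le> K ^ 13 * N"
    using card_mono[OF finA A'(1)] cardA K1 by (intro mult_mono) auto
  finally have pl: "real (card (diffset (nsums 7 B') (nsums 6 B'))) \<le> K ^ 13 * N" .

  define V where "V = {v. v \<noteq> 0 \<and> (0, v) \<in> diffset (nsums 6 B') (nsums 6 B')}"
  \<comment> \<open>As B' lies on a graph, the first coordinate of (0, v) + b determines b and hence
    v. So the vertical differences of 6B' - 6B' multiply the size of B' inside 7B' - 6B', which the
    Pluennecke--Ruzsa inequality bounds with exponent 13.\<close>
  have "card (V \<times> B') \<le> card (diffset (nsums 7 B') (nsums 6 B'))"
  proof (rule card_inj_on_le[of "\<lambda>(v, b). (0, v) + b"])
    show "inj_on (\<lambda>(v, b). (0, v) + b) (V \<times> B')"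
    proof (rule inj_onI)
      fix p p' assume A: "p \<in> V \<times> B'" "p' \<in> V \<times> B'"
        and "(\<lambda>(v, b). (0, v) + b) p = (\<lambda>(v, b). (0, v) + b) p'"
      then have eq: "(0, fst p) + snd p = (0, fst p') + snd p'" by (simp add: case_prod_beta)
      have "fst (snd p) = fst (snd p')" using arg_cong[OF eq, of fst] by simp
      moreover from this have "snd (snd p) = snd (snd p')"
        using graph(1)[of "snd p"] graph(1)[of "snd p'"] A B'(1)
        by (metis SigmaE snd_conv subsetD)
      moreover from this have "fst p = fst p'" using arg_cong[OF eq, of snd] by simp
      ultimately show "p = p'" by (simp add: prod_eq_iff)
    qed
    show "(\<lambda>(v, b). (0, v) + b) ` (V \<times> B') \<subseteq> diffset (nsums 7 B') (nsums 6 B')"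
    proof (rule image_subsetI)
      fix p assume "p \<in> V \<times> B'"
      then obtain v b1 b2 where p: "p = (v, (b1, b2))" and "v \<in> V" "(b1, b2) \<in> B'" by auto
      then obtain y z where yz: "y \<in> nsums 6 B'" "z \<in> nsums 6 B'" "(0, v) = y - z"
        by (auto simp: V_def diffset_def)
      have "(0, v) + (b1, b2) = ((b1, b2) + y) - z" using yz by simp
      moreover have "(b1, b2) + y \<in> nsums (Suc 6) B'"
        unfolding nsums.simps using yz \<open>(b1, b2) \<in> B'\<close> by (intro set_plus_intro)
      ultimately show "(case p of (v, b) \<Rightarrow> (0, v) + b) \<in> diffset (nsums 7 B') (nsums 6 B')"
        using yz(2) unfolding p prod.case diffset_def
        by (intro image_eqI[of _ _ "((b1, b2) + y, z)"]) (simp_all add: eval_nat_numeral)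
    qed
    show "finite (diffset (nsums 7 B') (nsums 6 B'))" using finB' by (simp add: diffset_def)
  qed
  then have "real (card V) * real (card B') \<le> K ^ 13 * N"
    using pl by (simp add: card_cartesian_product flip: of_nat_mult)
  moreover have "real (card V) * (c * N / 8) \<le> real (card V) * real (card B')"
    using B' by (intro mult_left_mono) auto
  ultimately have "(real (card V) * c) * N \<le> (8 * K ^ 13) * N" by (simp add: algebra_simps)
  then have cardV: "real (card V) \<le> 8 * K ^ 13 / c" using N0 c by (simp add: field_simps)

  have q2: "?q > 1"
  proof -
    have "card {0, 1 :: 'F} \<le> ?q" by (rule card_mono) auto
    then show ?thesis by simp
  qed
  \<comment> \<open>With m cuts fewer than one element of V is expected to survive. Minimality of m
    loses at most one factor CARD('F) \<le> 8, hence 64 in place of 8 below.\<close>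
  define m where "m = (LEAST m. card V < ?q ^ m)"
  have m: "card V < ?q ^ m"
    unfolding m_def by (rule LeastI[of _ "card V"]) (use q2 less_exp in \<open>simp add: power_gt_expt\<close>)
  have qm: "real ?q ^ m \<le> 64 * K ^ 13 / c"
  proof (cases m)
    case 0
    have "c \<le> 64 * K ^ 13" using c K1 one_le_power[of K 13] by linarith
    then show ?thesis using 0 c by simp
  next
    case (Suc j)
    then have "\<not> card V < ?q ^ j" using not_less_Least[of j "\<lambda>m. card V < ?q ^ m"] by (simp add: m_def)
    then have "real ?q ^ j \<le> real (card V)" by (simp flip: of_nat_power)
    then have "real ?q ^ j \<le> 8 * K ^ 13 / c" using cardV by linarith
    then have "real ?q * real ?q ^ j \<le> 8 * (8 * K ^ 13 / c)" using q by (intro mult_mono) auto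
    then show ?thesis using Suc by simp
  qed
  have "0 \<notin> V" by (simp add: V_def)
  from separating_subspace[OF this finB', of snd m] obtain U S where
    U: "vec.subspace U" and S: "S \<subseteq> B'" "\<forall>s\<in>S. \<forall>t\<in>S. snd s - snd t \<in> U"
    and UV: "card (U \<inter> V) * ?q ^ m \<le> card V" and cS: "card B' \<le> card S * ?q ^ m" by blast
  \<comment> \<open>A natural number below 1: the separating subspace misses V entirely.\<close>
  have "card (U \<inter> V) * ?q ^ m < 1 * ?q ^ m" using UV m by linarith
  then have "card (U \<inter> V) = 0" by (subst (asm) mult_less_cancel2) simp
  then have UV0: "v \<notin> V" if "v \<in> U" for v using that by auto

  define H where "H = fst ` S"
  have SH: "(h, \<xi> h) \<in> S" if "h \<in> H" for h
    using that S B' graph(1) by (force simp: H_def)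
  have HB: "H \<subseteq> B" using S B' graph(2) by (auto simp: H_def)
  have "inj_on fst S"
    by (rule inj_onI, rule prod_eqI) (use S(1) B'(1) graph(1) in \<open>metis subsetD\<close>)+
  then have cardH: "card H = card S" by (simp add: H_def card_image)
  have "\<alpha> * N \<le> real (card H)"
  proof -
    \<comment> \<open>Inserting K = 2^24/c^9 explains the exponents: 119 = 2 + 9 * 13 and 321 = 9 +
      24 * 13.\<close>
    have "\<alpha> * N = c * N / 8 / (64 * K ^ 13 / c)"
      using c by (simp add: \<alpha>_def K_def field_simps power_divide flip: power_mult power_add power_Suc)
    also have "\<dots> \<le> real (card B') / (64 * K ^ 13 / c)"
      using B' c K1 by (intro divide_right_mono) auto
    also have "\<dots> \<le> real (card S) * real ?q ^ m / (64 * K ^ 13 / c)"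
      using cS c K1 by (intro divide_right_mono) (auto simp flip: of_nat_power of_nat_mult)
    also have "\<dots> \<le> real (card S) * real ?q ^ m / real ?q ^ m"
      using qm q2 c K1 by (intro divide_left_mono) auto
    finally show ?thesis using q2 cardH by simp
  qed
  then obtain W where W: "vec.subspace W" "real CARD('n) - real (vec.dim W) \<le> 1 / \<alpha>\<^sup>2"
    and bog: "\<And>w. w \<in> W \<Longrightarrow> \<exists>a\<in>H. \<exists>b\<in>H. \<exists>c\<in>H. \<exists>d\<in>H. w = a + b - c - d"
    using bogolyubov[OF \<alpha>0, of H] unfolding N_def by blast

  \<comment> \<open>The defect v is a sum of differences of frequencies from one coset of U, so it
    lies in U and thus outside V. It is also a vertical difference of two sums of six graph points,
    so only v = 0 remains.\<close>
  have freiman: "\<xi> a1 + \<xi> a2 + \<xi> a3 + \<xi> a4 + \<xi> a5 + \<xi> a6 = \<xi> b1 + \<xi> b2 + \<xi> b3 + \<xi> b4 + \<xi> b5 + \<xi> b6"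
    if "a1 \<in> H" "a2 \<in> H" "a3 \<in> H" "a4 \<in> H" "a5 \<in> H" "a6 \<in> H"
      "b1 \<in> H" "b2 \<in> H" "b3 \<in> H" "b4 \<in> H" "b5 \<in> H" "b6 \<in> H"
      and eq: "a1 + a2 + a3 + a4 + a5 + a6 = b1 + b2 + b3 + b4 + b5 + b6"
    for a1 a2 a3 a4 a5 a6 b1 b2 b3 b4 b5 b6
  proof -
    define v where "v = (\<xi> a1 + \<xi> a2 + \<xi> a3 + \<xi> a4 + \<xi> a5 + \<xi> a6) - (\<xi> b1 + \<xi> b2 + \<xi> b3 + \<xi> b4 + \<xi> b5 + \<xi> b6)"
    have diff: "\<xi> a - \<xi> b \<in> U" if "a \<in> H" "b \<in> H" for a b
      using S(2) SH[OF that(1)] SH[OF that(2)] by force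
    have sum6: "x1 + (x2 + (x3 + (x4 + (x5 + (x6 + 0))))) \<in> nsums 6 B'"
      if "x1 \<in> S" "x2 \<in> S" "x3 \<in> S" "x4 \<in> S" "x5 \<in> S" "x6 \<in> S" for x1 x2 x3 x4 x5 x6
    proof -
      have "6 = Suc (Suc (Suc (Suc (Suc (Suc 0)))))" by simp
      then show ?thesis using that S by (simp only: nsums.simps) (intro set_plus_intro, auto)
    qed
    have "(\<xi> a1 - \<xi> b1) + (\<xi> a2 - \<xi> b2) + (\<xi> a3 - \<xi> b3) + (\<xi> a4 - \<xi> b4) + (\<xi> a5 - \<xi> b5) + (\<xi> a6 - \<xi> b6) \<in> U"
      by (intro vec.subspace_add U diff that)
    also have "(\<xi> a1 - \<xi> b1) + (\<xi> a2 - \<xi> b2) + (\<xi> a3 - \<xi> b3) + (\<xi> a4 - \<xi> b4) + (\<xi> a5 - \<xi> b5) + (\<xi> a6 - \<xi> b6) = v"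
      by (simp add: v_def algebra_simps)
    finally have "v \<notin> V" by (rule UV0)
    moreover
    let ?Y = "(a1, \<xi> a1) + ((a2, \<xi> a2) + ((a3, \<xi> a3) + ((a4, \<xi> a4) + ((a5, \<xi> a5) + ((a6, \<xi> a6) + 0)))))"
    let ?Z = "(b1, \<xi> b1) + ((b2, \<xi> b2) + ((b3, \<xi> b3) + ((b4, \<xi> b4) + ((b5, \<xi> b5) + ((b6, \<xi> b6) + 0)))))"
    have "(0, v) = ?Y - ?Z"
      using eq by (simp add: v_def add.assoc prod_eq_iff)
    moreover have "?Y \<in> nsums 6 B'" "?Z \<in> nsums 6 B'"
      by (intro sum6 SH that)+
    ultimately have "(0, v) \<in> diffset (nsums 6 B') (nsums 6 B')" "v \<notin> V"
      unfolding diffset_def by (auto intro: image_eqI[of _ _ "(?Y, ?Z)"])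
    then have "v = 0" by (auto simp: V_def)
    then show ?thesis by (simp add: v_def)
  qed

  obtain r1 r2 r3 r4 where r: "r1 w \<in> H" "r2 w \<in> H" "r3 w \<in> H" "r4 w \<in> H" "w = r1 w + r2 w - r3 w - r4 w"
    if "w \<in> W" for w using bog by metis
  \<comment> \<open>An arbitrary representation of w in 2H - 2H is chosen; the order-six identity
    makes the choice immaterial.\<close>
  define M0 where "M0 w = \<xi> (r1 w) + \<xi> (r2 w) - \<xi> (r3 w) - \<xi> (r4 w)" for w
  have M0_add: "M0 (v + w) = M0 v + M0 w" if vw: "v \<in> W" "w \<in> W" for v w
  proof -
    have vw': "v + w \<in> W" using vw by (intro vec.subspace_add W)
    have "r1 v + r2 v + r1 w + r2 w + r3 (v + w) + r4 (v + w) =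
        r3 v + r4 v + r3 w + r4 w + r1 (v + w) + r2 (v + w)"
    proof -
      have "(r1 v + r2 v - r3 v - r4 v) + (r1 w + r2 w - r3 w - r4 w) =
          r1 (v + w) + r2 (v + w) - r3 (v + w) - r4 (v + w)"
        using r(5)[OF vw(1)] r(5)[OF vw(2)] r(5)[OF vw'] by metis
      then show ?thesis by (simp only: algebra_simps)
    qed
    from freiman[OF _ _ _ _ _ _ _ _ _ _ _ _ this] show ?thesis
      using r(1-4)[OF vw(1)] r(1-4)[OF vw(2)] r(1-4)[OF vw']
      by (simp add: M0_def algebra_simps)
  qed
  have M0_diff: "\<xi> h = \<xi> h' + M0 (h - h')" if h: "h \<in> H" "h' \<in> H" "h - h' \<in> W" for h h'
  proof -
    \<comment> \<open>A relation with three terms on each side, padded by h + h + h to six.\<close>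
    have "h + r3 (h - h') + r4 (h - h') + h + h + h = h' + r1 (h - h') + r2 (h - h') + h + h + h"
    proof -
      have "h - h' = p1 + p2 - p3 - p4 \<Longrightarrow> h + p3 + p4 = h' + p1 + p2" for p1 p2 p3 p4
        by (simp only: algebra_simps)
      from this[OF r(5)[OF h(3)]] show ?thesis by simp
    qed
    from freiman[OF _ _ _ _ _ _ _ _ _ _ _ _ this] show ?thesis
      using r(1-4)[OF h(3)] h by (simp add: M0_def algebra_simps)
  qed
  \<comment> \<open>\<open>M0\<close> is additive on W only; composing with a projection onto W
    makes it additive on the whole space.\<close>
  obtain \<pi> where \<pi>: "range \<pi> \<subseteq> W" "Vector_Spaces.linear (*s) (*s) \<pi>" "\<forall>w\<in>W. \<pi> w = w"
    using vec.linear_exists_left_inverse_on[OF vec.linear_id W(1)] by auto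
  have \<pi>_add: "\<pi> (x + y) = \<pi> x + \<pi> y" for x y
    using \<pi>(2) by (simp add: Vector_Spaces.linear_iff)

  \<comment> \<open>Some coset of W contains at least the average share of H. The base point is then
    moved from t to an element of H, where \<xi> is under control.\<close>
  obtain t where "(\<Sum>t\<in>UNIV. real (card {h\<in>H. h - t \<in> W})) \<le> N * real (card {h\<in>H. h - t \<in> W})"
    using ex_ge_average[of UNIV "\<lambda>t. real (card {h\<in>H. h - t \<in> W})"] unfolding N_def by auto
  moreover have "(\<Sum>t\<in>UNIV. card {h\<in>H. h - t \<in> W}) = card H * card W"
  proof -
    have "(\<Sum>t\<in>UNIV. card {h\<in>H. h - t \<in> W}) = (\<Sum>h\<in>H. card {t\<in>UNIV. h - t \<in> W})"
      by (rule sum_card_swap) auto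
    also have "\<dots> = (\<Sum>h\<in>H. card W)"
    proof (rule sum.cong[OF refl])
      fix h
      have "bij_betw (\<lambda>t. h - t) {t\<in>UNIV. h - t \<in> W} W"
        by (rule bij_betw_byWitness[of _ "\<lambda>t. h - t"]) auto
      then show "card {t\<in>UNIV. h - t \<in> W} = card W" by (rule bij_betw_same_card)
    qed
    finally show ?thesis by simp
  qed
  ultimately have t: "real (card H) * real (card W) \<le> N * real (card {h\<in>H. h - t \<in> W})"
    by (simp flip: of_nat_sum of_nat_mult)
  have "(\<alpha> * real (card W)) * N \<le> real (card {h\<in>H. h - t \<in> W}) * N"
    using mult_right_mono[OF \<open>\<alpha> * N \<le> real (card H)\<close>, of "real (card W)"] t by (simp add: algebra_simps)
  then have t': "\<alpha> * real (card W) \<le> real (card {h\<in>H. h - t \<in> W})" using N0 by simp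
  have "card W > 0" using vec.subspace_0[OF W(1)] by (auto simp: card_gt_0_iff)
  then have "\<alpha> * real (card W) > 0" using \<alpha>0 by simp
  then have "card {h\<in>H. h - t \<in> W} > 0" using t' by linarith
  then obtain h0 where h0: "h0 \<in> H" "h0 - t \<in> W" by (auto simp: card_gt_0_iff)
  have "h - h0 \<in> W" if "h - t \<in> W" for h
    using vec.subspace_diff[OF W(1) that h0(2)] by simp
  then have "\<xi> h = \<xi> h0 + M0 (\<pi> (h - h0)) \<and> h - h0 \<in> W" if "h \<in> H" "h - t \<in> W" for h
    using that M0_diff[of h h0] h0(1) \<pi>(3) by auto
  then show ?thesis
    using W t' HB \<pi>(1) by (intro that[of W "\<lambda>x. M0 (\<pi> x)" "{h\<in>H. h - t \<in> W}" h0])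
      (auto simp: \<pi>_add intro!: M0_add)
qed

end

section \<open>Localisation to cosets and symmetry of the linear part\<close>

lemma sum_subspace_shift:
  fixes W :: "('F::field ^ 'n) set"
  assumes W: "vec.subspace W" and u: "u \<in> W"
  shows "(\<Sum>x\<in>W. g (x + u)) = (\<Sum>x\<in>W. g x)" "(\<Sum>x\<in>W. g (u - x)) = (\<Sum>x\<in>W. g x)"
proof -
  show "(\<Sum>x\<in>W. g (x + u)) = (\<Sum>x\<in>W. g x)"
    by (rule sum.reindex_bij_witness[of _ "\<lambda>x. x - u" "\<lambda>x. x + u"])
      (auto simp: vec.subspace_diff vec.subspace_add W u)
  show "(\<Sum>x\<in>W. g (u - x)) = (\<Sum>x\<in>W. g x)"
    by (rule sum.reindex_bij_witness[of _ "\<lambda>x. u - x" "\<lambda>x. u - x"])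
      (auto simp: vec.subspace_diff vec.subspace_add W u)
qed

lemma sum_subspace_cosets:
  fixes V :: "('F::{field,finite} ^ 'n) set" and g :: "'F ^ 'n \<Rightarrow> 'b::comm_semiring_1"
  assumes W: "vec.subspace W" and V: "V \<subseteq> W"
  shows "(\<Sum>t\<in>W. \<Sum>v\<in>V. g (t + v)) = of_nat (card V) * (\<Sum>x\<in>W. g x)"
proof -
  have "(\<Sum>t\<in>W. \<Sum>v\<in>V. g (t + v)) = (\<Sum>v\<in>V. \<Sum>t\<in>W. g (t + v))" by (rule sum.swap)
  also have "\<dots> = (\<Sum>v\<in>V. \<Sum>x\<in>W. g x)"
    using V by (intro sum.cong refl sum_subspace_shift W) auto
  finally show ?thesis by simp
qed

text \<open>The translates of V cover each point card V times, so Cauchy--Schwarz over t passes from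
  a global sum to local ones without any loss in the index of V.\<close>

lemma cmod_sum_square_le_cosets:
  fixes V :: "('F::{field,finite} ^ 'n) set" and g :: "'F ^ 'n \<Rightarrow> complex"
  shows "(real (card V))\<^sup>2 * (cmod (\<Sum>x\<in>UNIV. g x))\<^sup>2 \<le>
    real CARD('F ^ 'n) * (\<Sum>t\<in>UNIV. (cmod (\<Sum>v\<in>V. g (t + v)))\<^sup>2)"
proof -
  have "(real (card V))\<^sup>2 * (cmod (\<Sum>x\<in>UNIV. g x))\<^sup>2 = (cmod (\<Sum>t\<in>UNIV. \<Sum>v\<in>V. g (t + v)))\<^sup>2"
    using sum_subspace_cosets[of UNIV V g] by (simp add: norm_mult power_mult_distrib)
  also have "\<dots> \<le> (\<Sum>t\<in>UNIV. cmod (\<Sum>v\<in>V. g (t + v)))\<^sup>2"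
    by (intro power_mono norm_sum) simp
  also have "\<dots> \<le> real CARD('F ^ 'n) * (\<Sum>t\<in>UNIV. (cmod (\<Sum>v\<in>V. g (t + v)))\<^sup>2)"
    by (rule sum_square_le_card)
  finally show ?thesis .
qed

context additive_character
begin

text \<open>
  The substitution \<open>w = z - x - y\<close> separates all factors in \<open>x\<close> from those in \<open>y\<close>
  except for the phase of the antisymmetric form \<open>M y \<cdot> x - M x \<cdot> y\<close>.
\<close>
lemma card_symmetric_kernel:
  fixes W :: "('F ^ 'n) set" and M :: "'F ^ 'n \<Rightarrow> 'F ^ 'n"
  assumes W: "vec.subspace W" and M: "\<And>x y. M (x + y) = M x + M y"
    and M_scale: "\<And>c x. M (c *s x) = c *s M x"
    and a: "\<And>x. cmod (a x) \<le> 1" and b: "\<And>x. cmod (b x) \<le> 1" and \<sigma>: "\<sigma> > 0"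
    and corr: "\<sigma> * real (card W) ^ 3 \<le> (\<Sum>w\<in>W. (cmod (\<Sum>v\<in>W. a (v + w) * b v * cnj (ch (M w) v)))\<^sup>2)"
  shows "\<sigma>\<^sup>2 * real (card W) \<le> real (card {y\<in>W. \<forall>x\<in>W. scalar_product (M y) x = scalar_product (M x) y})"
proof -
  let ?n = "real (card W)"
  have M_diff: "M (x - y) = M x - M y" for x y
    using M[of "x - y" y] by (simp add: algebra_simps)
  have n0: "?n > 0" using vec.subspace_0[OF W] by (auto simp: card_gt_0_iff)
  \<comment> \<open>A bicharacter measuring the failure of symmetry; it is trivial in x exactly when
    y lies in the kernel being counted.\<close>
  define \<beta> where "\<beta> x y = e (scalar_product (M y) x - scalar_product (M x) y)" for x y
  have \<beta>: "cmod (\<beta> x y) = 1" "\<beta> (x + x') y = \<beta> x y * \<beta> x' y" "\<beta> x (y + y') = \<beta> x y * \<beta> x y'"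
    "\<beta> x (- y) = cnj (\<beta> x y)" for x x' y y'
  proof -
    have "M (- y) = - M y" using M_diff[of 0 y] M_diff[of 0 0] by simp
    then show "\<beta> x (- y) = cnj (\<beta> x y)"
      by (simp add: \<beta>_def scalar_product_simps flip: e_minus)
  qed (simp_all add: \<beta>_def M scalar_product_simps algebra_simps flip: e_add)
  define A where "A z x = cnj (a (z - x)) * b x * cnj (ch (M z) x) * ch (M x) x" for z x
  define B where "B z y = a (z - y) * cnj (b y) * ch (M z) y * cnj (ch (M y) y)" for z y
  have A_le: "cmod (A z x) \<le> 1" and B_le: "cmod (B z x) \<le> 1" for z x
    by (simp_all add: A_def B_def norm_mult a b mult_le_one)
  have "complex_of_real (\<Sum>w\<in>W. (cmod (\<Sum>v\<in>W. a (v + w) * b v * cnj (ch (M w) v)))\<^sup>2) =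
      (\<Sum>w\<in>W. \<Sum>x\<in>W. \<Sum>y\<in>W. (a (x + w) * b x * cnj (ch (M w) x)) * cnj (a (y + w) * b y * cnj (ch (M w) y)))"
    by (simp only: of_real_sum complex_norm_square cnj_sum sum_product)
  also have "\<dots> = (\<Sum>x\<in>W. \<Sum>w\<in>W. \<Sum>y\<in>W. (a (x + w) * b x * cnj (ch (M w) x)) * cnj (a (y + w) * b y * cnj (ch (M w) y)))"
    by (rule sum.swap)
  also have "\<dots> = (\<Sum>x\<in>W. \<Sum>y\<in>W. \<Sum>w\<in>W. (a (x + w) * b x * cnj (ch (M w) x)) * cnj (a (y + w) * b y * cnj (ch (M w) y)))"
    by (intro sum.cong refl sum.swap)
  also have "\<dots> = (\<Sum>x\<in>W. \<Sum>y\<in>W. \<Sum>z\<in>W. A z x * (B z y * \<beta> x y))"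
  proof (rule sum.cong[OF refl], rule sum.cong[OF refl])
    fix x y assume xy: "x \<in> W" "y \<in> W"
    have "(\<Sum>w\<in>W. (a (x + w) * b x * cnj (ch (M w) x)) * cnj (a (y + w) * b y * cnj (ch (M w) y))) =
        (\<Sum>z\<in>W. (a (x + (z + (- x - y))) * b x * cnj (ch (M (z + (- x - y))) x)) *
          cnj (a (y + (z + (- x - y))) * b y * cnj (ch (M (z + (- x - y))) y)))"
      by (rule sum_subspace_shift(1)[symmetric, OF W]) (use xy W in \<open>auto simp: vec.subspace_neg vec.subspace_diff\<close>)
    also have "\<dots> = (\<Sum>z\<in>W. A z x * (B z y * \<beta> x y))"
    proof (rule sum.cong[OF refl])
      fix z
      have args: "x + (z + (- x - y)) = z - y" "y + (z + (- x - y)) = z - x" "z + (- x - y) = z - x - y"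
        by (simp_all add: algebra_simps)
      have "cnj (ch (M (z - x - y)) x) * ch (M (z - x - y)) y =
          cnj (ch (M z) x) * ch (M x) x * (ch (M z) y * cnj (ch (M y) y) * \<beta> x y)"
        by (simp add: ch_def \<beta>_def M_diff M scalar_product_simps algebra_simps flip: e_minus e_add)
      then show "(a (x + (z + (- x - y))) * b x * cnj (ch (M (z + (- x - y))) x)) *
          cnj (a (y + (z + (- x - y))) * b y * cnj (ch (M (z + (- x - y))) y)) = A z x * (B z y * \<beta> x y)"
        unfolding args A_def B_def by simp
    qed
    finally show "(\<Sum>w\<in>W. (a (x + w) * b x * cnj (ch (M w) x)) * cnj (a (y + w) * b y * cnj (ch (M w) y))) =
        (\<Sum>z\<in>W. A z x * (B z y * \<beta> x y))" .
  qed
  also have "\<dots> = (\<Sum>x\<in>W. \<Sum>z\<in>W. \<Sum>y\<in>W. A z x * (B z y * \<beta> x y))"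
    by (intro sum.cong refl sum.swap)
  also have "\<dots> = (\<Sum>z\<in>W. \<Sum>x\<in>W. \<Sum>y\<in>W. A z x * (B z y * \<beta> x y))"
    by (rule sum.swap)
  also have "\<dots> = (\<Sum>z\<in>W. \<Sum>x\<in>W. A z x * (\<Sum>y\<in>W. B z y * \<beta> x y))"
    by (simp only: sum_distrib_left)
  finally have eq: "complex_of_real (\<Sum>w\<in>W. (cmod (\<Sum>v\<in>W. a (v + w) * b v * cnj (ch (M w) v)))\<^sup>2) = \<dots>" .
  have "\<sigma> * ?n ^ 3 \<le> cmod (complex_of_real (\<Sum>w\<in>W. (cmod (\<Sum>v\<in>W. a (v + w) * b v * cnj (ch (M w) v)))\<^sup>2))"
    using corr by (simp only: norm_of_real)
  also have "\<dots> \<le> (\<Sum>z\<in>W. \<Sum>x\<in>W. cmod (\<Sum>y\<in>W. B z y * \<beta> x y))"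
    unfolding eq
  proof (intro sum_norm_le)
    fix z x
    show "cmod (A z x * (\<Sum>y\<in>W. B z y * \<beta> x y)) \<le> cmod (\<Sum>y\<in>W. B z y * \<beta> x y)"
      unfolding norm_mult[of "A z x"] using A_le by (intro mult_left_le_one_le) auto
  qed
  finally have sum_ge: "\<sigma> * ?n ^ 3 \<le> (\<Sum>z\<in>W. \<Sum>x\<in>W. cmod (\<Sum>y\<in>W. B z y * \<beta> x y))" .
  \<comment> \<open>With z fixed only \<beta> couples x and y. Cauchy--Schwarz in x then removes the
    remaining dependence on the functions a and b.\<close>
  have "W \<noteq> {}" using n0 by auto
  then obtain z where "(\<Sum>z\<in>W. \<Sum>x\<in>W. cmod (\<Sum>y\<in>W. B z y * \<beta> x y)) \<le> ?n * (\<Sum>x\<in>W. cmod (\<Sum>y\<in>W. B z y * \<beta> x y))"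
    using ex_ge_average[of W "\<lambda>z. \<Sum>x\<in>W. cmod (\<Sum>y\<in>W. B z y * \<beta> x y)"] by auto
  with sum_ge have "?n * (\<sigma> * ?n\<^sup>2) \<le> ?n * (\<Sum>x\<in>W. cmod (\<Sum>y\<in>W. B z y * \<beta> x y))"
    by (simp add: power3_eq_cube power2_eq_square mult_ac)
  then have "\<sigma> * ?n\<^sup>2 \<le> (\<Sum>x\<in>W. cmod (\<Sum>y\<in>W. B z y * \<beta> x y))" using n0 by simp
  then have "(\<sigma> * ?n\<^sup>2)\<^sup>2 \<le> (\<Sum>x\<in>W. cmod (\<Sum>y\<in>W. B z y * \<beta> x y))\<^sup>2"
    using \<sigma> by (intro power_mono) auto
  also have "\<dots> \<le> ?n * (\<Sum>x\<in>W. (cmod (\<Sum>y\<in>W. B z y * \<beta> x y))\<^sup>2)" by (rule sum_square_le_card)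
  finally have sq: "(\<sigma> * ?n\<^sup>2)\<^sup>2 \<le> ?n * (\<Sum>x\<in>W. (cmod (\<Sum>y\<in>W. B z y * \<beta> x y))\<^sup>2)" .
  have "complex_of_real (\<Sum>x\<in>W. (cmod (\<Sum>y\<in>W. B z y * \<beta> x y))\<^sup>2) =
      (\<Sum>x\<in>W. \<Sum>y\<in>W. \<Sum>y'\<in>W. B z y * cnj (B z y') * \<beta> x (y - y'))"
    unfolding of_real_sum complex_norm_square cnj_sum sum_product
    by (intro sum.cong refl) (simp add: diff_conv_add_uminus \<beta> del: add_uminus_conv_diff)
  also have "\<dots> = (\<Sum>y\<in>W. \<Sum>x\<in>W. \<Sum>y'\<in>W. B z y * cnj (B z y') * \<beta> x (y - y'))" by (rule sum.swap)
  also have "\<dots> = (\<Sum>y\<in>W. \<Sum>y'\<in>W. \<Sum>x\<in>W. B z y * cnj (B z y') * \<beta> x (y - y'))"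
    by (intro sum.cong refl sum.swap)
  also have "\<dots> = (\<Sum>y\<in>W. \<Sum>y'\<in>W. B z y * cnj (B z y') * (\<Sum>x\<in>W. \<beta> x (y - y')))"
    by (simp only: sum_distrib_left)
  finally have eq2: "complex_of_real (\<Sum>x\<in>W. (cmod (\<Sum>y\<in>W. B z y * \<beta> x y))\<^sup>2) = \<dots>" .
  have "(\<Sum>x\<in>W. (cmod (\<Sum>y\<in>W. B z y * \<beta> x y))\<^sup>2) =
      cmod (complex_of_real (\<Sum>x\<in>W. (cmod (\<Sum>y\<in>W. B z y * \<beta> x y))\<^sup>2))"
    by (simp only: norm_of_real) (simp add: sum_nonneg)
  also have "\<dots> \<le> (\<Sum>y\<in>W. \<Sum>y'\<in>W. cmod (\<Sum>x\<in>W. \<beta> x (y - y')))"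
    unfolding eq2
  proof (intro sum_norm_le)
    fix y y'
    have "cmod (B z y * cnj (B z y')) \<le> 1" by (simp add: norm_mult B_le mult_le_one)
    then show "cmod (B z y * cnj (B z y') * (\<Sum>x\<in>W. \<beta> x (y - y'))) \<le> cmod (\<Sum>x\<in>W. \<beta> x (y - y'))"
      unfolding norm_mult[of "B z y * cnj (B z y')"] by (intro mult_left_le_one_le) auto
  qed
  also have "\<dots> = (\<Sum>y\<in>W. \<Sum>u\<in>W. cmod (\<Sum>x\<in>W. \<beta> x u))"
    by (intro sum.cong refl sum_subspace_shift(2) W)
  also have "\<dots> = ?n * (\<Sum>u\<in>W. cmod (\<Sum>x\<in>W. \<beta> x u))" by simp
  \<comment> \<open>For fixed u the map x \<mapsto> \<beta> x u is a character of W: its sum is card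
    W on the kernel and 0 elsewhere.\<close>
  also have "(\<Sum>u\<in>W. cmod (\<Sum>x\<in>W. \<beta> x u)) \<le> (\<Sum>u\<in>W. if \<forall>x\<in>W. scalar_product (M u) x = scalar_product (M x) u then ?n else 0)"
  proof (rule sum_mono)
    fix u assume u: "u \<in> W"
    show "cmod (\<Sum>x\<in>W. \<beta> x u) \<le> (if \<forall>x\<in>W. scalar_product (M u) x = scalar_product (M x) u then ?n else 0)"
    proof (cases "\<forall>x\<in>W. scalar_product (M u) x = scalar_product (M x) u")
      case True
      then show ?thesis by (simp add: \<beta>_def)
    next
      case False
      then obtain x0 where x0: "x0 \<in> W" and ne: "scalar_product (M u) x0 - scalar_product (M x0) u \<noteq> 0" by auto
      obtain c where c: "e c \<noteq> 1" using nontrivial by blast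
      \<comment> \<open>Rescaling x0 gives the antisymmetric form a value c with e c \<noteq> 1;
        this is where homogeneity of M is used.\<close>
      define k where "k = c / (scalar_product (M u) x0 - scalar_product (M x0) u)"
      have "(\<Sum>x\<in>W. \<beta> x u) = 0"
      proof (rule sum_character_eq_0[where s = "k *s x0"])
        have "k * (scalar_product (M u) x0 - scalar_product (M x0) u) = c" using ne by (simp add: k_def)
        then show "\<beta> (k *s x0) u \<noteq> 1"
          using c by (simp add: \<beta>_def M_scale scalar_product_simps right_diff_distrib)
      qed (use W x0 in \<open>auto simp: \<beta> vec.subspace_add vec.subspace_scale\<close>)
      then show ?thesis using False by simp
    qed
  qed
  also have "\<dots> = ?n * real (card {y\<in>W. \<forall>x\<in>W. scalar_product (M y) x = scalar_product (M x) y})"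
    by (subst sum.inter_filter[symmetric]) auto
  finally have "(\<sigma> * ?n\<^sup>2)\<^sup>2 \<le> ?n * (?n * (?n * real (card {y\<in>W. \<forall>x\<in>W. scalar_product (M y) x = scalar_product (M x) y})))"
    using sq by (elim order_trans) (simp add: mult_left_mono)
  then have "?n ^ 3 * (\<sigma>\<^sup>2 * ?n) \<le> ?n ^ 3 * real (card {y\<in>W. \<forall>x\<in>W. scalar_product (M y) x = scalar_product (M x) y})"
    by (simp add: eval_nat_numeral mult_ac)
  then show ?thesis using n0 by simp
qed

text \<open>Localising to a coset of W yields the symmetric kernel W'; localising once more, to
  cosets of W', confines both variables to the region where M is symmetric. All averages are
  relative to W or W', so the lower bound remains \<sigma>.\<close>

lemma sum_u3norm_cosets:
  fixes W :: "('F ^ 'n) set" and M :: "'F ^ 'n \<Rightarrow> 'F ^ 'n" and f :: "'F ^ 'n \<Rightarrow> complex"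
  defines "N \<equiv> real CARD('F ^ 'n)"
  assumes two: "(2 :: 'F) \<noteq> 0"
    and W: "vec.subspace W" and M: "\<And>x y. M (x + y) = M x + M y" and M_scale: "\<And>c x. M (c *s x) = c *s M x"
    and f: "\<And>x. cmod (f x) \<le> 1" and \<sigma>: "\<sigma> > 0"
    and corr: "\<sigma> * real (card W) * N\<^sup>2 \<le>
      (\<Sum>w\<in>W. (cmod (\<Sum>x\<in>UNIV. f (x + (h\<^sub>0 + w)) * cnj (f x) * cnj (ch (\<xi>\<^sub>0 + M w) x)))\<^sup>2)"
  obtains W' where "vec.subspace W'" "W' \<subseteq> W" "\<sigma>\<^sup>2 * real (card W) \<le> real (card W')"
    "\<sigma> * N \<le> (\<Sum>t\<in>UNIV. u3norm f ((\<lambda>w. t + w) ` W'))"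
proof -
  define G where "G w x = f (x + (h\<^sub>0 + w)) * cnj (f x) * cnj (ch (\<xi>\<^sub>0 + M w) x)" for w x
  let ?n = "real (card W)"
  have n0: "?n > 0" using vec.subspace_0[OF W] by (auto simp: card_gt_0_iff)
  have N0: "N > 0" unfolding N_def by (simp only: of_nat_0_less_iff finite_UNIV_card_ge_0 finite)
  \<comment> \<open>Applied with V = W to find the kernel and with V = W' to exploit it, while w
    ranges over W both times.\<close>
  have localised: "\<sigma> * ?n * N * (real (card V))\<^sup>2 \<le> (\<Sum>t\<in>UNIV. \<Sum>w\<in>W. (cmod (\<Sum>v\<in>V. G w (t + v)))\<^sup>2)"
    for V :: "('F ^ 'n) set"
  proof -
    have "(real (card V))\<^sup>2 * (\<sigma> * ?n * N\<^sup>2) \<le> (real (card V))\<^sup>2 * (\<Sum>w\<in>W. (cmod (\<Sum>x\<in>UNIV. G w x))\<^sup>2)"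
      using corr unfolding G_def by (rule mult_left_mono) simp
    also have "\<dots> \<le> (\<Sum>w\<in>W. N * (\<Sum>t\<in>UNIV. (cmod (\<Sum>v\<in>V. G w (t + v)))\<^sup>2))"
      unfolding sum_distrib_left N_def by (intro sum_mono, rule cmod_sum_square_le_cosets[unfolded sum_distrib_left])
    also have "\<dots> = N * (\<Sum>t\<in>UNIV. \<Sum>w\<in>W. (cmod (\<Sum>v\<in>V. G w (t + v)))\<^sup>2)"
      by (subst sum.swap) (simp only: sum_distrib_left)
    finally have "N * (\<sigma> * ?n * N * (real (card V))\<^sup>2) \<le> \<dots>"
      by (simp add: power2_eq_square mult_ac)
    then show ?thesis using N0 by simp
  qed
  have norm_G: "cmod (\<Sum>v\<in>V. G w (t + v)) =
      cmod (\<Sum>v\<in>V. f (t + h\<^sub>0 + (v + w)) * (cnj (f (t + v)) * cnj (ch \<xi>\<^sub>0 v)) * cnj (ch (M w) v))" for V w t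
  proof -
    have "(\<Sum>v\<in>V. G w (t + v)) = cnj (ch (\<xi>\<^sub>0 + M w) t) *
        (\<Sum>v\<in>V. f (t + h\<^sub>0 + (v + w)) * (cnj (f (t + v)) * cnj (ch \<xi>\<^sub>0 v)) * cnj (ch (M w) v))"
      unfolding sum_distrib_left
      by (intro sum.cong refl) (simp add: G_def ch_right ch_left add_ac mult_ac)
    then show ?thesis by (simp add: norm_mult)
  qed

  define W' where "W' = {y\<in>W. \<forall>x\<in>W. scalar_product (M y) x = scalar_product (M x) y}"
  have M0: "M 0 = 0" using M[of 0 0] by simp
  have W': "vec.subspace W'"
    using W by (auto simp: W'_def vec.subspace_def M0 M M_scale scalar_product_simps)
  have W'W: "W' \<subseteq> W" by (auto simp: W'_def)
  let ?k = "real (card W')"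
  have k0: "?k > 0" using vec.subspace_0[OF W'] by (auto simp: card_gt_0_iff)

  obtain t where "(\<Sum>t\<in>UNIV. \<Sum>w\<in>W. (cmod (\<Sum>v\<in>W. G w (t + v)))\<^sup>2) \<le>
      N * (\<Sum>w\<in>W. (cmod (\<Sum>v\<in>W. G w (t + v)))\<^sup>2)"
    using ex_ge_average[of UNIV "\<lambda>t. \<Sum>w\<in>W. (cmod (\<Sum>v\<in>W. G w (t + v)))\<^sup>2"] unfolding N_def by auto
  with localised[of W] have "N * (\<sigma> * ?n ^ 3) \<le> N * (\<Sum>w\<in>W. (cmod (\<Sum>v\<in>W. G w (t + v)))\<^sup>2)"
    by (simp add: power2_eq_square power3_eq_cube mult_ac)
  then have "\<sigma> * ?n ^ 3 \<le> (\<Sum>w\<in>W. (cmod (\<Sum>v\<in>W. G w (t + v)))\<^sup>2)" using N0 by simp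
  then have card_W': "\<sigma>\<^sup>2 * ?n \<le> ?k"
    unfolding W'_def norm_G
    by (intro card_symmetric_kernel[OF W M M_scale _ _ \<sigma>]) (auto simp: norm_mult f)

  \<comment> \<open>Writing w = s + u and fixing a good s leaves the shift u in W'; the contribution
    M s is a fixed linear phase.\<close>
  have "(\<Sum>s\<in>W. \<Sum>u\<in>W'. \<Sum>t\<in>UNIV. (cmod (\<Sum>v\<in>W'. G (s + u) (t + v)))\<^sup>2) =
      ?k * (\<Sum>w\<in>W. \<Sum>t\<in>UNIV. (cmod (\<Sum>v\<in>W'. G w (t + v)))\<^sup>2)"
    using sum_subspace_cosets[OF W W'W, of "\<lambda>w. \<Sum>t\<in>UNIV. (cmod (\<Sum>v\<in>W'. G w (t + v)))\<^sup>2"] by simp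
  also have "(\<Sum>w\<in>W. \<Sum>t\<in>UNIV. (cmod (\<Sum>v\<in>W'. G w (t + v)))\<^sup>2) =
      (\<Sum>t\<in>UNIV. \<Sum>w\<in>W. (cmod (\<Sum>v\<in>W'. G w (t + v)))\<^sup>2)" by (rule sum.swap)
  also have "?k * \<dots> \<ge> ?k * (\<sigma> * ?n * N * ?k\<^sup>2)" by (intro mult_left_mono localised) simp
  finally have sum_s: "?k * (\<sigma> * ?n * N * ?k\<^sup>2) \<le>
      (\<Sum>s\<in>W. \<Sum>u\<in>W'. \<Sum>t\<in>UNIV. (cmod (\<Sum>v\<in>W'. G (s + u) (t + v)))\<^sup>2)" .
  have "W \<noteq> {}" using n0 by auto
  then obtain s where s: "s \<in> W" and "(\<Sum>s\<in>W. \<Sum>u\<in>W'. \<Sum>t\<in>UNIV. (cmod (\<Sum>v\<in>W'. G (s + u) (t + v)))\<^sup>2)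
      \<le> ?n * (\<Sum>u\<in>W'. \<Sum>t\<in>UNIV. (cmod (\<Sum>v\<in>W'. G (s + u) (t + v)))\<^sup>2)"
    using ex_ge_average[of W "\<lambda>s. \<Sum>u\<in>W'. \<Sum>t\<in>UNIV. (cmod (\<Sum>v\<in>W'. G (s + u) (t + v)))\<^sup>2"] by auto
  with sum_s have "?n * (?k ^ 3 * (\<sigma> * N)) \<le> ?n * (\<Sum>u\<in>W'. \<Sum>t\<in>UNIV. (cmod (\<Sum>v\<in>W'. G (s + u) (t + v)))\<^sup>2)"
    by (simp add: power2_eq_square power3_eq_cube mult_ac)
  then have "?k ^ 3 * (\<sigma> * N) \<le> (\<Sum>u\<in>W'. \<Sum>t\<in>UNIV. (cmod (\<Sum>v\<in>W'. G (s + u) (t + v)))\<^sup>2)"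
    using n0 by simp
  also have "\<dots> = (\<Sum>t\<in>UNIV. \<Sum>u\<in>W'. (cmod (\<Sum>v\<in>W'. G (s + u) (t + v)))\<^sup>2)" by (rule sum.swap)
  also have "\<dots> \<le> (\<Sum>t\<in>UNIV. ?k ^ 3 * u3norm f ((\<lambda>w. t + w) ` W'))"
  proof (rule sum_mono)
    fix t
    let ?T = "(\<lambda>w. t + w) ` W'"
    \<comment> \<open>Halving makes the polarisation of \<open>Q\<close> on W' equal to M u . v
      itself, by symmetry.\<close>
    define Q where "Q x = 1 / 2 * scalar_product (M x) x" for x
    have Q: "scalar_product (M u) v = Q (v + u) - Q v - Q u" if "u \<in> W'" "v \<in> W'" for u v
    proof -
      have "scalar_product (M v) u = scalar_product (M u) v" using that unfolding W'_def by blast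
      then have "scalar_product (M (v + u)) (v + u) - scalar_product (M v) v - scalar_product (M u) u =
          2 * scalar_product (M u) v"
        by (simp add: M scalar_product_simps)
      then have "Q (v + u) - Q v - Q u = 1 / 2 * (2 * scalar_product (M u) v)"
        by (simp only: Q_def flip: right_diff_distrib)
      then show ?thesis using two by simp
    qed
    \<comment> \<open>Both functions absorb a copy of the phase \<open>Q\<close>; the twisted sum
      becomes a plain correlation up to a factor of modulus one depending on u.\<close>
    define a where "a x = (if x \<in> W' then f (t + h\<^sub>0 + (x + s)) * cnj (e (Q x)) else 0)" for x
    define b where "b v = (if v \<in> W' then cnj (f (t + v)) * cnj (ch (\<xi>\<^sub>0 + M s) v) * e (Q v) else 0)" for v
    have corr_eq: "cmod (\<Sum>v\<in>W'. G (s + u) (t + v)) = cmod (\<Sum>v\<in>UNIV. b v * a (v + u))" if u: "u \<in> W'" for u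
    proof -
      have "(\<Sum>v\<in>UNIV. b v * a (v + u)) = (\<Sum>v\<in>W'. b v * a (v + u))"
        by (rule sum.mono_neutral_right) (auto simp: b_def)
      also have "\<dots> = (\<Sum>v\<in>W'. cnj (e (Q u)) *
          (f (t + h\<^sub>0 + (v + (s + u))) * (cnj (f (t + v)) * cnj (ch \<xi>\<^sub>0 v)) * cnj (ch (M (s + u)) v)))"
      proof (rule sum.cong[OF refl])
        fix v assume v: "v \<in> W'"
        have "v + u \<in> W'" by (rule vec.subspace_add[OF W' v u])
        moreover have "cnj (ch (M u) v) * cnj (e (Q u)) = cnj (e (Q (v + u))) * e (Q v)"
        proof -
          have "ch (M u) v * e (Q u) = e (Q (v + u)) * cnj (e (Q v))"
            by (simp add: ch_def Q[OF u v] flip: e_add e_minus)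
          then show ?thesis by (metis complex_cnj_cnj complex_cnj_mult)
        qed
        ultimately show "b v * a (v + u) = cnj (e (Q u)) *
          (f (t + h\<^sub>0 + (v + (s + u))) * (cnj (f (t + v)) * cnj (ch \<xi>\<^sub>0 v)) * cnj (ch (M (s + u)) v))"
          using v by (simp add: a_def b_def ch_left M add_ac mult_ac)
      qed
      finally show ?thesis unfolding norm_G sum_distrib_left[symmetric] by (simp add: norm_mult)
    qed
    have cardT: "card ?T = card W'" by (simp add: card_image)
    have b_le: "cmod (\<Sum>v\<in>UNIV. b v * ch r v) \<le> ?k * u3norm f ?T" for r
    proof -
      define \<phi> where "\<phi> x = e_arg (1 / 2 * scalar_product (M (x - t)) (x - t) + scalar_product (r - (\<xi>\<^sub>0 + M s)) (x - t))" for x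
      have "quadratic_phase ?T \<phi>" unfolding \<phi>_def by (rule quadratic_phase_quadratic_form[OF M])
      then have "cmod (avg ?T (\<lambda>x. f x * echar (- \<phi> x))) \<le> u3norm f ?T" by (rule cmod_avg_le_u3norm)
      then have "?k * cmod (avg ?T (\<lambda>x. f x * echar (- \<phi> x))) \<le> ?k * u3norm f ?T" by (simp add: mult_left_mono)
      moreover have "?k * cmod (avg ?T (\<lambda>x. f x * echar (- \<phi> x))) = cmod (\<Sum>x\<in>?T. f x * echar (- \<phi> x))"
        using k0 by (simp add: avg_def norm_divide cardT)
      moreover have "(\<Sum>x\<in>?T. f x * echar (- \<phi> x)) = (\<Sum>v\<in>W'. f (t + v) * echar (- \<phi> (t + v)))"
        by (subst sum.reindex) auto
      moreover have "\<dots> = cnj (\<Sum>v\<in>UNIV. b v * ch r v)"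
      proof -
        have "(\<Sum>v\<in>UNIV. b v * ch r v) = (\<Sum>v\<in>W'. b v * ch r v)"
          by (rule sum.mono_neutral_right) (auto simp: b_def)
        also have "\<dots> = (\<Sum>v\<in>W'. cnj (f (t + v) * echar (- \<phi> (t + v))))"
          by (intro sum.cong refl)
            (simp add: b_def \<phi>_def echar_uminus Q_def e_add ch_def[symmetric] ch_left mult_ac)
        finally show ?thesis by simp
      qed
      ultimately show ?thesis by (metis complex_mod_cnj)
    qed
    have "(\<Sum>u\<in>W'. (cmod (\<Sum>v\<in>W'. G (s + u) (t + v)))\<^sup>2) = (\<Sum>u\<in>W'. (cmod (\<Sum>v\<in>UNIV. b v * a (v + u)))\<^sup>2)"
      by (intro sum.cong refl) (simp only: corr_eq)
    also have "\<dots> \<le> (\<Sum>u\<in>UNIV. (cmod (\<Sum>v\<in>UNIV. b v * a (v + u)))\<^sup>2)" by (rule sum_mono2) auto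
    also have "\<dots> \<le> (?k * u3norm f ?T)\<^sup>2 * (\<Sum>x\<in>UNIV. (cmod (a x))\<^sup>2)"
      by (rule sum_correlation_le[OF b_le])
    also have "(\<Sum>x\<in>UNIV. (cmod (a x))\<^sup>2) = (\<Sum>x\<in>W'. (cmod (a x))\<^sup>2)"
      by (rule sum.mono_neutral_right) (auto simp: a_def)
    also have "(?k * u3norm f ?T)\<^sup>2 * \<dots> \<le> (?k * u3norm f ?T)\<^sup>2 * (\<Sum>x\<in>W'. 1)"
      by (intro mult_left_mono sum_mono power_le_one) (auto simp: a_def norm_mult f)
    also have "\<dots> = ?k ^ 3 * (u3norm f ?T * u3norm f ?T)" by (simp add: power2_eq_square power3_eq_cube mult_ac)
    \<comment> \<open>The norm is at most 1, so its square may be replaced by the norm itself; the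
      conclusion then concerns the mean of the norms.\<close>
    also have "\<dots> \<le> ?k ^ 3 * (1 * u3norm f ?T)"
      using u3norm_nonneg[of f ?T] u3norm_le_1[of ?T f] f by (intro mult_left_mono mult_right_mono) auto
    finally show "(\<Sum>u\<in>W'. (cmod (\<Sum>v\<in>W'. G (s + u) (t + v)))\<^sup>2) \<le> ?k ^ 3 * u3norm f ?T" by simp
  qed
  also have "\<dots> = ?k ^ 3 * (\<Sum>t\<in>UNIV. u3norm f ((\<lambda>w. t + w) ` W'))" by (simp only: sum_distrib_left)
  finally have "\<sigma> * N \<le> (\<Sum>t\<in>UNIV. u3norm f ((\<lambda>w. t + w) ` W'))" using k0 by simp
  then show ?thesis using W' W'W card_W' by (intro that)
qed

end

section \<open>Prime fields and the inverse theorem\<close>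

text \<open>Translation by 1 permutes the ring, so adding 1 to every element leaves the total
  unchanged.\<close>

lemma of_nat_CARD_eq_0: "of_nat CARD('a::{ring_1,finite}) = (0::'a)"
proof -
  have "(\<Sum>x\<in>UNIV. x + 1) = (\<Sum>x\<in>(UNIV :: 'a set). x)" by (rule sum_UNIV_shift(1)[of "\<lambda>x. x"])
  then show ?thesis by (simp add: sum.distrib)
qed

lemma CHAR_eq_CARD:
  assumes "prime CARD('F::{field,finite})"
  shows "CHAR('F) = CARD('F)"
proof -
  have "CHAR('F) dvd CARD('F)"
    by (rule of_nat_eq_0_iff_char_dvd[THEN iffD1]) (rule of_nat_CARD_eq_0)
  then show ?thesis using assms CHAR_not_1'[where ?'a = 'F] by (auto simp: prime_nat_iff)
qed

lemma bij_betw_of_nat_prime_field: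
  assumes "prime CARD('F::{field,finite})"
  shows "bij_betw of_nat {..<CARD('F)} (UNIV :: 'F set)"
proof -
  have "inj_on (of_nat :: nat \<Rightarrow> 'F) {..<CARD('F)}"
  proof (rule linorder_inj_onI)
    fix i j assume ij: "i < j" "j \<in> {..<CARD('F)}"
    then have "\<not> CARD('F) dvd j - i" by (auto dest!: dvd_imp_le)
    then have "(of_nat (j - i) :: 'F) \<noteq> 0"
      by (simp add: of_nat_eq_0_iff_char_dvd CHAR_eq_CARD[OF assms])
    then show "(of_nat i :: 'F) \<noteq> of_nat j" using ij by (simp add: of_nat_diff)
  qed auto
  then show ?thesis
    unfolding bij_betw_def by (intro conjI card_subset_eq) (auto simp: card_image)
qed

lemma echar_of_nat [simp]: "echar (real k) = 1"
  by (simp add: echar_eq_1_iff rcong_altdef) (metis add.right_inverse of_int_minus of_int_of_nat_eq)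

lemma additive_character_prime_field:
  assumes p: "prime CARD('F::{field,finite})"
  shows "additive_character (\<lambda>a :: 'F. echar (real (inv_into {..<CARD('F)} of_nat a) / real CARD('F)))"
proof -
  let ?p = "CARD('F)"
  define val where "val = inv_into {..<?p} (of_nat :: nat \<Rightarrow> 'F)"
  have val: "of_nat (val a) = a" for a
    unfolding val_def using bij_betw_of_nat_prime_field[OF p] by (simp add: bij_betw_def f_inv_into_f)
  have p1: "?p > 1" using prime_gt_1_nat[OF p] .
  \<comment> \<open>The value depends only on the residue class, so the chosen representatives need
    not be additive.\<close>
  have cong: "echar (real k / real ?p) = echar (real l / real ?p)" if "(of_nat k :: 'F) = of_nat l" for k l
    using that
  proof (induction k l rule: linorder_wlog)
    case (le k l)
    then have "(of_nat (l - k) :: 'F) = 0" by (simp add: of_nat_diff)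
    then have "?p dvd l - k" using of_nat_eq_0_iff_char_dvd CHAR_eq_CARD[OF p] by metis
    then obtain m where "l - k = ?p * m" by blast
    then have "l = k + ?p * m" using le by simp
    then have "real l / real ?p = real k / real ?p + real m" using p1 by (simp add: field_simps)
    then show ?case by (simp add: echar_add)
  qed simp
  have "echar (real (val 1) / real ?p) = echar (real 1 / real ?p)" by (rule cong) (simp add: val)
  moreover have "echar (1 / real ?p) \<noteq> 1"
  proof
    assume "echar (1 / real ?p) = 1"
    then obtain m where "0 = 1 / real ?p + of_int m * 1"
      unfolding echar_eq_1_iff rcong_altdef by blast
    then have n: "1 / real ?p = of_int (- m)" by simp
    have "0 < 1 / real ?p" "1 / real ?p < 1" using p1 by (simp_all add: divide_less_eq)
    then have "0 < - m" "- m < 1" unfolding n by linarith+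
    then show False by linarith
  qed
  ultimately have "\<exists>a. echar (real (val a) / real ?p) \<noteq> 1" by (intro exI[of _ 1]) simp
  moreover have "echar (real (val (a + b)) / real ?p) = echar (real (val a) / real ?p) * echar (real (val b) / real ?p)" for a b
  proof -
    have "echar (real (val (a + b)) / real ?p) = echar (real (val a + val b) / real ?p)"
      by (rule cong) (simp add: val)
    then show ?thesis by (simp add: add_divide_distrib echar_add)
  qed
  ultimately show ?thesis unfolding additive_character_def val_def[symmetric] by auto
qed

text \<open>Over a prime field every scalar is an iterated sum of 1.\<close>

lemma additive_imp_homogeneous_prime_field:
  fixes M :: "'F::{field,finite} ^ 'n \<Rightarrow> 'F ^ 'm"
  assumes p: "prime CARD('F)" and M: "\<And>x y. M (x + y) = M x + M y"
  shows "M (c *s x) = c *s M x"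
proof -
  have "M 0 = 0" using M[of 0 0] by simp
  then have "M (of_nat k *s x) = of_nat k *s M x" for k
    by (induction k) (simp_all add: vec.scale_left_distrib M)
  moreover obtain k where "c = of_nat k"
    using bij_betw_of_nat_prime_field[OF p] unfolding bij_betw_def by blast
  ultimately show ?thesis by simp
qed

section \<open>Cardinality and dimension of subspaces\<close>

lemma card_span_independent:
  fixes B :: "('F::{field,finite} ^ 'n) set"
  assumes "finite B" "vec.independent B"
  shows "card (vec.span B) = CARD('F) ^ card B"
  using assms
proof (induction B rule: finite_induct)
  case (insert a B)
  then have a: "a \<notin> vec.span B" and ind: "vec.independent B" by (auto simp: vec.independent_insert)
  have "inj_on (\<lambda>(k, x). k *s a + x) (UNIV \<times> vec.span B)"
  proof (rule inj_onI, clarify)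
    fix k x k' x' assume x: "x \<in> vec.span B" "x' \<in> vec.span B" and eq: "k *s a + x = k' *s a + x'"
    then have eq': "(k - k') *s a = x' - x" by (simp add: vec.scale_left_diff_distrib algebra_simps)
    have "k = k'"
    proof (rule ccontr)
      assume "k \<noteq> k'"
      then have "a = (inverse (k - k') * (k - k')) *s a" by simp
      also have "\<dots> = inverse (k - k') *s ((k - k') *s a)" by (simp only: vec.scale_scale)
      also have "\<dots> \<in> vec.span B" unfolding eq' using x by (intro vec.span_scale vec.span_diff)
      finally show False using a by simp
    qed
    then show "k = k' \<and> x = x'" using eq by simp
  qed
  moreover have "vec.span (insert a B) = (\<lambda>(k, x). k *s a + x) ` (UNIV \<times> vec.span B)"
  proof (intro equalityI subsetI)
    fix y assume "y \<in> vec.span (insert a B)"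
    then obtain k where "y - k *s a \<in> vec.span B" unfolding vec.span_insert by blast
    then show "y \<in> (\<lambda>(k, x). k *s a + x) ` (UNIV \<times> vec.span B)"
      by (intro image_eqI[of _ _ "(k, y - k *s a)"]) auto
  next
    fix y assume "y \<in> (\<lambda>(k, x). k *s a + x) ` (UNIV \<times> vec.span B)"
    then obtain k x where "y = k *s a + x" "x \<in> vec.span B" by auto
    then show "y \<in> vec.span (insert a B)" unfolding vec.span_insert by (auto intro!: exI[of _ k])
  qed
  ultimately have "card (vec.span (insert a B)) = CARD('F) * card (vec.span B)"
    by (simp add: card_image card_cartesian_product)
  then show ?case using insert ind by simp
qed simp

lemma card_subspace:
  fixes W :: "('F::{field,finite} ^ 'n) set"
  assumes "vec.subspace W"
  shows "card W = CARD('F) ^ vec.dim W"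
proof -
  obtain B where B: "B \<subseteq> W" "vec.independent B" "W \<subseteq> vec.span B" "card B = vec.dim W"
    using vec.basis_exists[of W] by blast
  have "vec.span B = W" using B assms by (simp add: vec.span_subspace)
  moreover have "finite B" by simp
  ultimately show ?thesis using card_span_independent B by metis
qed

section \<open>The inverse theorem\<close>

context additive_character
begin

text \<open>The eighth power of the U^3 norm is the mean over h of the fourth power of the U^2 norm
  of a derivative, and \<xi> h is a frequency at which the transform of that derivative is
  largest.\<close>

lemma derivative_correlations:
  fixes f :: "'F ^ 'n \<Rightarrow> complex"
  assumes f: "\<And>x. cmod (f x) \<le> 1" and \<eta>: "0 \<le> \<eta>" "\<eta> \<le> U3norm f"
  obtains \<xi> where "\<eta> ^ 8 * real CARD('F ^ 'n) ^ 3 \<le>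
    (\<Sum>h\<in>UNIV. (cmod (\<Sum>x\<in>UNIV. f (x + h) * cnj (f x) * cnj (ch (\<xi> h) x)))\<^sup>2)"
proof -
  let ?N = "real CARD('F ^ 'n)"
  have N0: "?N > 0" by (simp only: of_nat_0_less_iff finite_UNIV_card_ge_0 finite)
  define D where "D h x = f x * cnj (f (x + h))" for h x
  have D_le: "cmod (D h x) \<le> 1" for h x by (simp add: D_def norm_mult f mult_le_one)
  have "\<exists>r. \<forall>r'. cmod (\<Sum>x\<in>UNIV. D h x * ch r' x) \<le> cmod (\<Sum>x\<in>UNIV. D h x * ch r x)" for h
  proof -
    define F where "F r = cmod (\<Sum>x\<in>UNIV. D h x * ch r x)" for r
    have "Max (range F) \<in> range F" by (rule Max_in) auto
    then obtain r where "F r = Max (range F)" by (metis rangeE)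
    then have "F r' \<le> F r" for r' by simp
    then show ?thesis unfolding F_def by blast
  qed
  then obtain \<xi> where \<xi>: "\<And>h r. cmod (\<Sum>x\<in>UNIV. D h x * ch r x) \<le> cmod (\<Sum>x\<in>UNIV. D h x * ch (\<xi> h) x)"
    by metis
  \<comment> \<open>\<open>D h\<close> is the conjugate of f(x + h) cnj f(x), so the character
    becomes conjugated as well.\<close>
  have D_eq: "cmod (\<Sum>x\<in>UNIV. D h x * ch (\<xi> h) x) = cmod (\<Sum>x\<in>UNIV. f (x + h) * cnj (f x) * cnj (ch (\<xi> h) x))" for h
  proof -
    have "cnj (\<Sum>x\<in>UNIV. D h x * ch (\<xi> h) x) = (\<Sum>x\<in>UNIV. f (x + h) * cnj (f x) * cnj (ch (\<xi> h) x))"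
      by (simp add: D_def mult_ac)
    then show ?thesis by (metis complex_mod_cnj)
  qed
  have "\<eta> ^ 8 \<le> U3norm f ^ 8" using \<eta> by (intro power_mono)
  also have "\<dots> = Re (U3avg f)" by (metis Re_complex_of_real U3norm_power8)
  also have "\<dots> = (\<Sum>h\<in>UNIV. \<Sum>h2\<in>UNIV. (cmod (\<Sum>x\<in>UNIV. D h x * cnj (D h (x + h2))))\<^sup>2) / ?N ^ 4"
    unfolding U3avg_eq D_def by (simp add: eval_nat_numeral mult_ac add_ac)
  finally have "\<eta> ^ 8 * ?N ^ 4 \<le> (\<Sum>h\<in>UNIV. \<Sum>h2\<in>UNIV. (cmod (\<Sum>x\<in>UNIV. D h x * cnj (D h (x + h2))))\<^sup>2)"
    using N0 by (simp add: field_simps del: CARD_vec)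
  also have "\<dots> \<le> (\<Sum>h\<in>UNIV. (cmod (\<Sum>x\<in>UNIV. D h x * ch (\<xi> h) x))\<^sup>2 * ?N)"
  proof (rule sum_mono)
    fix h
    have "(\<Sum>h2\<in>UNIV. (cmod (\<Sum>x\<in>UNIV. D h x * cnj (D h (x + h2))))\<^sup>2) \<le>
        (cmod (\<Sum>x\<in>UNIV. D h x * ch (\<xi> h) x))\<^sup>2 * (\<Sum>x\<in>UNIV. (cmod (cnj (D h x)))\<^sup>2)"
      by (rule sum_correlation_le[OF \<xi>])
    also have "\<dots> \<le> (cmod (\<Sum>x\<in>UNIV. D h x * ch (\<xi> h) x))\<^sup>2 * (\<Sum>x\<in>(UNIV :: ('F ^ 'n) set). 1)"
      using D_le by (intro mult_left_mono sum_mono power_le_one) auto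
    finally show "(\<Sum>h2\<in>UNIV. (cmod (\<Sum>x\<in>UNIV. D h x * cnj (D h (x + h2))))\<^sup>2) \<le>
        (cmod (\<Sum>x\<in>UNIV. D h x * ch (\<xi> h) x))\<^sup>2 * ?N" by simp
  qed
  finally have "(\<eta> ^ 8 * ?N ^ 3) * ?N \<le> (\<Sum>h\<in>UNIV. (cmod (\<Sum>x\<in>UNIV. D h x * ch (\<xi> h) x))\<^sup>2) * ?N"
    by (simp add: eval_nat_numeral mult_ac del: CARD_vec flip: sum_distrib_left)
  then have "\<eta> ^ 8 * ?N ^ 3 \<le> (\<Sum>h\<in>UNIV. (cmod (\<Sum>x\<in>UNIV. D h x * ch (\<xi> h) x))\<^sup>2)"
    using N0 by (simp del: CARD_vec)
  then show ?thesis unfolding D_eq by (rule that)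
qed

lemma U3_inverse:
  fixes f :: "'F ^ 'n \<Rightarrow> complex"
  assumes p: "prime CARD('F)" "CARD('F) \<le> 8" "(2 :: 'F) \<noteq> 0"
    and f: "\<And>x. cmod (f x) \<le> 1" and \<eta>: "0 < \<eta>" "\<eta> \<le> 1" "\<eta> \<le> U3norm f"
  defines "\<alpha> \<equiv> ((\<eta> ^ 8 / 2) ^ 4) ^ 119 / 2 ^ 321"
  defines "\<sigma> \<equiv> \<alpha> * (\<eta> ^ 8 / 2)"
  obtains W where "vec.subspace W" "real CARD('n) - real (vec.dim W) \<le> 1 / \<alpha>\<^sup>2 + 1 / \<sigma>\<^sup>2"
    "\<sigma> * real CARD('F ^ 'n) \<le> (\<Sum>y\<in>UNIV. u3norm f ((\<lambda>w. y + w) ` W))"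
proof -
  let ?N = "real CARD('F ^ 'n)"
  have N0: "?N > 0" by (simp only: of_nat_0_less_iff finite_UNIV_card_ge_0 finite)
  define \<delta> where "\<delta> = \<eta> ^ 8 / 2"
  have \<delta>: "0 < \<delta>" "\<delta> \<le> 1" using \<eta> power_le_one[of \<eta> 8] by (auto simp: \<delta>_def)
  define c where "c = \<delta> ^ 4"
  have c: "0 < c" "c \<le> 1" using \<delta> by (auto simp: c_def power_le_one)
  have \<alpha>: "\<alpha> = c ^ 119 / 2 ^ 321" by (simp only: \<alpha>_def c_def \<delta>_def)
  have \<alpha>0: "\<alpha> > 0" using c by (simp add: \<alpha>)
  have \<sigma>: "\<sigma> = \<alpha> * \<delta>" by (simp only: \<sigma>_def \<delta>_def)
  have \<sigma>0: "\<sigma> > 0" using \<alpha>0 \<delta> by (simp add: \<sigma>)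
  obtain \<xi> where "\<eta> ^ 8 * ?N ^ 3 \<le>
      (\<Sum>h\<in>UNIV. (cmod (\<Sum>x\<in>UNIV. f (x + h) * cnj (f x) * cnj (ch (\<xi> h) x)))\<^sup>2)"
    by (rule derivative_correlations[OF f less_imp_le[OF \<eta>(1)] \<eta>(3)])
  moreover define m where "m h = (cmod (\<Sum>x\<in>UNIV. f (x + h) * cnj (f x) * cnj (ch (\<xi> h) x)))\<^sup>2" for h
  ultimately have sum_m: "2 * \<delta> * ?N ^ 3 \<le> (\<Sum>h\<in>UNIV. m h)" by (simp add: \<delta>_def)
  \<comment> \<open>Half of the average is the threshold; the shifts below it account for at most
    half of the total.\<close>
  define B where "B = {h. m h \<ge> \<delta> * ?N\<^sup>2}"
  have "(\<Sum>h\<in>UNIV. m h) = (\<Sum>h\<in>B. m h) + (\<Sum>h\<in>- B. m h)"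
    by (subst sum.union_disjoint[symmetric]) auto
  also have "(\<Sum>h\<in>- B. m h) \<le> (\<Sum>h\<in>- B. \<delta> * ?N\<^sup>2)" by (intro sum_mono) (auto simp: B_def)
  also have "\<dots> \<le> (\<Sum>h\<in>(UNIV :: ('F ^ 'n) set). \<delta> * ?N\<^sup>2)" using \<delta> by (intro sum_mono2) auto
  also have "\<dots> = \<delta> * ?N ^ 3" by (simp add: power2_eq_square power3_eq_cube)
  finally have sum_B: "\<delta> * ?N ^ 3 \<le> (\<Sum>h\<in>B. m h)" using sum_m by (simp del: CARD_vec)
  let ?Q = "{(d, h, k). h \<in> B \<and> h + d \<in> B \<and> k \<in> B \<and> k + d \<in> B \<and> \<xi> h + \<xi> (k + d) = \<xi> k + \<xi> (h + d)}"
  have "(\<delta> * ?N ^ 3) ^ 4 \<le> ?N ^ 9 * real (card ?Q)"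
    using sum_B \<delta> unfolding m_def by (intro card_additive_quadruples) (auto simp: f)
  then have "?N ^ 9 * (c * ?N ^ 3) \<le> ?N ^ 9 * real (card ?Q)"
    by (simp add: c_def power_mult_distrib mult_ac flip: power_mult power_add del: CARD_vec)
  then have quads: "c * ?N ^ 3 \<le> real (card ?Q)"
    using N0 by (subst (asm) mult_le_cancel_left_pos) (simp_all del: CARD_vec)
  obtain W M h0 P where W: "vec.subspace W" "real CARD('n) - real (vec.dim W) \<le> 1 / \<alpha>\<^sup>2"
    and M: "\<And>x y. M (x + y) = M x + M y" and P: "P \<subseteq> B"
      "\<And>h. h \<in> P \<Longrightarrow> h - h0 \<in> W \<and> \<xi> h = \<xi> h0 + M (h - h0)" "real (card P) \<ge> \<alpha> * real (card W)"
    by (rule linear_on_dense_coset[OF p(2) c quads, folded \<alpha>]) (rule that)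
  define G where "G w = (cmod (\<Sum>x\<in>UNIV. f (x + (h0 + w)) * cnj (f x) * cnj (ch (\<xi> h0 + M w) x)))\<^sup>2" for w
  \<comment> \<open>Each h in P retains correlation \<delta>N^2 and P has at least \<alpha> times as
    many elements as W, whence \<sigma> = \<alpha>\<delta>.\<close>
  have "\<sigma> * real (card W) * ?N\<^sup>2 = (\<alpha> * real (card W)) * (\<delta> * ?N\<^sup>2)" by (simp add: \<sigma>)
  also have "\<dots> \<le> real (card P) * (\<delta> * ?N\<^sup>2)" using P(3) \<delta> by (intro mult_right_mono) auto
  also have "\<dots> = (\<Sum>h\<in>P. \<delta> * ?N\<^sup>2)" by simp
  also have "\<dots> \<le> (\<Sum>h\<in>P. m h)" using P(1) by (intro sum_mono) (auto simp: B_def)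
  also have "\<dots> = (\<Sum>h\<in>P. G (h - h0))"
    using P(2) by (intro sum.cong) (auto simp: m_def G_def)
  also have "\<dots> = (\<Sum>w\<in>(\<lambda>h. h - h0) ` P. G w)"
    by (subst sum.reindex) (auto simp: inj_on_def)
  also have "\<dots> \<le> (\<Sum>w\<in>W. G w)" using P(2) by (intro sum_mono2) (auto simp: G_def)
  finally have corr: "\<sigma> * real (card W) * ?N\<^sup>2 \<le> (\<Sum>w\<in>W. G w)" .
  obtain W' where W': "vec.subspace W'" "W' \<subseteq> W" "\<sigma>\<^sup>2 * real (card W) \<le> real (card W')"
    and sum: "\<sigma> * ?N \<le> (\<Sum>t\<in>UNIV. u3norm f ((\<lambda>w. t + w) ` W'))"
    by (rule sum_u3norm_cosets[OF p(3) W(1) M additive_imp_homogeneous_prime_field[OF p(1) M] f \<sigma>0 corr[unfolded G_def]])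
  \<comment> \<open>The index of W' in W is at most 1/\<sigma>^2; the codimension j is bounded
    crudely by j < CARD('F)^j.\<close>
  have "real (vec.dim W) - real (vec.dim W') \<le> 1 / \<sigma>\<^sup>2"
  proof -
    define j where "j = vec.dim W - vec.dim W'"
    have dim: "vec.dim W = vec.dim W' + j" using vec.dim_subset[OF W'(2)] by (simp add: j_def)
    have q1: "CARD('F) > 1" using prime_gt_1_nat[OF p(1)] .
    have "(\<sigma>\<^sup>2 * real CARD('F) ^ j) * real CARD('F) ^ vec.dim W' \<le> 1 * real CARD('F) ^ vec.dim W'"
      using W'(3) unfolding card_subspace[OF W(1)] card_subspace[OF W'(1)] dim by (simp add: power_add mult_ac)
    then have "\<sigma>\<^sup>2 * real CARD('F) ^ j \<le> 1"
      using q1 by (subst (asm) mult_le_cancel_right_pos) auto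
    then have "real CARD('F) ^ j \<le> 1 / \<sigma>\<^sup>2" using \<sigma>0 by (simp add: field_simps)
    moreover have "j < CARD('F) ^ j" using q1 by (simp add: power_gt_expt)
    then have "real j \<le> real CARD('F) ^ j" by (simp flip: of_nat_power)
    ultimately show ?thesis unfolding dim of_nat_add by linarith
  qed
  then show ?thesis using W W' sum by (intro that[of W']) auto
qed

end

theorem theorem2p3:
  fixes C :: nat
  assumes F5: "CARD('F::{field,finite}) = 5"
    and C: "C = 2 ^ 16"
  shows
    "(\<forall>(f :: 'F ^ 'n \<Rightarrow> complex) (\<eta> :: real).
        (\<forall>x. f x \<in> {z. cmod z \<le> 1}) \<and> 0 < \<eta> \<and> \<eta> \<le> 1 \<and> U3norm f \<ge> \<eta> \<longrightarrow>
        (\<exists>W. vec.subspace W \<and>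
             real CARD('n) - real (vec.dim W) \<le> (2 / \<eta>) ^ C \<and>
             avg UNIV (\<lambda>y. u3norm f ((\<lambda>w. y + w) ` W)) \<ge> (\<eta> / 2) ^ C \<and>
             (\<exists>y. u3norm f ((\<lambda>w. y + w) ` W) \<ge> (\<eta> / 2) ^ C))) \<and>
     (\<forall>(W :: ('F ^ 'n) set) (f :: 'F ^ 'n \<Rightarrow> complex) (y :: 'F ^ 'n).
        vec.subspace W \<longrightarrow>
        U3norm f \<ge> u3norm f UNIV \<and>
        u3norm f UNIV \<ge> 1 / 5 ^ CARD('n) * real (card W) * u3norm f ((\<lambda>w. y + w) ` W))"
proof -
  have p: "prime CARD('F)" using F5 by simp
  obtain e :: "'F \<Rightarrow> complex" where "additive_character e"
    using additive_character_prime_field[OF p] by blast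
  then interpret additive_character e .
  have two: "(2 :: 'F) \<noteq> 0"
  proof
    assume "(2 :: 'F) = 0"
    then have "(of_nat 2 :: 'F) = 0" by simp
    then have "CHAR('F) dvd 2" by (simp only: of_nat_eq_0_iff_char_dvd)
    then show False by (simp add: CHAR_eq_CARD[OF p] F5)
  qed
  \<comment> \<open>8275 = 2 * 4137 + 1 is the exponent that the codimension bound needs.\<close>
  have C_ge: "8275 \<le> C" using C by simp
  let ?N = "real CARD('F ^ 'n)"
  have N0: "?N > 0" by (simp only: of_nat_0_less_iff finite_UNIV_card_ge_0 finite)
  have "\<exists>W. vec.subspace W \<and> real CARD('n) - real (vec.dim W) \<le> (2 / \<eta>) ^ C \<and>
      avg UNIV (\<lambda>y. u3norm f ((\<lambda>w. y + w) ` W)) \<ge> (\<eta> / 2) ^ C \<and>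
      (\<exists>y. u3norm f ((\<lambda>w. y + w) ` W) \<ge> (\<eta> / 2) ^ C)"
    if f: "\<And>x. cmod (f x) \<le> 1" and \<eta>: "0 < \<eta>" "\<eta> \<le> 1" "\<eta> \<le> U3norm f" for f :: "'F ^ 'n \<Rightarrow> complex" and \<eta>
  proof -
    \<comment> \<open>In terms of z = \<eta>/2 all constants are powers: \<eta>^8/2 \<ge> z^8 and
      1/2 \<ge> z give 8 * 4 * 119 + 321 = 4129 for \<alpha>, and 8 more for \<sigma>.\<close>
    define z where "z = \<eta> / 2"
    have z: "0 < z" "z \<le> 1 / 2" using \<eta> by (auto simp: z_def)
    define \<alpha> where "\<alpha> = ((\<eta> ^ 8 / 2) ^ 4) ^ 119 / 2 ^ 321"
    define \<sigma> where "\<sigma> = \<alpha> * (\<eta> ^ 8 / 2)"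
    obtain W where W: "vec.subspace W" "real CARD('n) - real (vec.dim W) \<le> 1 / \<alpha>\<^sup>2 + 1 / \<sigma>\<^sup>2"
      and sum: "\<sigma> * ?N \<le> (\<Sum>y\<in>UNIV. u3norm f ((\<lambda>w. y + w) ` W))"
      using U3_inverse[OF p _ two f \<eta>] F5 unfolding \<alpha>_def \<sigma>_def by auto
    have \<delta>: "z ^ 8 \<le> \<eta> ^ 8 / 2" using z by (simp add: z_def power_divide)
    have "z ^ 4129 = (((z ^ 8) ^ 4) ^ 119) * z ^ 321" by (simp flip: power_mult power_add)
    also have "\<dots> \<le> ((\<eta> ^ 8 / 2) ^ 4) ^ 119 * (1 / 2) ^ 321"
      using z \<delta> by (intro mult_mono power_mono) auto
    also have "\<dots> = \<alpha>" by (simp only: \<alpha>_def power_one_over times_divide_eq_right mult_1_right)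
    finally have \<alpha>: "z ^ 4129 \<le> \<alpha>" .
    have "0 \<le> \<alpha>" using z by (intro order_trans[OF _ \<alpha>]) simp
    have "z ^ 4137 = z ^ 4129 * z ^ 8" by (simp flip: power_add)
    also have "\<dots> \<le> \<sigma>" unfolding \<sigma>_def using z \<alpha> \<delta> \<open>0 \<le> \<alpha>\<close> by (intro mult_mono) auto
    finally have \<sigma>: "z ^ 4137 \<le> \<sigma>" .
    have inv: "1 / t\<^sup>2 \<le> 1 / (z ^ 4137)\<^sup>2" if "z ^ 4137 \<le> t" for t
      using z that by (intro divide_left_mono power_mono mult_pos_pos zero_less_power) (auto intro: less_le_trans[OF _ that])
    have "z ^ 4137 \<le> \<alpha>" using z by (intro order_trans[OF power_decreasing \<alpha>]) auto
    then have "1 / \<alpha>\<^sup>2 + 1 / \<sigma>\<^sup>2 \<le> 2 * (1 / (z ^ 4137)\<^sup>2)" using inv[of \<alpha>] inv[OF \<sigma>] by linarith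
    \<comment> \<open>The factor 2 from the two codimension terms is absorbed into one further power
      of 1/z.\<close>
    also have "\<dots> \<le> 1 / z * (1 / (z ^ 4137)\<^sup>2)"
      using z by (intro mult_right_mono) (auto simp: field_simps)
    also have "1 / (z ^ 4137)\<^sup>2 = (1 / z) ^ 8274" by (simp add: power_one_over flip: power_mult)
    also have "1 / z * (1 / z) ^ 8274 = (1 / z) ^ Suc 8274" by (rule power_Suc[symmetric])
    also have "\<dots> \<le> (1 / z) ^ C" using z C_ge by (intro power_increasing) (auto simp: field_simps)
    finally have codim: "real CARD('n) - real (vec.dim W) \<le> (2 / \<eta>) ^ C" using W by (simp add: z_def)
    have zC: "(\<eta> / 2) ^ C \<le> \<sigma>"
      unfolding z_def[symmetric] using z C_ge by (intro order_trans[OF power_decreasing \<sigma>]) auto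
    have avg: "\<sigma> \<le> avg UNIV (\<lambda>y. u3norm f ((\<lambda>w. y + w) ` W))"
      using sum N0 by (simp add: avg_def field_simps del: CARD_vec)
    obtain y where "(\<Sum>y\<in>UNIV. u3norm f ((\<lambda>w. y + w) ` W)) \<le> ?N * u3norm f ((\<lambda>w. y + w) ` W)"
      using ex_ge_average[of UNIV "\<lambda>y. u3norm f ((\<lambda>w. y + w) ` W)"] by auto
    with sum have "?N * \<sigma> \<le> ?N * u3norm f ((\<lambda>w. y + w) ` W)" by (simp only: mult.commute[of _ ?N])
    then have "\<sigma> \<le> u3norm f ((\<lambda>w. y + w) ` W)" using N0 by (subst (asm) mult_le_cancel_left_pos)
    with W codim avg zC show ?thesis by (intro exI[of _ W]) (auto intro: order_trans)
  qed
  moreover have "U3norm f \<ge> u3norm f UNIV \<and>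
      u3norm f UNIV \<ge> 1 / 5 ^ CARD('n) * real (card W) * u3norm f ((\<lambda>w. y + w) ` W)"
    if "vec.subspace W" for W and f :: "'F ^ 'n \<Rightarrow> complex" and y
    using u3norm_le_U3norm[of f] u3norm_coset_le[OF that, of f y] by (simp add: F5 field_simps)
  ultimately show ?thesis by simp
qed

end
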